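(* Let $(\Omega,\mathcal A,\mathcal R,\alpha)$ be a computable measurable space. Let $\mathrm{RN}$ be the partial function which maps every pair $(\lambda,\mu)$ with $\lambda\in\mathcal M$, $\mu\in\mathcal M_{<\infty}$ and $\mu\ll\lambda$ to the (unique) $h\in L^1(\lambda)$ such that $\mu(E)=\int_E h\,\mathrm d\lambda$ for all $E\in\sigma(\mathcal R)$, where the input $\lambda$ is represented by $\delta_{\mathcal M}$, the input $\mu$ by $\delta_{\mathcal M,<\infty}$, and the output $h$ by the multi-representation $\overline\delta$. Then $\mathrm{RN}\leq_W \mathrm{EC}$.
   Context: All names are infinite sequences over a fixed finite alphabet $\Sigma\supseteq\{0,1\}$; computability of (partial) functions on $\Sigma^{\mathbb N}$ (and tuples thereof) is Type-2 (Turing machine) computability. A representation of a set $M$ is a surjective partial map $\delta:\subseteq\Sigma^{\mathbb N}\to M$. For represented sets, a realizer of $f$ is a partial function $F$ on names with $f(\delta_1(y))=\delta_2(F(y))$ whenever $\delta_1(y)\in\mathrm{dom}(f)$. For functions $f,g$ between represented spaces, $f\leq_W g$ means: there are computable partial functions $K,H$ on names such that for every realizer $G$ of $g$, the map $p\mapsto K(p,G(H(p)))$ is a realizer of $f$. A computable measurable space is a tuple $(\Omega,\mathcal A,\mathcal R,\alpha)$ where $\mathcal R$ is a countable ring of subsets of $\Omega$ (contains $\emptyset$, closed under $\cup,\cap,\setminus$) with $\bigcup\mathcal R=\Omega$, $\mathcal A=\sigma(\mathcal R)$, and $\alpha:\mathbb N\to\mathcal R$ is a surjective numbering such that union, intersection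 and set difference are computable w.r.t. $\alpha$ (i.e. realized by computable functions on indices). $\mathcal M$ is the set of measures $\mu$ on $\mathcal A$ with $\mu(E)<\infty$ for all $E\in\mathcal R$; $\mathcal M_{<\infty}$ is the set of finite measures on $\mathcal A$. $\delta_{\mathcal M}(p)=\mu$ iff $p$ encodes a list of all $(u,n,v)\in\mathbb Q\times\mathbb N\times\mathbb Q$ with $u<\mu(\alpha(n))<v$. $\delta_{\mathcal M,<\infty}(p)=\mu$ iff $p=\langle p_1,p_2\rangle$ with $\delta_{\mathcal M}(p_1)=\mu$ and $p_2$ encodes a list of all $(u,v)\in\mathbb Q^2$ with $u<\mu(\Omega)<v$. A rational step function is a finite sum $\sum_{k=1}^j a_k\chi_{E_k}$ with $a_k\in\mathbb Q$, $E_k\in\mathcal R$; $\mathrm{RSF}$ denotes their set with a canonical numbering. For $\mu\in\mathcal M$, $\delta_\mu$ is the Cauchy representation of $L^1(\mu)$: $\delta_\mu(p)=f$ iff $p$ encodes a sequence $(s_0,s_1,\dots)$ of rational step functions with $\|s_i-f\|_\mu=\int|s_i-f|\,\mathrm d\mu\le 2^{-i}$ for all $i$. The multi-representation $\overline\delta$ of $\overline L=\bigcup_{\mu\in\mathcal M}L^1(\mu)$ is given by: for $\mu\in\mathcal M$ and $f\in L^1(\mu)$, $f\in\overline\delta(p)$ iff $f=\delta_\mu(p)$. (For $\mathrm{RN}$ this means the output name must be a $\delta_\lambda$-name of $h$.) $\mathrm{EC}$ is the identity map from $(2^{\mathbb N},\mathrm{En})$ to $(2^{\mathbb N},\mathrm{Cf})$,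 where $\mathrm{dom}(\mathrm{En})=\{0^{n_0}10^{n_1}10^{n_2}1\cdots\mid n_i\in\mathbb N,\ (n_i=n_j\neq0\Rightarrow i=j)\}$, $\mathrm{En}(p)=\{n\in\mathbb N\mid 10^{n+1}1\text{ is a subword of }p\}$, and $\mathrm{Cf}(p)=\{n\in\mathbb N\mid p_n=1\}$ ($p_n$ the $n$-th symbol of $p$). *)

theory Defs
  imports "HOL-Analysis.Analysis" "HOL-Library.Nat_Bijection" "HOL-Library.Countable"
begin

section \<open>Type-2 Turing machines\<close>

text \<open>
  The alphabet is a type of sort \<open>{finite, zero_neq_one}\<close>, that is, a finite type with two
  distinguished distinct symbols \<open>0\<close> and \<open>1\<close>.
\<close>

type_synonym 'a name = "nat \<Rightarrow> 'a"

text \<open>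
  A machine has finitely many read-only input tapes with one-way heads, finitely many work tapes
  that are infinite in both directions, and a write-only one-way output tape.
  States are the numbers below \<open>n_states\<close> (start state 0), work symbols the numbers below
  \<open>n_symbols\<close> (blank 0).  A transition depends on the state and the scanned symbols; it yields the
  next state, for each input head whether it advances, for each work tape the symbol written and
  the head movement, and optionally one output symbol.  There are no halting states: only
  infinite outputs matter here, and a machine that wants to stop can loop without writing.
\<close>

record 'a t2_machine =
  n_inputs :: nat
  n_tapes :: nat
  n_states :: nat
  n_symbols :: nat
  trans :: "nat \<Rightarrow> 'a list \<Rightarrow> nat list \<Rightarrow> nat \<times> bool list \<times> (nat \<times> int) list \<times> 'a option"

definition t2_wf :: "'a::finite t2_machine \<Rightarrow> bool" where
  "t2_wf M \<longleftrightarrow> 0 < n_states M \<and> 0 < n_symbols M \<and>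
     (\<forall>q us ws. q < n_states M \<and> length us = n_inputs M \<and>
        length ws = n_tapes M \<and> set ws \<subseteq> {..<n_symbols M} \<longrightarrow>
        (case trans M q us ws of (q', adv, acts, out) \<Rightarrow>
           q' < n_states M \<and> length adv = n_inputs M \<and> length acts = n_tapes M \<and>
           set acts \<subseteq> {..<n_symbols M} \<times> {-1, 0, 1}))"

record 'a t2_config =
  state :: nat
  in_heads :: "nat list"
  tapes :: "((int \<Rightarrow> nat) \<times> int) list"
  out_tape :: "'a list"

definition t2_init :: "'a t2_machine \<Rightarrow> 'a t2_config" where
  "t2_init M = \<lparr>state = 0, in_heads = replicate (n_inputs M) 0,
     tapes = replicate (n_tapes M) (\<lambda>_. 0, 0), out_tape = []\<rparr>"

definition t2_step :: "'a t2_machine \<Rightarrow> 'a name list \<Rightarrow> 'a t2_config \<Rightarrow> 'a t2_config" where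
  "t2_step M ps c =
     (case trans M (state c) (map2 (\<lambda>p i. p i) ps (in_heads c)) (map (\<lambda>(t, h). t h) (tapes c)) of
        (q', adv, acts, out) \<Rightarrow>
          \<lparr>state = q',
           in_heads = map2 (\<lambda>a i. if a then Suc i else i) adv (in_heads c),
           tapes = map2 (\<lambda>(b, d) (t, h). (t(h := b), h + d)) acts (tapes c),
           out_tape = out_tape c @ (case out of None \<Rightarrow> [] | Some b \<Rightarrow> [b])\<rparr>)"

definition t2_run :: "'a t2_machine \<Rightarrow> 'a name list \<Rightarrow> nat \<Rightarrow> 'a t2_config" where
  "t2_run M ps t = (t2_step M ps ^^ t) (t2_init M)"

text \<open>The machine writes the infinite sequence \<open>r\<close> (a step writes at most one symbol).\<close>

definition t2_outputs :: "'a t2_machine \<Rightarrow> 'a name list \<Rightarrow> 'a name \<Rightarrow> bool" where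
  "t2_outputs M ps r \<longleftrightarrow> (\<forall>n. \<exists>t. out_tape (t2_run M ps t) = map r [0..<n])"

text \<open>The domain is exactly the set of inputs on which the output is infinite.\<close>

definition t2_computable :: "nat \<Rightarrow> ('a::finite name list \<rightharpoonup> 'a name) \<Rightarrow> bool" where
  "t2_computable k F \<longleftrightarrow> (\<exists>M. t2_wf M \<and> n_inputs M = k \<and>
     (\<forall>ps r. length ps = k \<longrightarrow> (F ps = Some r \<longleftrightarrow> t2_outputs M ps r)))"

section \<open>Realizers and Weihrauch reducibility\<close>

text \<open>
  A multi-representation maps a name to the set of objects it denotes; a representation is the
  case where every such set has at most one element, with the empty set for names outside the
  domain.
\<close>

type_synonym ('a, 'x) multirep = "'a name \<Rightarrow> 'x set"

definition realizes ::
    "('a name \<rightharpoonup> 'a name) \<Rightarrow> ('a, 'x) multirep \<times> ('a, 'y) multirep \<times> ('x \<rightharpoonup> 'y) \<Rightarrow> bool" where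
  "realizes F = (\<lambda>(\<delta>\<^sub>1, \<delta>\<^sub>2, f). \<forall>p x y. x \<in> \<delta>\<^sub>1 p \<and> f x = Some y \<longrightarrow> (\<exists>q. F p = Some q \<and> y \<in> \<delta>\<^sub>2 q))"

definition weihrauch_le ::
    "('a::finite, 'x) multirep \<times> ('a, 'y) multirep \<times> ('x \<rightharpoonup> 'y) \<Rightarrow>
     ('a, 'u) multirep \<times> ('a, 'v) multirep \<times> ('u \<rightharpoonup> 'v) \<Rightarrow> bool"  (infix "\<le>\<^sub>W" 50) where
  "f \<le>\<^sub>W g \<longleftrightarrow> (\<exists>(K :: 'a name \<Rightarrow> 'a name \<rightharpoonup> 'a name) (H :: 'a name \<rightharpoonup> 'a name).
     t2_computable 2 (\<lambda>ps. K (ps ! 0) (ps ! 1)) \<and> t2_computable 1 (\<lambda>ps. H (ps ! 0)) \<and>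
     (\<forall>G. realizes G g \<longrightarrow>
        realizes (\<lambda>p. Option.bind (H p) (\<lambda>q. Option.bind (G q) (\<lambda>r. K p r))) f))"

section \<open>Names of sequences and pairs\<close>

text \<open>\<open>seq_name s\<close> is the sequence \<open>0^(s 0) 1 0^(s 1) 1 0^(s 2) 1 \<dots>\<close>: its \<open>k\<close>-th symbol \<open>1\<close> ends
  the first \<open>k + 1\<close> blocks.\<close>

definition seq_name :: "(nat \<Rightarrow> nat) \<Rightarrow> 'a::zero_neq_one name" where
  "seq_name s = (\<lambda>i. if \<exists>k. Suc i = (\<Sum>j\<le>k. Suc (s j)) then 1 else 0)"

definition name_pair :: "'a name \<Rightarrow> 'a name \<Rightarrow> 'a name" where
  "name_pair p q = (\<lambda>i. if even i then p (i div 2) else q (i div 2))"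

definition prod_rep :: "('a, 'x) multirep \<Rightarrow> ('a, 'y) multirep \<Rightarrow> ('a, 'x \<times> 'y) multirep" where
  "prod_rep \<delta> \<delta>' = (\<lambda>r. {(x, y). \<exists>p q. r = name_pair p q \<and> x \<in> \<delta> p \<and> y \<in> \<delta>' q})"

section \<open>The problem EC\<close>

definition En :: "('a::zero_neq_one, nat set) multirep" where
  "En p = {A. (\<exists>s. p = seq_name s \<and> (\<forall>i j. s i = s j \<and> s i \<noteq> 0 \<longrightarrow> i = j)) \<and>
              A = {n. \<exists>i. map p [i..<i + (n + 3)] = [1] @ replicate (n + 1) 0 @ [1]}}"

definition Cf :: "('a::zero_neq_one, nat set) multirep" where
  "Cf p = {A. A = {n. p n = 1}}"

definition EC ::
    "('a::zero_neq_one, nat set) multirep \<times> ('a, nat set) multirep \<times> (nat set \<rightharpoonup> nat set)" where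
  "EC = (En, Cf, Some)"

section \<open>Computable functions on natural numbers\<close>

datatype recf = Zero | Succ | Proj nat | Comp recf "recf list" | Prec recf recf | Mu recf

inductive rec_eval :: "recf \<Rightarrow> nat list \<Rightarrow> nat \<Rightarrow> bool" where
  "rec_eval Zero xs 0"
| "rec_eval Succ [x] (Suc x)"
| "i < length xs \<Longrightarrow> rec_eval (Proj i) xs (xs ! i)"
| "list_all2 (\<lambda>g y. rec_eval g xs y) gs ys \<Longrightarrow> rec_eval f ys z \<Longrightarrow> rec_eval (Comp f gs) xs z"
| "rec_eval f xs z \<Longrightarrow> rec_eval (Prec f g) (0 # xs) z"
| "rec_eval (Prec f g) (n # xs) y \<Longrightarrow> rec_eval g (n # y # xs) z \<Longrightarrow>
     rec_eval (Prec f g) (Suc n # xs) z"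
| "rec_eval f (n # xs) 0 \<Longrightarrow> (\<And>m. m < n \<Longrightarrow> \<exists>y. rec_eval f (m # xs) (Suc y)) \<Longrightarrow>
     rec_eval (Mu f) xs n"

definition recursive2 :: "(nat \<Rightarrow> nat \<Rightarrow> nat) \<Rightarrow> bool" where
  "recursive2 f \<longleftrightarrow> (\<exists>e. \<forall>i j. rec_eval e [i, j] (f i j))"

section \<open>Computable measurable spaces and their measures\<close>

definition computable_measurable_space ::
    "'w set \<Rightarrow> 'w set set \<Rightarrow> 'w set set \<Rightarrow> (nat \<Rightarrow> 'w set) \<Rightarrow> bool" where
  "computable_measurable_space \<Omega> \<A> \<R> \<alpha> \<longleftrightarrow>
     ring_of_sets \<Omega> \<R> \<and> countable \<R> \<and> \<Union>\<R> = \<Omega> \<and> \<A> = sigma_sets \<Omega> \<R> \<and> range \<alpha> = \<R> \<and>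
     (\<exists>f. recursive2 f \<and> (\<forall>i j. \<alpha> (f i j) = \<alpha> i \<union> \<alpha> j)) \<and>
     (\<exists>f. recursive2 f \<and> (\<forall>i j. \<alpha> (f i j) = \<alpha> i \<inter> \<alpha> j)) \<and>
     (\<exists>f. recursive2 f \<and> (\<forall>i j. \<alpha> (f i j) = \<alpha> i - \<alpha> j))"

definition ring_finite_measures :: "'w set \<Rightarrow> 'w set set \<Rightarrow> 'w set set \<Rightarrow> 'w measure set" where
  "ring_finite_measures \<Omega> \<A> \<R> =
     {\<mu>. space \<mu> = \<Omega> \<and> sets \<mu> = \<A> \<and> (\<forall>E\<in>\<R>. emeasure \<mu> E < \<infinity>)}"

definition finite_measures :: "'w set \<Rightarrow> 'w set set \<Rightarrow> 'w measure set" where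
  "finite_measures \<Omega> \<A> = {\<mu>. space \<mu> = \<Omega> \<and> sets \<mu> = \<A> \<and> emeasure \<mu> \<Omega> < \<infinity>}"

text \<open>Rationals are numbered by the surjection \<open>nat_to_rat_surj\<close>; a sequence lists a set if the
  decoded values are exactly its elements.\<close>

definition decode_interval :: "nat \<Rightarrow> rat \<times> rat" where
  "decode_interval c = (case prod_decode c of (a, b) \<Rightarrow> (nat_to_rat_surj a, nat_to_rat_surj b))"

definition decode_bound :: "nat \<Rightarrow> rat \<times> nat \<times> rat" where
  "decode_bound c = (case prod_decode c of (a, d) \<Rightarrow> case prod_decode d of (n, b) \<Rightarrow>
     (nat_to_rat_surj a, n, nat_to_rat_surj b))"

definition rep_M ::
    "'w set \<Rightarrow> 'w set set \<Rightarrow> 'w set set \<Rightarrow> (nat \<Rightarrow> 'w set) \<Rightarrow> ('a::zero_neq_one, 'w measure) multirep" where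
  "rep_M \<Omega> \<A> \<R> \<alpha> p = {\<mu> \<in> ring_finite_measures \<Omega> \<A> \<R>. \<exists>s. p = seq_name s \<and>
     range (\<lambda>i. decode_bound (s i)) =
       {(u, n, v). of_rat u < measure \<mu> (\<alpha> n) \<and> measure \<mu> (\<alpha> n) < of_rat v}}"

definition rep_M_fin ::
    "'w set \<Rightarrow> 'w set set \<Rightarrow> 'w set set \<Rightarrow> (nat \<Rightarrow> 'w set) \<Rightarrow> ('a::zero_neq_one, 'w measure) multirep" where
  "rep_M_fin \<Omega> \<A> \<R> \<alpha> p = {\<mu> \<in> finite_measures \<Omega> \<A>. \<exists>p\<^sub>1 p\<^sub>2 s. p = name_pair p\<^sub>1 p\<^sub>2 \<and>
     \<mu> \<in> rep_M \<Omega> \<A> \<R> \<alpha> p\<^sub>1 \<and> p\<^sub>2 = seq_name s \<and>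
     range (\<lambda>i. decode_interval (s i)) =
       {(u, v). of_rat u < measure \<mu> \<Omega> \<and> measure \<mu> \<Omega> < of_rat v}}"

section \<open>The Cauchy representation of the spaces of integrable functions\<close>

definition L1_class :: "'w measure \<Rightarrow> ('w \<Rightarrow> real) \<Rightarrow> ('w \<Rightarrow> real) set" where
  "L1_class \<mu> f = {g. integrable \<mu> g \<and> (AE x in \<mu>. g x = f x)}"

definition L1 :: "'w measure \<Rightarrow> ('w \<Rightarrow> real) set set" where
  "L1 \<mu> = L1_class \<mu> ` {f. integrable \<mu> f}"

text \<open>The number \<open>c\<close> codes a list of pairs of (the number of) a rational coefficient and an index
  of a set in the ring.\<close>

definition rsf :: "(nat \<Rightarrow> 'w set) \<Rightarrow> nat \<Rightarrow> 'w \<Rightarrow> real" where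
  "rsf \<alpha> c x = (\<Sum>(a, n)\<leftarrow>map prod_decode (list_decode c). of_rat (nat_to_rat_surj a) * indicator (\<alpha> n) x)"

definition rep_L1 ::
    "(nat \<Rightarrow> 'w set) \<Rightarrow> 'w measure \<Rightarrow> ('a::zero_neq_one, ('w \<Rightarrow> real) set) multirep" where
  "rep_L1 \<alpha> \<mu> p = {h \<in> L1 \<mu>. \<exists>s. p = seq_name s \<and>
     (\<forall>i. \<forall>f\<in>h. (LINT x|\<mu>. \<bar>rsf \<alpha> (s i) x - f x\<bar>) \<le> 1 / 2 ^ i)}"

text \<open>
  An element of the union of all spaces \<open>L1 \<mu>\<close> carries the measure \<open>\<mu>\<close> it belongs to: a
  set of functions may be an element of \<open>L1 \<mu>\<close> for several \<open>\<mu>\<close>, with different Cauchy names.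
\<close>

definition rep_L1_union ::
    "'w set \<Rightarrow> 'w set set \<Rightarrow> 'w set set \<Rightarrow> (nat \<Rightarrow> 'w set) \<Rightarrow>
     ('a::zero_neq_one, 'w measure \<times> ('w \<Rightarrow> real) set) multirep" where
  "rep_L1_union \<Omega> \<A> \<R> \<alpha> p =
     {(\<mu>, h). \<mu> \<in> ring_finite_measures \<Omega> \<A> \<R> \<and> h \<in> rep_L1 \<alpha> \<mu> p}"

section \<open>The Radon-Nikodym operator\<close>

definition RN_fun ::
    "'w set \<Rightarrow> 'w set set \<Rightarrow> 'w set set \<Rightarrow>
     'w measure \<times> 'w measure \<rightharpoonup> 'w measure \<times> ('w \<Rightarrow> real) set" where
  "RN_fun \<Omega> \<A> \<R> = (\<lambda>(\<nu>, \<mu>).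
     if \<nu> \<in> ring_finite_measures \<Omega> \<A> \<R> \<and> \<mu> \<in> finite_measures \<Omega> \<A> \<and> absolutely_continuous \<nu> \<mu>
     then Some (\<nu>, THE h. h \<in> L1 \<nu> \<and> (\<forall>E\<in>\<A>. \<forall>f\<in>h. measure \<mu> E = (LINT x:E|\<nu>. f x)))
     else None)"

definition RN ::
    "'w set \<Rightarrow> 'w set set \<Rightarrow> 'w set set \<Rightarrow> (nat \<Rightarrow> 'w set) \<Rightarrow>
     ('a::zero_neq_one, 'w measure \<times> 'w measure) multirep \<times>
     ('a, 'w measure \<times> ('w \<Rightarrow> real) set) multirep \<times>
     ('w measure \<times> 'w measure \<rightharpoonup> 'w measure \<times> ('w \<Rightarrow> real) set)" where
  "RN \<Omega> \<A> \<R> \<alpha> =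
     (prod_rep (rep_M \<Omega> \<A> \<R> \<alpha>) (rep_M_fin \<Omega> \<A> \<R> \<alpha>), rep_L1_union \<Omega> \<A> \<R> \<alpha>, RN_fun \<Omega> \<A> \<R>)"

end

theory Submission
  imports Defs
begin

text \<open>
  The ring generates the sigma-algebra, so the \<open>L1\<close> norm of an integrable \<open>g\<close> is the
  supremum over \<open>A\<close>, \<open>C\<close> in the ring of the integral of \<open>g\<close> over \<open>A\<close> minus that over \<open>C - A\<close>. For a
  rational step function \<open>s\<close> and the density \<open>h\<close> of \<open>\<mu>\<close>, these integrals of \<open>g = s - h\<close> are combinations of
  values of the two measures on ring sets. Hence the set of all \<open>(s, i)\<close> such that \<open>s\<close> is
  farther than \<open>1 / 2 ^ i\<close> from \<open>h\<close> is enumerable from the names of the measures. Given the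
  characteristic function of this set, a Cauchy name of \<open>h\<close> is found by search, since the
  rational step functions are dense.

  The Turing machines come from programs over counters: a counter is a work tape that is used
  only through its head position, and recursive functions compile to such programs.
\<close>

text \<open>The test on the two names can confirm that a distance is large, whereas a Cauchy name
  has to certify that it is small. Closing this gap is the one use of EC, and a single question
  suffices because all pairs are coded in one set of numbers. Taking \<open>C - A\<close> instead of
  \<open>C\<close> keeps the two sets disjoint; with overlapping sets the difference of the
  integrals could exceed the norm and a close function would be declared far. All arithmetic stays
  in the natural numbers: negative coefficients move to the other side of the inequality, real
  values are compared by counting thresholds \<open>t / D\<close> that listed rational bounds pass,
  and the input read so far is a number given by its binary digits. Bounded sums then suffice to
  show that the test is recursive. Two formats shape the machines. A name for \<open>En\<close> may
  not repeat a nonzero block, so an element is written only at its first successful stage. The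
  answer of EC is read in a single pass, so the k-th approximation is whatever close function comes
  next with a precision index of at least k.\<close>

datatype cmd = Inc nat | Dec nat | Seq cmd cmd (infixr ";;" 60) | Loop nat cmd | IfRead cmd cmd | Emit bool

type_synonym cconf = "cmd list \<times> (nat \<Rightarrow> nat) \<times> nat \<times> bool list"

text \<open>Control is a stack of pending commands, which makes the semantics deterministic and
  small-step, as a machine requires. \<open>IfRead\<close> names no tape because each machine of the
  reduction reads a single one: the enumerator its only input, the scanner the answer of EC.\<close>

fun cstep :: "(nat \<Rightarrow> bool) \<Rightarrow> cconf \<Rightarrow> cconf" where
  "cstep b ([], s, i, w) = ([], s, i, w)"
| "cstep b (Inc r # k, s, i, w) = (k, s(r := Suc (s r)), i, w)"
| "cstep b (Dec r # k, s, i, w) = (k, s(r := s r - 1), i, w)"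
| "cstep b ((c ;; d) # k, s, i, w) = (c # d # k, s, i, w)"
| "cstep b (Loop r c # k, s, i, w) = (if s r = 0 then k else c # Loop r c # k, s, i, w)"
| "cstep b (IfRead c d # k, s, i, w) = ((if b i then c else d) # k, s, Suc i, w)"
| "cstep b (Emit x # k, s, i, w) = (k, s, i, w @ [x])"

section \<open>Compiling programs to machines\<close>

text \<open>Control is a stack, but a machine has finitely many states. A loop body returns to the
  stack from which the loop started, so the stacks that occur while \<open>c\<close> runs above
  \<open>k\<close> form this finite set; leaving \<open>c\<close> means reaching
  \<open>k\<close>.\<close>

primrec conts :: "cmd \<Rightarrow> cmd list \<Rightarrow> cmd list set" where
  "conts (Inc r) k = {Inc r # k}"
| "conts (Dec r) k = {Dec r # k}"
| "conts (c ;; d) k = insert ((c ;; d) # k) (conts c (d # k) \<union> conts d k)"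
| "conts (Loop r c) k = insert (Loop r c # k) (conts c (Loop r c # k))"
| "conts (IfRead c d) k = insert (IfRead c d # k) (conts c k \<union> conts d k)"
| "conts (Emit x) k = {Emit x # k}"

primrec regs :: "cmd \<Rightarrow> nat set" where
  "regs (Inc r) = {r}"
| "regs (Dec r) = {r}"
| "regs (c ;; d) = regs c \<union> regs d"
| "regs (Loop r c) = insert r (regs c)"
| "regs (IfRead c d) = regs c \<union> regs d"
| "regs (Emit x) = {}"

lemma finite_conts: "finite (conts c k)"
  by (induction c arbitrary: k) auto

lemma finite_regs: "finite (regs c)"
  by (induction c) auto

lemma conts_start: "c # k \<in> conts c k"
  by (cases c) auto

lemma conts_step:
  assumes "x \<in> conts c k"
  shows "fst (cstep b (x, s, i, w)) \<in> insert k (conts c k)"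
  using assms
proof (induction c arbitrary: k x)
  case (Seq c d)
  consider "x = (c ;; d) # k" | "x \<in> conts c (d # k)" | "x \<in> conts d k"
    using Seq.prems by auto
  then show ?case
  proof cases
    case 1
    then show ?thesis by (simp add: conts_start)
  next
    case 2
    then show ?thesis using Seq.IH(1)[OF 2] by (auto simp: conts_start)
  next
    case 3
    then show ?thesis using Seq.IH(2)[OF 3] by auto
  qed
next
  case (Loop r c)
  consider "x = Loop r c # k" | "x \<in> conts c (Loop r c # k)"
    using Loop.prems by auto
  then show ?case
  proof cases
    case 1
    then show ?thesis by (simp add: conts_start)
  next
    case 2
    then show ?thesis using Loop.IH[OF 2] by auto
  qed
next
  case (IfRead c d)
  consider "x = IfRead c d # k" | "x \<in> conts c k" | "x \<in> conts d k"
    using IfRead.prems by auto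
  then show ?case
  proof cases
    case 1
    then show ?thesis by (simp add: conts_start)
  next
    case 2
    then show ?thesis using IfRead.IH(1)[OF 2] by auto
  next
    case 3
    then show ?thesis using IfRead.IH(2)[OF 3] by auto
  qed
qed auto

lemma conts_regs: "x \<in> conts c k \<Longrightarrow> x \<noteq> [] \<and> regs (hd x) \<subseteq> regs c"
proof (induction c arbitrary: k)
  case (Seq c d)
  then show ?case using Seq.IH(1)[of "d # k"] Seq.IH(2)[of k] by auto
next
  case (IfRead c d)
  then show ?case using IfRead.IH(1)[of k] IfRead.IH(2)[of k] by auto
next
  case (Loop r c)
  then show ?case using Loop.IH[of "Loop r c # k"] by auto
qed auto

text \<open>The next stack depends on the counters only through their zero tests and on the input
  only through the scanned symbol, so a step from a dummy configuration with counters 0 and 1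
  computes it.\<close>

definition next_stack :: "cmd list \<Rightarrow> (nat \<Rightarrow> bool) \<Rightarrow> bool \<Rightarrow> cmd list" where
  "next_stack k z b = fst (cstep (\<lambda>_. b) (k, \<lambda>r. if z r then 0 else 1, 0, []))"

definition reads :: "cmd list \<Rightarrow> bool" where
  "reads k = (case k of IfRead _ _ # _ \<Rightarrow> True | _ \<Rightarrow> False)"

definition emits :: "cmd list \<Rightarrow> 'a::zero_neq_one option" where
  "emits k = (case k of Emit x # _ \<Rightarrow> Some (of_bool x) | _ \<Rightarrow> None)"

definition move :: "cmd list \<Rightarrow> nat \<Rightarrow> bool \<Rightarrow> int" where
  "move k r z = (case k of Inc r' # _ \<Rightarrow> (if r = r' then 1 else 0)
     | Dec r' # _ \<Rightarrow> (if r = r' \<and> \<not> z then -1 else 0) | _ \<Rightarrow> 0)"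

text \<open>A counter is the head position of a work tape whose only nonblank cell is the origin. State 0
  marks the origins; the other states number the control stacks.\<close>

definition machine_of ::
    "nat \<Rightarrow> nat \<Rightarrow> nat \<Rightarrow> nat \<Rightarrow> (cmd list \<Rightarrow> nat) \<Rightarrow> (nat \<Rightarrow> cmd list) \<Rightarrow> cmd \<Rightarrow> 'a::zero_neq_one t2_machine" where
  "machine_of k j R N e d c = \<lparr>n_inputs = k, n_tapes = R, n_states = Suc N, n_symbols = 2,
     trans = (\<lambda>q us ws. if q = 0 then (Suc (e [c]), replicate k False, replicate R (1, 0), None)
       else (Suc (e (next_stack (d (q - 1)) (\<lambda>r. ws ! r = 1) (us ! j = 1))),
             map (\<lambda>i. i = j \<and> reads (d (q - 1))) [0..<k],
             map (\<lambda>r. (ws ! r, move (d (q - 1)) r (ws ! r = 1))) [0..<R],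
             emits (d (q - 1))))\<rparr>"

definition machine_config :: "nat \<Rightarrow> nat \<Rightarrow> nat \<Rightarrow> (cmd list \<Rightarrow> nat) \<Rightarrow> cconf \<Rightarrow> 'a::zero_neq_one t2_config" where
  "machine_config k j R e = (\<lambda>(x, s, i, w). \<lparr>state = Suc (e x),
     in_heads = map (\<lambda>l. if l = j then i else 0) [0..<k],
     tapes = map (\<lambda>r. ((\<lambda>_. 0)(0 := 1), int (s r))) [0..<R], out_tape = map of_bool w\<rparr>)"

lemma map2_map_upt:
  "map2 f (map g [0..<n]) (map h [0..<n]) = map (\<lambda>i. f (g i) (h i)) [0..<n]"
  by (induction n) auto

lemma machine_config_step:
  fixes c :: cmd and ps :: "'a::{finite,zero_neq_one} name list"
  assumes j: "j < k" and ps: "length ps = k"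
    and d: "d (e x) = x" and x: "x \<noteq> [] \<Longrightarrow> regs (hd x) \<subseteq> {..<R}"
  shows "t2_step (machine_of k j R N e d c) ps (machine_config k j R e (x, s, i, w)) =
    machine_config k j R e (cstep (\<lambda>i. (ps ! j) i = 1) (x, s, i, w))"
proof -
  have us: "map2 (\<lambda>p i. p i) ps (map (\<lambda>l. if l = j then i else 0) [0..<k]) =
      map (\<lambda>l. (ps ! l) (if l = j then i else 0)) [0..<k]"
    using ps by (intro nth_equalityI) auto
  define us where "us = map (\<lambda>l. (ps ! l) (if l = j then i else 0)) [0..<k]"
  have usj: "us ! j = (ps ! j) i" using j by (simp add: us_def)
  define ws where "ws = map (\<lambda>(t, h). t h) (map (\<lambda>r. ((\<lambda>_. 0)(0 := 1) :: int \<Rightarrow> nat, int (s r))) [0..<R])"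
  have wsr: "ws ! r = (if s r = 0 then 1 else 0)" if "r < R" for r
    using that by (simp add: ws_def)
  have nxt: "next_stack x (\<lambda>r. ws ! r = 1) (us ! j = 1) = fst (cstep (\<lambda>i. (ps ! j) i = 1) (x, s, i, w))"
  proof (cases x)
    case (Cons y ys)
    then show ?thesis using x wsr usj by (cases y) (auto simp: next_stack_def)
  qed (auto simp: next_stack_def)
  obtain x' s' i' w' where st: "cstep (\<lambda>i. (ps ! j) i = 1) (x, s, i, w) = (x', s', i', w')"
    by (metis prod_cases4)
  have st': "i' = (if reads x then Suc i else i)" "map of_bool w' = map of_bool w @ (case emits x of None \<Rightarrow> [] | Some b \<Rightarrow> [b])"
    using st by (cases x; cases "hd x"; auto simp: reads_def emits_def)+
  have mv: "int (s' r) = int (s r) + move x r (ws ! r = 1)" if "r < R" for r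
    using st wsr[OF that] that by (cases x; cases "hd x"; auto simp: move_def split: if_splits)
  \<comment> \<open>Each transition writes back the scanned symbol, so the mark at the origin stays
    the only content of the tape.\<close>
  have tp: "(\<lambda>_. 0)(0 := 1, int (s r) := ws ! r) = ((\<lambda>_. 0)(0 := 1) :: int \<Rightarrow> nat)" if "r < R" for r
    using wsr[OF that] by auto
  show ?thesis
    unfolding st
    apply (simp add: t2_step_def machine_of_def machine_config_def us d)
    apply (simp add: us_def[symmetric] ws_def[symmetric, simplified] nxt st st' map2_map_upt)
    using mv tp nxt[unfolded st] by auto
qed

section \<open>Finite output tapes and the infinite output\<close>

lemma out_tape_step:
  "\<exists>v. out_tape (t2_step M ps c) = out_tape c @ v \<and> length v \<le> 1"
  by (auto simp: t2_step_def split: prod.splits option.splits)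

lemma out_tape_mono:
  "t \<le> t' \<Longrightarrow> \<exists>v. out_tape (t2_run M ps t') = out_tape (t2_run M ps t) @ v"
proof (induction t' rule: dec_induct)
  case (step n)
  then show ?case using out_tape_step[of M ps "t2_run M ps n"] by (auto simp: t2_run_def)
qed auto

lemma t2_outputs_unique:
  assumes "t2_outputs M ps r" "t2_outputs M ps r'"
  shows "r = r'"
proof
  fix n
  obtain t t' where t: "out_tape (t2_run M ps t) = map r [0..<Suc n]"
      and t': "out_tape (t2_run M ps t') = map r' [0..<Suc n]"
    using assms unfolding t2_outputs_def by metis
  have "map r [0..<Suc n] = map r' [0..<Suc n]"
  proof (cases "t \<le> t'")
    case True
    then show ?thesis using out_tape_mono[of t t' M ps] t t'
      by (metis append_Nil2 append_eq_append_conv length_map)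
  next
    case False
    then show ?thesis using out_tape_mono[of t' t M ps] t t'
      by (metis append_Nil2 append_eq_append_conv length_map nat_le_linear)
  qed
  then show "r n = r' n" by simp
qed

text \<open>\<open>t2_outputs\<close> asks for a time at which exactly \<open>n\<close> symbols are
  written, while simulations provide times with at least \<open>n\<close>. A step writes at most one
  symbol, so the first time with at least \<open>n\<close> symbols has exactly
  \<open>n\<close>.\<close>

lemma t2_outputsI:
  assumes "\<And>n. \<exists>t. n \<le> length (out_tape (t2_run M ps t)) \<and>
    out_tape (t2_run M ps t) = map r [0..<length (out_tape (t2_run M ps t))]"
  shows "t2_outputs M ps r"
  unfolding t2_outputs_def
proof
  fix n
  let ?L = "\<lambda>t. out_tape (t2_run M ps t)"
  obtain T where T: "n \<le> length (?L T)" "?L T = map r [0..<length (?L T)]" using assms by blast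
  define t where "t = (LEAST t. n \<le> length (?L t))"
  have t: "n \<le> length (?L t)" unfolding t_def using T(1) by (rule LeastI)
  have tT: "t \<le> T" unfolding t_def using T(1) by (rule Least_le)
  have len: "length (?L t) = n"
  proof (cases t)
    case 0
    then show ?thesis using t by (simp add: t2_run_def t2_init_def)
  next
    case (Suc t')
    then have "length (?L t') < n" using not_less_Least[of t' "\<lambda>t. n \<le> length (?L t)"] t_def by force
    moreover have "length (?L t) \<le> length (?L t') + 1"
      using out_tape_step[of M ps "t2_run M ps t'"] Suc by (auto simp: t2_run_def)
    ultimately show ?thesis using t by simp
  qed
  have "?L t = take n (?L T)" using out_tape_mono[OF tT, of M ps] len by auto
  also have "\<dots> = take n (map r [0..<length (?L T)])" using T(2) by simp
  also have "\<dots> = map r [0..<n]" using T(1) by (simp add: take_map)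
  finally show "\<exists>t. ?L t = map r [0..<n]" by blast
qed

theorem program_computable:
  fixes c :: cmd
  assumes j: "j < k"
  obtains F :: "'a::{finite,zero_neq_one} name list \<rightharpoonup> 'a name" where "t2_computable k F"
    and "\<And>ps r. length ps = k \<Longrightarrow>
      (\<And>n. \<exists>t x s i w. (cstep (\<lambda>i. (ps ! j) i = 1) ^^ t) ([c], \<lambda>_. 0, 0, []) = (x, s, i, w) \<and>
         n \<le> length w \<and> map of_bool w = map r [0..<length w]) \<Longrightarrow> F ps = Some r"
proof -
  \<comment> \<open>The empty stack is a state as well: a program that ends stays there, and the
    machine idles without writing.\<close>
  define S where "S = insert [] (conts c [])"
  have fin: "finite S" by (simp add: S_def finite_conts)
  then obtain e where e: "bij_betw e S {0..<card S}" using ex_bij_betw_finite_nat by blast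
  define d where "d = inv_into S e"
  have de: "d (e x) = x" if "x \<in> S" for x
    using that e by (simp add: d_def bij_betw_inv_into_left)
  have dS: "d q \<in> S" if "q < card S" for q
    using that bij_betw_inv_into[OF e] by (force simp: d_def bij_betw_def)
  have eS: "e x < card S" if "x \<in> S" for x
    using that e by (force simp: bij_betw_def)
  have stepS: "fst (cstep b (x, s, i, w)) \<in> S" if "x \<in> S" for b x s i w
    using that conts_step[of x c "[]" b s i w] unfolding S_def by auto
  have startS: "[c] \<in> S" by (simp add: S_def conts_start)
  define R where "R = Suc (Max (insert 0 (regs c)))"
  have R: "regs c \<subseteq> {..<R}"
    using finite_regs[of c] by (auto simp: R_def less_Suc_eq_le)
  have regS: "regs (hd x) \<subseteq> {..<R}" if "x \<in> S" "x \<noteq> []" for x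
    using that conts_regs[of x c "[]"] R by (auto simp: S_def)
  define M :: "'a t2_machine" where "M = machine_of k j R (card S) e d c"
  have wf: "t2_wf M"
    unfolding t2_wf_def
  proof (intro conjI allI impI)
    fix q ws and us :: "'a list" assume A: "q < n_states M \<and> length us = n_inputs M \<and>
        length ws = n_tapes M \<and> set ws \<subseteq> {..<n_symbols M}"
    have "e (next_stack (d (q - 1)) z b) < card S" if "q \<noteq> 0" for z b
      using A that unfolding next_stack_def
      by (intro eS stepS dS) (auto simp: M_def machine_of_def)
    moreover have "e [c] < card S" using eS startS by blast
    moreover have "move (d (q - 1)) r (ws ! r = 1) = -1 \<or> move (d (q - 1)) r (ws ! r = 1) = 0 \<or>
        move (d (q - 1)) r (ws ! r = 1) = 1" for r
      by (auto simp: move_def split: list.splits cmd.splits)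
    moreover have "ws ! r < 2" if "r < R" for r
    proof -
      have "ws ! r \<in> set ws" "set ws \<subseteq> {..<2}" using A that by (auto simp: M_def machine_of_def)
      then show ?thesis by auto
    qed
    ultimately show "case trans M q us ws of (q', adv, acts, out) \<Rightarrow>
           q' < n_states M \<and> length adv = n_inputs M \<and> length acts = n_tapes M \<and>
           set acts \<subseteq> {..<n_symbols M} \<times> {-1, 0, 1}"
      using A by (auto simp: M_def machine_of_def)
  qed (auto simp: M_def machine_of_def)
  have n_inputs: "n_inputs M = k" by (simp add: M_def machine_of_def)
  \<comment> \<open>The machine is one step ahead, since state 0 spends a step on marking the
    origins.\<close>
  have run: "t2_run M ps (Suc t) = machine_config k j R e ((cstep (\<lambda>i. (ps ! j) i = 1) ^^ t) ([c], \<lambda>_. 0, 0, [])) \<and>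
      fst ((cstep (\<lambda>i. (ps ! j) i = 1) ^^ t) ([c], \<lambda>_. 0, 0, [])) \<in> S" if ps: "length ps = k" for ps t
  proof (induction t)
    case 0
    have replicate: "replicate n y = map (\<lambda>_. y) [0..<n]" for n and y :: 'b
      by (simp add: map_replicate_const)
    show ?case using startS
      by (simp add: t2_run_def t2_step_def t2_init_def machine_config_def M_def machine_of_def replicate map2_map_upt
          del: map_replicate_trivial cong: map_cong)
  next
    case (Suc t)
    obtain x s i w where X: "(cstep (\<lambda>i. (ps ! j) i = 1) ^^ t) ([c], \<lambda>_. 0, 0, []) = (x, s, i, w)"
      by (metis prod_cases4)
    have xS: "x \<in> S" using Suc X by simp
    have "t2_run M ps (Suc (Suc t)) = t2_step M ps (machine_config k j R e (x, s, i, w))"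
      using Suc X by (simp add: t2_run_def)
    also have "\<dots> = machine_config k j R e (cstep (\<lambda>i. (ps ! j) i = 1) (x, s, i, w))"
      unfolding M_def using regS[OF xS] by (intro machine_config_step j ps de xS)
    finally show ?case using X stepS[OF xS] by simp
  qed
  define F :: "'a name list \<rightharpoonup> 'a name" where
    "F ps = (if \<exists>r. t2_outputs M ps r then Some (THE r. t2_outputs M ps r) else None)" for ps
  have F: "F ps = Some r \<longleftrightarrow> t2_outputs M ps r" for ps r
    using theI[of "t2_outputs M ps"] t2_outputs_unique[of M ps] unfolding F_def
    by (auto intro!: the_equality)
  show thesis
  proof
    show "t2_computable k F" unfolding t2_computable_def using wf n_inputs F by blast
  next
    fix ps :: "'a name list" and r :: "'a name"
    assume ps: "length ps = k"
      and out: "\<And>n. \<exists>t x s i w. (cstep (\<lambda>i. (ps ! j) i = 1) ^^ t) ([c], \<lambda>_. 0, 0, []) = (x, s, i, w) \<and>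
         n \<le> length w \<and> map of_bool w = map r [0..<length w]"
    have "t2_outputs M ps r"
    proof (rule t2_outputsI)
      fix n
      obtain t x s i w where *: "(cstep (\<lambda>i. (ps ! j) i = 1) ^^ t) ([c], \<lambda>_. 0, 0, []) = (x, s, i, w)"
        "n \<le> length w" "map of_bool w = map r [0..<length w]" using out by blast
      have "out_tape (t2_run M ps (Suc t)) = map of_bool w"
        using run[OF ps, of t] * by (simp add: machine_config_def)
      then show "\<exists>t. n \<le> length (out_tape (t2_run M ps t)) \<and>
          out_tape (t2_run M ps t) = map r [0..<length (out_tape (t2_run M ps t))]"
        using * by (intro exI[of _ "Suc t"]) simp
    qed
    then show "F ps = Some r" using F by blast
  qed
qed

section \<open>Programs that halt\<close>

text \<open>Quantifying over the rest \<open>k\<close> of the stack makes the relation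
  compositional: the same run serves in every context.\<close>

definition runs :: "(nat \<Rightarrow> bool) \<Rightarrow> cmd \<Rightarrow> (nat \<Rightarrow> nat) \<times> nat \<times> bool list \<Rightarrow> (nat \<Rightarrow> nat) \<times> nat \<times> bool list \<Rightarrow> bool" where
  "runs b c v v' \<longleftrightarrow> (\<forall>k. \<exists>t. (cstep b ^^ t) (c # k, v) = (k, v'))"

lemma funpow_trans: "(f ^^ t) x = y \<Longrightarrow> (f ^^ t') y = z \<Longrightarrow> (f ^^ (t' + t)) x = z"
  by (simp add: funpow_add)

lemma runs_step:
  assumes "\<And>k. \<exists>t. (cstep b ^^ t) (cstep b (c # k, v)) = (k, v')"
  shows "runs b c v v'"
  unfolding runs_def
proof
  fix k
  obtain t where "(cstep b ^^ t) (cstep b (c # k, v)) = (k, v')" using assms by blast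
  then show "\<exists>t. (cstep b ^^ t) (c # k, v) = (k, v')"
    by (intro exI[of _ "Suc t"]) (simp add: funpow_swap1)
qed

lemma runs_Inc: "runs b (Inc r) (s, i, w) (s(r := Suc (s r)), i, w)"
  by (rule runs_step) (auto intro!: exI[of _ 0])

lemma runs_Dec: "runs b (Dec r) (s, i, w) (s(r := s r - 1), i, w)"
  by (rule runs_step) (auto intro!: exI[of _ 0])

lemma runs_Emit: "runs b (Emit x) (s, i, w) (s, i, w @ [x])"
  by (rule runs_step) (auto intro!: exI[of _ 0])

lemma runs_Seq:
  assumes "runs b c v v1" "runs b d v1 v2"
  shows "runs b (c ;; d) v v2"
proof (rule runs_step)
  fix k
  obtain t t' where t: "(cstep b ^^ t) (c # d # k, v) = (d # k, v1)" "(cstep b ^^ t') (d # k, v1) = (k, v2)"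
    using assms unfolding runs_def by metis
  then show "\<exists>t. (cstep b ^^ t) (cstep b ((c ;; d) # k, v)) = (k, v2)"
    using funpow_trans[OF t] by (cases v) auto
qed

lemma runs_IfRead:
  assumes "runs b (if b i then c else d) (s, Suc i, w) v"
  shows "runs b (IfRead c d) (s, i, w) v"
  by (rule runs_step) (use assms in \<open>simp add: runs_def\<close>)

lemma runs_Loop_0: "s r = 0 \<Longrightarrow> runs b (Loop r c) (s, i, w) (s, i, w)"
  by (rule runs_step) (auto intro!: exI[of _ 0])

lemma runs_Loop_Suc:
  assumes "s r \<noteq> 0" "runs b c (s, i, w) v" "runs b (Loop r c) v v'"
  shows "runs b (Loop r c) (s, i, w) v'"
proof (rule runs_step)
  fix k
  obtain t t' where t: "(cstep b ^^ t) (c # Loop r c # k, (s, i, w)) = (Loop r c # k, v)"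
      "(cstep b ^^ t') (Loop r c # k, v) = (k, v')"
    using assms unfolding runs_def by metis
  then show "\<exists>t. (cstep b ^^ t) (cstep b (Loop r c # k, (s, i, w))) = (k, v')"
    using funpow_trans[OF t] assms(1) by auto
qed

definition calc :: "cmd \<Rightarrow> (nat \<Rightarrow> nat) \<Rightarrow> (nat \<Rightarrow> nat) \<Rightarrow> bool" where
  "calc c s s' \<longleftrightarrow> (\<forall>b i w. runs b c (s, i, w) (s', i, w))"

lemma calc_Inc: "calc (Inc r) s (s(r := Suc (s r)))"
  unfolding calc_def using runs_Inc by blast

lemma calc_Dec: "calc (Dec r) s (s(r := s r - 1))"
  unfolding calc_def using runs_Dec by blast

lemma calc_Seq: "calc c s s1 \<Longrightarrow> calc d s1 s2 \<Longrightarrow> calc (c ;; d) s s2"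
  unfolding calc_def using runs_Seq by blast

lemma calc_Loop_0: "s r = 0 \<Longrightarrow> calc (Loop r c) s s"
  unfolding calc_def using runs_Loop_0 by blast

lemma calc_Loop_Suc: "s r \<noteq> 0 \<Longrightarrow> calc c s s1 \<Longrightarrow> calc (Loop r c) s1 s2 \<Longrightarrow> calc (Loop r c) s s2"
  unfolding calc_def using runs_Loop_Suc by blast

definition clear :: "nat \<Rightarrow> cmd" where
  "clear r = Loop r (Dec r)"

lemma calc_clear: "calc (clear r) s (s(r := 0))"
proof (induction "s r" arbitrary: s)
  case 0
  then have "s(r := 0) = s" by auto
  then show ?case using calc_Loop_0[of s r] 0 by (simp add: clear_def)
next
  case (Suc x)
  have "calc (clear r) (s(r := s r - 1)) (s(r := 0))"
    using Suc(1)[of "s(r := s r - 1)"] Suc(2) by simp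
  then show ?case using calc_Loop_Suc[OF _ calc_Dec] Suc(2) by (simp add: clear_def)
qed

text \<open>Reading a counter means running it down, so its value goes both to \<open>t\<close> and
  to the scratch register \<open>u\<close>, from which \<open>a\<close> is restored.\<close>

definition copy :: "nat \<Rightarrow> nat \<Rightarrow> nat \<Rightarrow> cmd" where
  "copy a t u = clear t ;; clear u ;; Loop a (Dec a ;; Inc t ;; Inc u) ;; Loop u (Dec u ;; Inc a)"

lemma calc_copy:
  assumes "a \<noteq> t" "a \<noteq> u" "t \<noteq> u"
  shows "calc (copy a t u) s (s(t := s a, u := 0))"
proof -
  have 1: "calc (Loop a (Dec a ;; Inc t ;; Inc u)) s (s(a := 0, t := s t + s a, u := s u + s a))" for s
  proof (induction "s a" arbitrary: s)
    case 0
    then have "s(a := 0, t := s t + s a, u := s u + s a) = s" by auto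
    then show ?case using calc_Loop_0[of s a] 0 by metis
  next
    case (Suc x)
    define s1 where "s1 = s(a := x, t := Suc (s t), u := Suc (s u))"
    have "calc (Dec a ;; Inc t ;; Inc u) s s1"
      unfolding s1_def using Suc(2)[symmetric] assms
        calc_Seq[OF calc_Dec[of a s] calc_Seq[OF calc_Inc[of t] calc_Inc[of u]]] by simp
    moreover have "calc (Loop a (Dec a ;; Inc t ;; Inc u)) s1 (s(a := 0, t := s t + s a, u := s u + s a))"
      using Suc(1)[of s1] Suc(2)[symmetric] assms by (simp add: s1_def fun_upd_twist)
    ultimately show ?case using calc_Loop_Suc Suc(2) by (metis nat.distinct(1))
  qed
  have 2: "calc (Loop u (Dec u ;; Inc a)) s (s(a := s a + s u, u := 0))" for s
  proof (induction "s u" arbitrary: s)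
    case 0
    then have "s(a := s a + s u, u := 0) = s" by auto
    then show ?case using calc_Loop_0[of s u] 0 by metis
  next
    case (Suc x)
    define s1 where "s1 = s(u := x, a := Suc (s a))"
    have "calc (Dec u ;; Inc a) s s1"
      unfolding s1_def using Suc(2)[symmetric] assms calc_Seq[OF calc_Dec[of u s] calc_Inc[of a]] by simp
    moreover have "calc (Loop u (Dec u ;; Inc a)) s1 (s(a := s a + s u, u := 0))"
      using Suc(1)[of s1] Suc(2)[symmetric] assms by (simp add: s1_def fun_upd_twist)
    ultimately show ?case using calc_Loop_Suc Suc(2) by (metis nat.distinct(1))
  qed
  have "calc (copy a t u) s (s(t := 0, u := 0, a := 0, t := s a, u := s a, a := s a, u := 0))"
    unfolding copy_def
    using calc_Seq[OF calc_clear[of t s] calc_Seq[OF calc_clear[of u] calc_Seq[OF 1 2]]] assms by simp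
  moreover have "s(t := 0, u := 0, a := 0, t := s a, u := s a, a := s a, u := 0) = s(t := s a, u := 0)"
    using assms by auto
  ultimately show ?thesis by simp
qed

section \<open>Compiling recursive functions to programs\<close>

text \<open>\<open>compile e as t n\<close> stores the value of \<open>e\<close> at the registers \<open>as\<close> in register \<open>t\<close>, using the
  registers from \<open>n\<close> onwards as scratch space.\<close>

primrec compile :: "recf \<Rightarrow> nat list \<Rightarrow> nat \<Rightarrow> nat \<Rightarrow> cmd" where
  "compile Zero as t n = clear t"
| "compile Succ as t n = copy (hd as) t n ;; Inc t"
| "compile (Proj i) as t n = copy (as ! i) t n"
| "compile (Comp f gs) as t n =
     foldr (;;) (map2 (\<lambda>C j. C as j (n + length gs)) (map compile gs) [n..<n + length gs])
       (compile f [n..<n + length gs] t (n + length gs))"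
| "compile (Prec f g) as t n =
     copy (hd as) (n + 2) n ;; clear n ;; compile f (tl as) (n + 1) (n + 4) ;;
     Loop (n + 2) (Dec (n + 2) ;; compile g (n # (n + 1) # tl as) (n + 3) (n + 4) ;;
       copy (n + 3) (n + 1) (n + 4) ;; Inc n) ;;
     copy (n + 1) t (n + 2)"
| "compile (Mu f) as t n =
     clear n ;; compile f (n # as) (n + 1) (n + 2) ;;
     Loop (n + 1) (Inc n ;; compile f (n # as) (n + 1) (n + 2)) ;;
     copy n t (n + 2)"

inductive_cases rec_eval_ZeroE: "rec_eval Zero xs y"
inductive_cases rec_eval_SuccE: "rec_eval Succ xs y"
inductive_cases rec_eval_ProjE: "rec_eval (Proj i) xs y"
inductive_cases rec_eval_CompE: "rec_eval (Comp f gs) xs y"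
inductive_cases rec_eval_PrecE: "rec_eval (Prec f g) xs y"
inductive_cases rec_eval_MuE: "rec_eval (Mu f) xs y"

text \<open>The compiled loop meets the values of the recursion from 0 upwards, whereas the
  evaluation rules descend from the top; the sequence \<open>ys\<close> translates between the
  two.\<close>

lemma rec_eval_Prec_seq:
  "rec_eval (Prec f g) (x # xs) y \<Longrightarrow>
    \<exists>ys. rec_eval f xs (ys 0) \<and> (\<forall>i<x. rec_eval g (i # ys i # xs) (ys (Suc i))) \<and> ys x = y"
proof (induction x arbitrary: y)
  case 0
  then show ?case by (intro exI[of _ "\<lambda>_. y"]) (auto elim: rec_eval_PrecE)
next
  case (Suc x)
  obtain z where z: "rec_eval (Prec f g) (x # xs) z" "rec_eval g (x # z # xs) y"
    using Suc.prems by (auto elim: rec_eval_PrecE)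
  obtain ys where "rec_eval f xs (ys 0)" "\<forall>i<x. rec_eval g (i # ys i # xs) (ys (Suc i))" "ys x = z"
    using Suc.IH[OF z(1)] by blast
  then show ?case using z(2) by (intro exI[of _ "ys(Suc x := y)"]) (auto simp: less_Suc_eq)
qed

text \<open>The frame condition below \<open>n\<close> keeps arguments and earlier results alive
  across nested calls. The target is kept apart from the arguments because \<open>copy\<close> needs
  distinct registers.\<close>

definition compile_ok :: "recf \<Rightarrow> bool" where
  "compile_ok e \<longleftrightarrow> (\<forall>as t n s y. rec_eval e (map s as) y \<longrightarrow> set as \<subseteq> {..<n} \<longrightarrow> t < n \<longrightarrow> t \<notin> set as \<longrightarrow>
     (\<exists>s'. calc (compile e as t n) s s' \<and> s' t = y \<and> (\<forall>r<n. r \<noteq> t \<longrightarrow> s' r = s r)))"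

lemma compile_okD:
  assumes "compile_ok e" "rec_eval e (map s as) y" "set as \<subseteq> {..<n}" "t < n" "t \<notin> set as"
  obtains s' where "calc (compile e as t n) s s'" "s' t = y" "\<And>r. r < n \<Longrightarrow> r \<noteq> t \<Longrightarrow> s' r = s r"
  using assms unfolding compile_ok_def by blast

text \<open>The commands contain no empty program to end the chain with, so the claim is made for
  the argument evaluations followed by an arbitrary program \<open>D\<close>.\<close>

lemma calc_foldr_compile:
  assumes "list_all2 (\<lambda>g y. rec_eval g (map s as) y) gs ys" "\<And>g. g \<in> set gs \<Longrightarrow> compile_ok g"
    "set as \<subseteq> {..<n}" "n + length gs \<le> N"
  shows "\<exists>s'. (\<forall>D s''. calc D s' s'' \<longrightarrow>
      calc (foldr (;;) (map2 (\<lambda>C j. C as j N) (map compile gs) [n..<n + length gs]) D) s s'') \<and>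
    map s' [n..<n + length gs] = ys \<and> (\<forall>r<n. s' r = s r)"
  using assms
proof (induction gs arbitrary: n ys s)
  case Nil
  then show ?case by (intro exI[of _ s]) auto
next
  case (Cons g gs)
  obtain y ys' where ys: "ys = y # ys'" "rec_eval g (map s as) y"
    "list_all2 (\<lambda>g y. rec_eval g (map s as) y) gs ys'"
    using Cons.prems(1) by (auto simp: list_all2_Cons1)
  have sub: "set as \<subseteq> {..<N}" "n < N" "n \<notin> set as" "set as \<subseteq> {..<Suc n}"
    using Cons.prems by auto
  obtain s1 where s1: "calc (compile g as n N) s s1" "s1 n = y" "\<And>r. r < N \<Longrightarrow> r \<noteq> n \<Longrightarrow> s1 r = s r"
    using compile_okD[OF Cons.prems(2)[of g] ys(2) sub(1-3)] by auto
  have "map s1 as = map s as" using s1(3) sub Cons.prems(3) by auto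
  then obtain s' where s': "\<And>D s''. calc D s' s'' \<Longrightarrow>
      calc (foldr (;;) (map2 (\<lambda>C j. C as j N) (map compile gs) [Suc n..<Suc n + length gs]) D) s1 s''"
    "map s' [Suc n..<Suc n + length gs] = ys'" "\<forall>r<Suc n. s' r = s1 r"
    using Cons.IH[of s1 ys' "Suc n"] ys(3) Cons.prems(2,4) sub(4) \<open>map s1 as = map s as\<close> by (auto simp del: upt_Suc map_eq_conv)
  have upt: "[n..<n + length (g # gs)] = n # [Suc n..<Suc n + length gs]"
    by (simp add: upt_conv_Cons del: upt_Suc)
  show ?case
    unfolding upt
    using s' s1 ys(1) calc_Seq[OF s1(1)] sub(2) by (intro exI[of _ s']) (auto simp del: upt_Suc)
qed

lemma compile_ok: "compile_ok e"
proof (induction e)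
  case Zero
  show ?case unfolding compile_ok_def
    by (auto elim!: rec_eval_ZeroE intro!: exI[of _ "_(_ := 0)"] calc_clear)
next
  case Succ
  show ?case unfolding compile_ok_def
  proof (intro allI impI)
    fix as :: "nat list" and t n s y assume a: "rec_eval Succ (map s as) y" "set as \<subseteq> {..<n}" "t < n" "t \<notin> set as"
    obtain r where r: "as = [r]" "y = Suc (s r)" using a(1) by (auto elim!: rec_eval_SuccE)
    have "calc (compile Succ as t n) s (s(t := s r, n := 0, t := Suc (s r)))"
      using calc_Seq[OF calc_copy[of r t n s] calc_Inc[of t]] a r by auto
    then show "\<exists>s'. calc (compile Succ as t n) s s' \<and> s' t = y \<and> (\<forall>r<n. r \<noteq> t \<longrightarrow> s' r = s r)"
      using r by (intro exI[of _ "s(t := s r, n := 0, t := Suc (s r))"]) auto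
  qed
next
  case (Proj i)
  show ?case unfolding compile_ok_def
  proof (intro allI impI)
    fix as :: "nat list" and t n s y assume a: "rec_eval (Proj i) (map s as) y" "set as \<subseteq> {..<n}" "t < n" "t \<notin> set as"
    have i: "i < length as" "y = s (as ! i)" using a(1) by (auto elim!: rec_eval_ProjE)
    then have "as ! i \<in> set as" by simp
    then have "calc (compile (Proj i) as t n) s (s(t := s (as ! i), n := 0))"
      using calc_copy[of "as ! i" t n s] a by auto
    then show "\<exists>s'. calc (compile (Proj i) as t n) s s' \<and> s' t = y \<and> (\<forall>r<n. r \<noteq> t \<longrightarrow> s' r = s r)"
      using i a by (intro exI[of _ "s(t := s (as ! i), n := 0)"]) auto
  qed
next
  case (Comp f gs)
  show ?case unfolding compile_ok_def
  proof (intro allI impI)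
    fix as :: "nat list" and t n s y assume a: "rec_eval (Comp f gs) (map s as) y" "set as \<subseteq> {..<n}" "t < n" "t \<notin> set as"
    obtain ys where ys: "list_all2 (\<lambda>g y. rec_eval g (map s as) y) gs ys" "rec_eval f ys y"
      using a(1) by (auto elim!: rec_eval_CompE)
    obtain s1 where s1: "\<And>D s''. calc D s1 s'' \<Longrightarrow>
      calc (foldr (;;) (map2 (\<lambda>C j. C as j (n + length gs)) (map compile gs) [n..<n + length gs]) D) s s''"
      "map s1 [n..<n + length gs] = ys" "\<And>r. r < n \<Longrightarrow> s1 r = s r"
      using calc_foldr_compile[OF ys(1) Comp.IH(2) a(2) order.refl] by auto
    obtain s2 where s2: "calc (compile f [n..<n + length gs] t (n + length gs)) s1 s2" "s2 t = y"
      "\<And>r. r < n + length gs \<Longrightarrow> r \<noteq> t \<Longrightarrow> s2 r = s1 r"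
      by (rule compile_okD[OF Comp.IH(1), of s1 "[n..<n + length gs]" y "n + length gs" t])
        (use s1 ys a in auto)
    show "\<exists>s'. calc (compile (Comp f gs) as t n) s s' \<and> s' t = y \<and> (\<forall>r<n. r \<noteq> t \<longrightarrow> s' r = s r)"
      using s1(1)[OF s2(1)] s1(3) s2(2,3) by (intro exI[of _ s2]) auto
  qed
next
  case (Prec f g)
  show ?case unfolding compile_ok_def
  proof (intro allI impI)
    fix as :: "nat list" and t n s y assume a: "rec_eval (Prec f g) (map s as) y" "set as \<subseteq> {..<n}" "t < n" "t \<notin> set as"
    obtain r rs where as: "as = r # rs" using a(1) by (cases as) (auto elim!: rec_eval_PrecE)
    let ?B = "Dec (n + 2) ;; compile g (n # (n + 1) # rs) (n + 3) (n + 4) ;;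
       copy (n + 3) (n + 1) (n + 4) ;; Inc n"
    let ?xs = "map s rs"
    obtain ys where ys: "rec_eval f ?xs (ys 0)" "\<And>i. i < s r \<Longrightarrow> rec_eval g (i # ys i # ?xs) (ys (Suc i))" "ys (s r) = y"
      using rec_eval_Prec_seq[of f g "s r" ?xs y] a(1) as by auto
    define s00 where "s00 = s(n + 2 := s r, n := 0)"
    have "map s00 rs = ?xs" using a as by (auto simp: s00_def)
    then have f: "rec_eval f (map s00 rs) (ys 0)" using ys(1) by (simp only:)
    obtain s0 where s0: "calc (compile f rs (n + 1) (n + 4)) s00 s0"
      "s0 (n + 1) = ys 0" "\<And>r. r < n + 4 \<Longrightarrow> r \<noteq> n + 1 \<Longrightarrow> s0 r = s00 r"
      by (rule compile_okD[OF Prec.IH(1) f, of "n + 4" "n + 1"]) (use a as in auto)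
    \<comment> \<open>Invariant with \<open>l\<close> rounds left: register \<open>n\<close> is the
      index of the recursion, \<open>n + 1\<close> the value at that index, \<open>n + 2\<close> the
      countdown.\<close>
    have loop: "\<exists>s''. calc (Loop (n + 2) ?B) s' s'' \<and> s'' (n + 1) = y \<and> s'' (n + 2) = 0 \<and> (\<forall>r<n. s'' r = s r)"
      if "l \<le> s r" "s' (n + 2) = l" "s' n = s r - l" "s' (n + 1) = ys (s r - l)" "\<forall>r<n. s' r = s r" for l s'
      using that
    proof (induction l arbitrary: s')
      case 0
      then show ?case using calc_Loop_0[of s' "n + 2"] ys(3) by (intro exI[of _ s']) simp
    next
      case (Suc l)
      define x where "x = s r - Suc l"
      have x: "x < s r" "s r - l = Suc x" using Suc.prems(1) by (auto simp: x_def)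
      have "map (s'(n + 2 := l)) (n # (n + 1) # rs) = x # ys x # ?xs"
        using a as Suc.prems by (auto simp: x_def)
      then have g: "rec_eval g (map (s'(n + 2 := l)) (n # (n + 1) # rs)) (ys (Suc x))"
        using ys(2)[OF x(1)] by (simp only:)
      obtain s2 where s2: "calc (compile g (n # (n + 1) # rs) (n + 3) (n + 4)) (s'(n + 2 := l)) s2"
        "s2 (n + 3) = ys (Suc x)" "\<And>r. r < n + 4 \<Longrightarrow> r \<noteq> n + 3 \<Longrightarrow> s2 r = (s'(n + 2 := l)) r"
        by (rule compile_okD[OF Prec.IH(2) g, of "n + 4" "n + 3"]) (use a as in auto)
      define s3 where "s3 = s2(n + 1 := ys (Suc x), n + 4 := 0, n := Suc x)"
      have "calc ?B s' s3"
      proof (intro calc_Seq)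
        show "calc (Dec (n + 2)) s' (s'(n + 2 := l))"
          using calc_Dec[of "n + 2" s'] Suc.prems(2) by simp
        show "calc (compile g (n # (n + 1) # rs) (n + 3) (n + 4)) (s'(n + 2 := l)) s2" by fact
        show "calc (copy (n + 3) (n + 1) (n + 4)) s2 (s2(n + 1 := ys (Suc x), n + 4 := 0))"
          using calc_copy[of "n + 3" "n + 1" "n + 4" s2] s2(2) by simp
        show "calc (Inc n) (s2(n + 1 := ys (Suc x), n + 4 := 0)) s3"
          using calc_Inc[of n "s2(n + 1 := ys (Suc x), n + 4 := 0)"] s2(3)[of n] Suc.prems(3)
          by (simp add: s3_def x_def)
      qed
      moreover obtain s4 where s4: "calc (Loop (n + 2) ?B) s3 s4" "s4 (n + 1) = y \<and> s4 (n + 2) = 0 \<and> (\<forall>r<n. s4 r = s r)"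
      proof -
        have "l \<le> s r" "s3 (n + 2) = l" "s3 n = s r - l" "s3 (n + 1) = ys (s r - l)" "\<forall>r<n. s3 r = s r"
          using s2(3) Suc.prems x by (simp_all add: s3_def)
        from Suc.IH[OF this] show thesis using that by (elim exE conjE) simp
      qed
      moreover have "s' (n + 2) \<noteq> 0" using Suc.prems(2) by simp
      ultimately show ?case using calc_Loop_Suc[of s' "n + 2" ?B s3 s4] by (intro exI[of _ s4] conjI) simp_all
    qed
    obtain s1 where s1: "calc (Loop (n + 2) ?B) s0 s1" "s1 (n + 1) = y" "s1 (n + 2) = 0" "\<forall>r<n. s1 r = s r"
      using loop[of "s r" s0] s0(2,3) by (auto simp: s00_def)
    have "calc (compile (Prec f g) as t n) s (s1(t := y, n + 2 := 0))"
      unfolding compile.simps as list.sel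
    proof (intro calc_Seq)
      show "calc (copy r (n + 2) n) s s00"
        using calc_copy[of r "n + 2" n s] a as by (auto simp: s00_def)
      show "calc (clear n) s00 s00"
        using calc_clear[of n s00] by (simp add: s00_def)
      show "calc (copy (n + 1) t (n + 2)) s1 (s1(t := y, n + 2 := 0))"
        using calc_copy[of "n + 1" t "n + 2" s1] a s1(2) by simp
    qed (rule s0 s1)+
    then show "\<exists>s'. calc (compile (Prec f g) as t n) s s' \<and> s' t = y \<and> (\<forall>r<n. r \<noteq> t \<longrightarrow> s' r = s r)"
      using s1(4) a(3) by (intro exI[of _ "s1(t := y, n + 2 := 0)"]) auto
  qed
next
  case (Mu f)
  show ?case unfolding compile_ok_def
  proof (intro allI impI)
    fix as :: "nat list" and t n s y assume a: "rec_eval (Mu f) (map s as) y" "set as \<subseteq> {..<n}" "t < n" "t \<notin> set as"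
    let ?xs = "map s as"
    have y: "rec_eval f (y # ?xs) 0" "\<And>m. m < y \<Longrightarrow> \<exists>z. rec_eval f (m # ?xs) (Suc z)"
      using a(1) by (auto elim!: rec_eval_MuE)
    let ?B = "Inc n ;; compile f (n # as) (n + 1) (n + 2)"
    have f: "\<exists>s2. calc (compile f (n # as) (n + 1) (n + 2)) s1 s2 \<and> s2 n = m \<and> s2 (n + 1) = z \<and> (\<forall>r<n. s2 r = s r)"
      if "rec_eval f (m # ?xs) z" "s1 n = m" "\<forall>r<n. s1 r = s r" for s1 m z
    proof -
      have "map s1 (n # as) = m # ?xs" using a that by auto
      then have "rec_eval f (map s1 (n # as)) z" using that(1) by (simp only:)
      then obtain s2 where s2: "calc (compile f (n # as) (n + 1) (n + 2)) s1 s2"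
        "s2 (n + 1) = z" "\<And>r. r < n + 2 \<Longrightarrow> r \<noteq> n + 1 \<Longrightarrow> s2 r = s1 r"
        by (rule compile_okD[OF Mu.IH, of s1 "n # as" z "n + 2" "n + 1"]) (use a in auto)
      then show ?thesis using that by (intro exI[of _ s2]) auto
    qed
    \<comment> \<open>With \<open>l\<close> candidates left before the minimum \<open>y\<close>,
      register \<open>n\<close> holds the candidate and \<open>n + 1\<close> the value of
      \<open>f\<close> there, which vanishes exactly for \<open>l = 0\<close>; this stops the loop
      at \<open>y\<close>.\<close>
    have loop: "\<exists>s2. calc (Loop (n + 1) ?B) s1 s2 \<and> s2 n = y \<and> (\<forall>r<n. s2 r = s r)"
      if "l \<le> y" "s1 n = y - l" "rec_eval f ((y - l) # ?xs) (s1 (n + 1))" "\<forall>r<n. s1 r = s r" "l = 0 \<longrightarrow> s1 (n + 1) = 0"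
        "l \<noteq> 0 \<longrightarrow> s1 (n + 1) \<noteq> 0" for l s1
      using that
    proof (induction l arbitrary: s1)
      case 0
      then show ?case using calc_Loop_0 by (intro exI[of _ s1]) auto
    next
      case (Suc l)
      \<comment> \<open>Below the minimum the evaluation rules only provide some positive value,
        hence the choice; any such value keeps the loop going.\<close>
      define z where "z = (if l = 0 then 0 else Suc (SOME z. rec_eval f ((y - l) # ?xs) (Suc z)))"
      have z: "rec_eval f ((y - l) # ?xs) z"
        using y(1) someI_ex[OF y(2)[of "y - l"]] Suc.prems(1) by (auto simp: z_def)
      have "(s1(n := Suc (s1 n))) n = y - l" using Suc.prems by simp
      then obtain s2 where s2: "calc (compile f (n # as) (n + 1) (n + 2)) (s1(n := Suc (s1 n))) s2"
        "s2 n = y - l" "s2 (n + 1) = z" "\<forall>r<n. s2 r = s r"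
        using f[OF z, of "s1(n := Suc (s1 n))"] Suc.prems(4) by auto
      obtain s3 where s3: "calc (Loop (n + 1) ?B) s2 s3" "s3 n = y \<and> (\<forall>r<n. s3 r = s r)"
      proof -
        have "l \<le> y" "s2 n = y - l" "rec_eval f ((y - l) # ?xs) (s2 (n + 1))" "\<forall>r<n. s2 r = s r"
          "l = 0 \<longrightarrow> s2 (n + 1) = 0" "l \<noteq> 0 \<longrightarrow> s2 (n + 1) \<noteq> 0"
          using s2(2-) z Suc.prems(1) by (simp_all add: z_def)
        from Suc.IH[OF this] show thesis using that by (elim exE conjE) simp
      qed
      moreover have "calc ?B s1 s2" using calc_Seq[OF calc_Inc s2(1)] .
      moreover have "s1 (n + 1) \<noteq> 0" using Suc.prems(6) by simp
      ultimately show ?case using calc_Loop_Suc[of s1 "n + 1" ?B s2 s3] by (intro exI[of _ s3] conjI) simp_all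
    qed
    obtain z where z: "rec_eval f (0 # ?xs) z" "y = 0 \<longrightarrow> z = 0" "y \<noteq> 0 \<longrightarrow> z \<noteq> 0"
      using y by (cases "y = 0") force+
    obtain s1 where s1: "calc (compile f (n # as) (n + 1) (n + 2)) (s(n := 0)) s1" "s1 n = 0" "s1 (n + 1) = z" "\<forall>r<n. s1 r = s r"
      using f[OF z(1), of "s(n := 0)"] by auto
    obtain s2 where s2: "calc (Loop (n + 1) ?B) s1 s2" "s2 n = y" "\<forall>r<n. s2 r = s r"
      using loop[of y s1] s1 z by auto
    have "calc (compile (Mu f) as t n) s (s2(t := y, n + 2 := 0))"
      unfolding compile.simps
    proof (intro calc_Seq)
      show "calc (clear n) s (s(n := 0))" by (rule calc_clear)
      show "calc (copy n t (n + 2)) s2 (s2(t := y, n + 2 := 0))"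
        using calc_copy[of n t "n + 2" s2] a s2(2) by simp
    qed (rule s1 s2)+
    then show "\<exists>s'. calc (compile (Mu f) as t n) s s' \<and> s' t = y \<and> (\<forall>r<n. r \<noteq> t \<longrightarrow> s' r = s r)"
      using s2(3) a(3) by (intro exI[of _ "s2(t := y, n + 2 := 0)"]) auto
  qed
qed

section \<open>Names of sequences\<close>

definition block_start :: "(nat \<Rightarrow> nat) \<Rightarrow> nat \<Rightarrow> nat" where
  "block_start s n = (\<Sum>i<n. Suc (s i))"

lemma block_start_Suc [simp]: "block_start s (Suc n) = block_start s n + Suc (s n)"
  by (simp add: block_start_def)

lemma block_start_0 [simp]: "block_start s 0 = 0"
  by (simp add: block_start_def)

lemma strict_mono_block_start: "strict_mono (block_start s)"
  by (rule strict_monoI_Suc) simp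

lemma seq_name_alt: "seq_name s i = (if \<exists>k. Suc i = block_start s (Suc k) then 1 else 0)"
  unfolding seq_name_def block_start_def lessThan_Suc_atMost ..

lemma seq_name_block:
  assumes "d \<le> s n"
  shows "seq_name s (block_start s n + d) = (if d = s n then 1 else (0 :: 'a::zero_neq_one))"
proof -
  have "d = s n" if "Suc (block_start s n + d) = block_start s (Suc k)" for k
  proof -
    have "block_start s n < block_start s (Suc k)" using that by linarith
    moreover have "block_start s (Suc k) \<le> block_start s (Suc n)" using that assms by simp
    ultimately have "n < Suc k" "Suc k \<le> Suc n"
      using strict_mono_block_start strict_mono_less strict_mono_less_eq by metis+
    then have "k = n" by simp
    then show ?thesis using that by simp
  qed
  then have "(\<exists>k. Suc (block_start s n + d) = block_start s (Suc k)) \<longleftrightarrow> d = s n"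
    using block_start_Suc[of s n] by (metis add_Suc_right)
  then show ?thesis unfolding seq_name_alt by simp
qed

lemma seq_name_eq_1: "seq_name s i = (1 :: 'a::zero_neq_one) \<longleftrightarrow> (\<exists>k. Suc i = block_start s (Suc k))"
  unfolding seq_name_alt by auto

text \<open>A block is recognized by the symbols 1 on either side of it. The first block has no 1 in
  front, hence \<open>n > 0\<close>; \<open>source_bit\<close> repairs this for the input by a
  virtual leading 1, and the enumerator by an empty first block.\<close>

lemma seq_name_pattern:
  "(\<exists>i. seq_name s i = (1 :: 'a::zero_neq_one) \<and> (\<forall>k<v. seq_name s (i + 1 + k) \<noteq> (1 :: 'a)) \<and>
      seq_name s (i + 1 + v) = (1 :: 'a)) \<longleftrightarrow> (\<exists>n>0. s n = v)"
proof
  assume "\<exists>i. seq_name s i = (1 :: 'a) \<and> (\<forall>k<v. seq_name s (i + 1 + k) \<noteq> (1 :: 'a)) \<and>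
      seq_name s (i + 1 + v) = (1 :: 'a)"
  then obtain i where i: "seq_name s i = (1 :: 'a)" "\<And>k. k < v \<Longrightarrow> seq_name s (i + 1 + k) \<noteq> (1 :: 'a)"
    "seq_name s (i + 1 + v) = (1 :: 'a)" by blast
  then obtain k where k: "Suc i = block_start s (Suc k)" unfolding seq_name_eq_1 by blast
  have at: "seq_name s (i + 1 + d) = (if d = s (Suc k) then 1 else (0 :: 'a))" if "d \<le> s (Suc k)" for d
    using seq_name_block[of d s "Suc k"] that k by simp
  have "\<not> s (Suc k) < v" using i(2)[of "s (Suc k)"] at[of "s (Suc k)"] by auto
  moreover have "\<not> v < s (Suc k)" using i(3) at[of v] by auto
  ultimately show "\<exists>n>0. s n = v" by (intro exI[of _ "Suc k"]) auto
next
  assume "\<exists>n>0. s n = v"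
  then obtain k where k: "s (Suc k) = v" by (metis gr0_implies_Suc)
  define i where "i = block_start s k + s k"
  have i: "i + 1 = block_start s (Suc k)" by (simp add: i_def)
  show "\<exists>i. seq_name s i = (1 :: 'a) \<and> (\<forall>k<v. seq_name s (i + 1 + k) \<noteq> (1 :: 'a)) \<and>
      seq_name s (i + 1 + v) = (1 :: 'a)"
    using seq_name_block[of "s k" s k, where ?'a = 'a] seq_name_block[of _ s "Suc k", where ?'a = 'a]
    by (intro exI[of _ i]) (simp add: i k, simp add: i_def)
qed

text \<open>No pattern can see the first block, so \<open>s 0 = 0\<close> reserves it for padding;
  the other zero blocks are padding too, which leaves the shifted values \<open>Suc n\<close> for
  the elements.\<close>

lemma En_seq_name:
  assumes "\<And>i j. s i = s j \<Longrightarrow> s i \<noteq> 0 \<Longrightarrow> i = j" and "s 0 = 0"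
  shows "{n. Suc n \<in> range s} \<in> En (seq_name s :: 'a::zero_neq_one name)"
proof -
  have m: "map p [i..<i + (n + 3)] = p i # map (\<lambda>k. p (i + 1 + k)) [0..<n + 1] @ [p (i + 1 + (n + 1))]"
    for p :: "'a name" and i n
    by (intro nth_equalityI) (auto simp: nth_Cons nth_append less_Suc_eq simp del: upt_Suc split: nat.split)
  have r: "map f [0..<n] = replicate n (0 :: 'a) \<longleftrightarrow> (\<forall>k<n. f k = 0)" for f n
    by (auto simp: list_eq_iff_nth_eq)
  have z: "seq_name s i \<noteq> (1 :: 'a) \<longleftrightarrow> seq_name s i = (0 :: 'a)" for i
    by (simp add: seq_name_alt)
  have "{n. Suc n \<in> range s} = {n. \<exists>i. map (seq_name s) [i..<i + (n + 3)] = [1 :: 'a] @ replicate (n + 1) 0 @ [1]}"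
  proof (intro Collect_cong)
    fix n
    have "(\<exists>i. map (seq_name s) [i..<i + (n + 3)] = [1 :: 'a] @ replicate (n + 1) 0 @ [1]) \<longleftrightarrow>
        (\<exists>i. seq_name s i = (1 :: 'a) \<and> (\<forall>k<n + 1. seq_name s (i + 1 + k) \<noteq> (1 :: 'a)) \<and>
          seq_name s (i + 1 + (n + 1)) = (1 :: 'a))"
      unfolding m z r[symmetric] by (simp del: upt_Suc replicate.simps)
    also have "\<dots> \<longleftrightarrow> (\<exists>k>0. s k = n + 1)" by (rule seq_name_pattern)
    also have "\<dots> \<longleftrightarrow> Suc n \<in> range s" using assms(2)
      by (metis Suc_eq_plus1 gr0I nat.distinct(1) rangeE rangeI)
    finally show "Suc n \<in> range s \<longleftrightarrow> (\<exists>i. map (seq_name s) [i..<i + (n + 3)] = [1 :: 'a] @ replicate (n + 1) 0 @ [1])"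
      by blast
  qed
  then show ?thesis unfolding En_def using assms(1) by blast
qed

text \<open>The argument is shifted by one so that a round of a transducer can also write
  nothing.\<close>

definition block :: "nat \<Rightarrow> bool list" where
  "block y = (case y of 0 \<Rightarrow> [] | Suc v \<Rightarrow> replicate v False @ [True])"

lemma seq_name_blocks:
  "map of_bool (concat (map (\<lambda>i. block (Suc (s i))) [0..<n])) =
    map (seq_name s :: 'a::zero_neq_one name) [0..<block_start s n]"
proof (induction n)
  case (Suc n)
  have "map of_bool (block (Suc (s n))) = map (\<lambda>d. if d = s n then 1 else (0 :: 'a)) [0..<Suc (s n)]"
    by (auto simp: block_def list_eq_iff_nth_eq nth_append less_Suc_eq simp del: upt_Suc)
  also have "\<dots> = map (\<lambda>d. seq_name s (block_start s n + d)) [0..<Suc (s n)]"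
    using seq_name_block[of _ s n, where ?'a = 'a] by (intro map_cong) auto
  also have "\<dots> = map (seq_name s) [block_start s n..<block_start s n + Suc (s n)]"
    by (auto simp: list_eq_iff_nth_eq simp del: upt_Suc)
  finally have "map of_bool (block (Suc (s n))) =
    map (seq_name s :: 'a name) [block_start s n..<block_start s n + Suc (s n)]" .
  moreover have "[0..<block_start s (Suc n)] = [0..<block_start s n] @ [block_start s n..<block_start s n + Suc (s n)]"
    unfolding block_start_Suc by (rule upt_add_eq_append) simp
  ultimately show ?case using Suc by simp
qed simp

lemma length_blocks: "length (concat (map (\<lambda>i. block (Suc (s i))) [0..<n])) = block_start s n"
  by (induction n) (auto simp: block_def)

section \<open>Transducers\<close>

primrec transducer_state :: "(nat \<Rightarrow> nat \<Rightarrow> nat \<Rightarrow> nat) \<Rightarrow> (nat \<Rightarrow> nat) \<Rightarrow> nat \<Rightarrow> nat" where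
  "transducer_state g b 0 = 0"
| "transducer_state g b (Suc m) = g (b m) m (transducer_state g b m)"

text \<open>The common form of both machines: each round reads one symbol, keeping only whether it
  is 1, and applies two recursive functions to this bit, the round number and the state. Rounds may
  be silent, so \<open>cnt N\<close> counts the blocks written in \<open>N\<close> rounds.\<close>

theorem transducer_computable:
  assumes eg: "\<And>b m z. rec_eval eg [b, m, z] (g b m z)"
    and eo: "\<And>b m z. rec_eval eo [b, m, z] (out b m z)" and j: "j < k"
  obtains F :: "'a::{finite,zero_neq_one} name list \<rightharpoonup> 'a name" where "t2_computable k F"
    and "\<And>ps b s cnt. length ps = k \<Longrightarrow> b = (\<lambda>i. of_bool ((ps ! j) i = 1)) \<Longrightarrow>
      (\<And>N. concat (map (\<lambda>m. block (out (b m) m (transducer_state g b m))) [0..<N]) =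
        concat (map (\<lambda>i. block (Suc (s i))) [0..<cnt N])) \<Longrightarrow> (\<And>n. \<exists>N. n \<le> cnt N) \<Longrightarrow>
      F ps = Some (seq_name s)"
proof -
  define rd where "rd = IfRead (clear 1 ;; Inc 1) (clear 1)"
  \<comment> \<open>The outer loop serves as a conditional: its body empties register 4, so it runs
    at most once, and not at all for the value 0.\<close>
  define wr where "wr = Loop 4 (Dec 4 ;; Loop 4 (Dec 4 ;; Emit False) ;; Emit True)"
  \<comment> \<open>Register 0 stays at 1 to keep the main loop alive; 1, 2 and 3 hold the bit, the
    round and the state, 4 the output, 5 the new state, and scratch space begins at 6.\<close>
  define body where "body = rd ;; compile eo [1, 2, 3] 4 6 ;; compile eg [1, 2, 3] 5 6 ;; copy 5 3 6 ;; wr ;; Inc 2"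
  have calc: "runs p c (s, i, w) (s', i, w)" if "calc c s s'" for p c s s' i w
    using that by (auto simp: calc_def)
  have rd: "runs p rd (s, i, w) (s(1 := of_bool (p i)), Suc i, w)" for p s i w
    unfolding rd_def
  proof (rule runs_IfRead)
    have "calc (if p i then clear 1 ;; Inc 1 else clear 1) s (s(1 := of_bool (p i)))"
      using calc_clear[of 1 s] calc_Seq[OF calc_clear[of 1 s] calc_Inc[of 1]] by auto
    then show "runs p (if p i then clear 1 ;; Inc 1 else clear 1) (s, Suc i, w) (s(1 := of_bool (p i)), Suc i, w)"
      by (rule calc)
  qed
  have wr': "runs p (Loop 4 (Dec 4 ;; Emit False)) (s, i, w) (s(4 := 0), i, w @ replicate (s 4) False)" for p s i w
  proof (induction "s 4" arbitrary: s w)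
    case 0
    then have "s(4 := 0) = s" by auto
    then show ?case using runs_Loop_0[of s 4] 0 by simp
  next
    case (Suc x)
    have "runs p (Loop 4 (Dec 4 ;; Emit False)) (s(4 := s 4 - 1), i, w @ [False]) (s(4 := 0), i, w @ replicate (s 4) False)"
      using Suc(1)[of "s(4 := s 4 - 1)" "w @ [False]"] Suc(2)[symmetric] by simp
    then show ?case
      using runs_Loop_Suc[OF _ runs_Seq[OF runs_Dec runs_Emit]] Suc(2) by simp
  qed
  have wr: "runs p wr (s, i, w) (s(4 := 0), i, w @ block (s 4))" for p s i w
  proof (cases "s 4")
    case 0
    then have "s(4 := 0) = s" by auto
    then show ?thesis using runs_Loop_0[of s 4] 0 by (simp add: wr_def block_def)
  next
    case (Suc v)
    have "runs p (Dec 4 ;; Loop 4 (Dec 4 ;; Emit False) ;; Emit True) (s, i, w) (s(4 := 0), i, w @ block (s 4))"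
      using runs_Seq[OF runs_Dec[of p 4 s i w] runs_Seq[OF wr' runs_Emit]] Suc by (simp add: block_def)
    then show ?thesis unfolding wr_def using Suc runs_Loop_Suc[OF _ _ runs_Loop_0] by simp
  qed
  have body: "\<exists>s'. runs p body (s, i, w) (s', Suc i, w @ block (out b m z)) \<and> s' 0 = 1 \<and> s' 2 = Suc m \<and> s' 3 = g b m z"
    if "s 0 = 1" "s 2 = m" "s 3 = z" "b = of_bool (p i)" for p s i w b m z
  proof -
    define s1 where "s1 = s(1 := of_bool (p i))"
    have s1: "map s1 [1, 2, 3] = [b, m, z]" using that by (simp add: s1_def)
    obtain s2 where s2: "calc (compile eo [1, 2, 3] 4 6) s1 s2" "s2 4 = out b m z"
      "\<And>r. r < 6 \<Longrightarrow> r \<noteq> 4 \<Longrightarrow> s2 r = s1 r"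
      by (rule compile_okD[OF compile_ok, of eo s1 "[1, 2, 3]" "out b m z" 6 4]) (use s1 eo in \<open>simp_all\<close>)
    have s2': "map s2 [1, 2, 3] = [b, m, z]" using s1 s2(3) by simp
    obtain s3 where s3: "calc (compile eg [1, 2, 3] 5 6) s2 s3" "s3 5 = g b m z"
      "\<And>r. r < 6 \<Longrightarrow> r \<noteq> 5 \<Longrightarrow> s3 r = s2 r"
      by (rule compile_okD[OF compile_ok, of eg s2 "[1, 2, 3]" "g b m z" 6 5]) (use s2' eg in \<open>simp_all\<close>)
    define s4 where "s4 = s3(3 := g b m z, 6 := 0)"
    have s4: "calc (copy 5 3 6) s3 s4" using calc_copy[of 5 3 6 s3] s3(2) by (simp add: s4_def)
    have s44: "s4 4 = out b m z" using s2(2) s3(3) by (simp add: s4_def)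
    define s5 where "s5 = s4(4 := 0, 2 := Suc m)"
    have 5: "runs p (wr ;; Inc 2) (s4, Suc i, w) (s5, Suc i, w @ block (out b m z))"
      using runs_Seq[OF wr[of p s4 "Suc i" w] runs_Inc[of p 2]] s44 that s3(3)[of 2] s2(3)[of 2]
      by (simp add: s5_def s4_def s1_def)
    have "runs p body (s, i, w) (s5, Suc i, w @ block (out b m z))"
      unfolding body_def
      by (rule runs_Seq[OF rd[of p s i w, folded s1_def] runs_Seq[OF calc[OF s2(1)] runs_Seq[OF calc[OF s3(1)] runs_Seq[OF calc[OF s4] 5]]]])
    then show ?thesis using that s3(3)[of 0] s2(3)[of 0]
      by (intro exI[of _ s5]) (simp add: s5_def s4_def s1_def)
  qed
  define c where "c = Inc 0 ;; Loop 0 body"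
  obtain F :: "'a name list \<rightharpoonup> 'a name" where F: "t2_computable k F"
    "\<And>ps r. length ps = k \<Longrightarrow>
      (\<And>n. \<exists>t x s i w. (cstep (\<lambda>i. (ps ! j) i = 1) ^^ t) ([c], \<lambda>_. 0, 0, []) = (x, s, i, w) \<and>
         n \<le> length w \<and> map of_bool w = map r [0..<length w]) \<Longrightarrow> F ps = Some r"
    using program_computable[OF j, of c] by blast
  show thesis
  proof
    show "t2_computable k F" by fact
  next
    fix ps :: "'a name list" and b s cnt
    assume ps: "length ps = k" and b: "b = (\<lambda>i. of_bool ((ps ! j) i = 1))"
      and out: "\<And>N. concat (map (\<lambda>m. block (out (b m) m (transducer_state g b m))) [0..<N]) =
        concat (map (\<lambda>i. block (Suc (s i))) [0..<cnt N])" and cnt: "\<And>n. \<exists>N. n \<le> cnt N"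
    let ?p = "\<lambda>i. (ps ! j) i = 1"
    let ?w = "\<lambda>N. concat (map (\<lambda>m. block (out (b m) m (transducer_state g b m))) [0..<N])"
    have run: "\<exists>t s. (cstep ?p ^^ t) ([c], \<lambda>_. 0, 0, []) = ([Loop 0 body], s, N, ?w N) \<and>
        s 0 = 1 \<and> s 2 = N \<and> s 3 = transducer_state g b N" for N
    proof (induction N)
      case 0
      have "(cstep ?p ^^ 2) ([c], \<lambda>_. 0, 0, []) = ([Loop 0 body], (\<lambda>_. 0)(0 := 1), 0, ?w 0)"
        by (simp add: c_def numeral_2_eq_2)
      then show ?case by (intro exI conjI) (assumption, simp_all)
    next
      case (Suc N)
      then obtain t s where ts: "(cstep ?p ^^ t) ([c], \<lambda>_. 0, 0, []) = ([Loop 0 body], s, N, ?w N)"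
        and s: "s 0 = 1" "s 2 = N" "s 3 = transducer_state g b N" by blast
      obtain s' where s': "runs ?p body (s, N, ?w N) (s', Suc N, ?w N @ block (out (b N) N (transducer_state g b N)))"
        "s' 0 = 1" "s' 2 = Suc N" "s' 3 = g (b N) N (transducer_state g b N)"
        using body[OF s, of "b N" ?p N "?w N"] b by auto
      obtain t' where t': "(cstep ?p ^^ t') (body # [Loop 0 body], s, N, ?w N) =
          ([Loop 0 body], s', Suc N, ?w N @ block (out (b N) N (transducer_state g b N)))"
        using s'(1) unfolding runs_def by blast
      have "(cstep ?p ^^ 1) ([Loop 0 body], s, N, ?w N) = (body # [Loop 0 body], s, N, ?w N)"
        using s(1) by simp
      from funpow_trans[OF funpow_trans[OF ts this] t'] s'(2-4) show ?case
        by (intro exI[of _ "t' + (1 + t)"] exI[of _ s'] conjI) simp_all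
    qed
    show "F ps = Some (seq_name s)"
    proof (rule F(2)[OF ps])
      fix n
      obtain N where N: "n \<le> cnt N" using cnt by blast
      obtain t s' where t: "(cstep ?p ^^ t) ([c], \<lambda>_. 0, 0, []) = ([Loop 0 body], s', N, ?w N)"
        using run by blast
      have "n \<le> block_start s (cnt N)"
        using N strict_mono_imp_increasing[OF strict_mono_block_start[of s], of "cnt N"] by linarith
      then have "n \<le> length (?w N)" unfolding out length_blocks .
      moreover have "map of_bool (?w N) = map (seq_name s) [0..<length (?w N)]"
        unfolding out length_blocks by (rule seq_name_blocks)
      ultimately show "\<exists>t x s' i w. (cstep ?p ^^ t) ([c], \<lambda>_. 0, 0, []) = (x, s', i, w) \<and>
         n \<le> length w \<and> map of_bool w = map (seq_name s) [0..<length w]" using t by blast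
    qed
  qed
qed

section \<open>Closure properties of recursive functions\<close>

text \<open>A bound variable is put in front of the argument list: under a binder, \<open>hd\<close> is the bound variable
  and the arguments of the context are in the \<open>tl\<close>.\<close>

definition rec_fun :: "nat \<Rightarrow> (nat list \<Rightarrow> nat) \<Rightarrow> bool" where
  "rec_fun n f \<longleftrightarrow> (\<exists>e. \<forall>xs. length xs = n \<longrightarrow> rec_eval e xs (f xs))"

definition rec_pred :: "nat \<Rightarrow> (nat list \<Rightarrow> bool) \<Rightarrow> bool" where
  "rec_pred n P \<longleftrightarrow> rec_fun n (\<lambda>xs. of_bool (P xs))"

lemma rec_fun_cong: "(\<And>xs. length xs = n \<Longrightarrow> f xs = g xs) \<Longrightarrow> rec_fun n f \<Longrightarrow> rec_fun n g"
  unfolding rec_fun_def by metis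

lemma rec_fun_nth: "i < n \<Longrightarrow> rec_fun n (\<lambda>xs. xs ! i)"
  unfolding rec_fun_def by (intro exI[of _ "Proj i"]) (auto intro: rec_eval.intros)

lemma rec_fun_hd: "rec_fun (Suc n) hd"
proof -
  have "rec_fun (Suc n) (\<lambda>xs. xs ! 0)" by (rule rec_fun_nth) simp
  then show ?thesis by (rule rec_fun_cong[rotated]) (auto simp: length_Suc_conv)
qed

lemma rec_fun_comp:
  assumes "rec_fun (length fs) g" "\<And>f. f \<in> set fs \<Longrightarrow> rec_fun n f"
  shows "rec_fun n (\<lambda>xs. g (map (\<lambda>f. f xs) fs))"
proof -
  obtain e where e: "\<And>xs. length xs = length fs \<Longrightarrow> rec_eval e xs (g xs)"
    using assms(1) unfolding rec_fun_def by blast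
  obtain E where E: "\<And>f xs. f \<in> set fs \<Longrightarrow> length xs = n \<Longrightarrow> rec_eval (E f) xs (f xs)"
    using assms(2) unfolding rec_fun_def by metis
  show ?thesis
    unfolding rec_fun_def
  proof (intro exI allI impI)
    fix xs :: "nat list" assume "length xs = n"
    then show "rec_eval (Comp e (map E fs)) xs (g (map (\<lambda>f. f xs) fs))"
      using e E by (intro rec_eval.intros(4)[of _ _ "map (\<lambda>f. f xs) fs"])
        (auto simp: list_all2_conv_all_nth)
  qed
qed

lemma rec_fun_weaken: "rec_fun n f \<Longrightarrow> rec_fun (Suc n) (\<lambda>xs. f (tl xs))"
proof -
  assume f: "rec_fun n f"
  have "rec_fun (Suc n) (\<lambda>xs. f (map (\<lambda>h. h xs) (map (\<lambda>i xs. xs ! Suc i) [0..<n])))"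
    by (rule rec_fun_comp) (use f in \<open>auto intro: rec_fun_nth\<close>)
  moreover have "map (\<lambda>h. h xs) (map (\<lambda>i xs. xs ! Suc i) [0..<n]) = tl xs" if "length xs = Suc n" for xs :: "nat list"
    using that by (intro nth_equalityI) (auto simp: nth_tl)
  ultimately show ?thesis using rec_fun_cong by (metis (no_types, lifting))
qed

lemma rec_fun_Suc: "rec_fun n f \<Longrightarrow> rec_fun n (\<lambda>xs. Suc (f xs))"
proof -
  assume f: "rec_fun n f"
  have "rec_fun 1 (\<lambda>ys. Suc (hd ys))"
    unfolding rec_fun_def
    by (intro exI[of _ Succ]) (auto simp: length_Suc_conv intro: rec_eval.intros)
  then show ?thesis using rec_fun_comp[of "[f]" "\<lambda>ys. Suc (hd ys)" n] f by simp
qed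

lemma rec_fun_const: "rec_fun n (\<lambda>_. k)"
proof (induction k)
  case 0
  show ?case unfolding rec_fun_def by (intro exI[of _ Zero]) (auto intro: rec_eval.intros)
qed (rule rec_fun_Suc)

lemma rec_fun_rec_nat:
  assumes "rec_fun n b" "rec_fun n f" "rec_fun (Suc (Suc n)) (\<lambda>xs. g (hd xs) (hd (tl xs)) (tl (tl xs)))"
  shows "rec_fun n (\<lambda>xs. rec_nat (f xs) (\<lambda>k r. g k r xs) (b xs))"
proof -
  obtain ef where ef: "\<And>xs. length xs = n \<Longrightarrow> rec_eval ef xs (f xs)"
    using assms(2) unfolding rec_fun_def by blast
  obtain eg where eg: "\<And>xs. length xs = Suc (Suc n) \<Longrightarrow> rec_eval eg xs (g (hd xs) (hd (tl xs)) (tl (tl xs)))"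
    using assms(3) unfolding rec_fun_def by blast
  have ev: "rec_eval (Prec ef eg) (k # xs) (rec_nat (f xs) (\<lambda>k r. g k r xs) k)" if "length xs = n" for k xs
  proof (induction k)
    case 0
    then show ?case using ef that by (auto intro: rec_eval.intros)
  next
    case (Suc k)
    then show ?case using eg[of "k # _ # xs"] that by (auto intro: rec_eval.intros)
  qed
  have "rec_fun (Suc n) (\<lambda>xs. rec_nat (f (tl xs)) (\<lambda>k r. g k r (tl xs)) (hd xs))"
    unfolding rec_fun_def
  proof (intro exI allI impI)
    fix xs :: "nat list" assume "length xs = Suc n"
    then show "rec_eval (Prec ef eg) xs (rec_nat (f (tl xs)) (\<lambda>k r. g k r (tl xs)) (hd xs))"
      using ev[of "tl xs" "hd xs"] by (cases xs) auto
  qed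
  then have "rec_fun n (\<lambda>xs. (\<lambda>xs. rec_nat (f (tl xs)) (\<lambda>k r. g k r (tl xs)) (hd xs))
      (map (\<lambda>h. h xs) (b # map (\<lambda>i xs. xs ! i) [0..<n])))"
    by (intro rec_fun_comp) (use assms(1) in \<open>auto intro: rec_fun_nth\<close>)
  moreover have "map (\<lambda>h. h xs) (map (\<lambda>i xs. xs ! i) [0..<n]) = xs" if "length xs = n" for xs :: "nat list"
    using that by (intro nth_equalityI) auto
  ultimately show ?thesis by (elim rec_fun_cong[rotated]) simp
qed

lemma rec_fun_add:
  assumes "rec_fun n f" "rec_fun n g"
  shows "rec_fun n (\<lambda>xs. f xs + g xs)"
proof -
  have "rec_nat a (\<lambda>k r. Suc r) b = a + b" for a b by (induction b) auto
  then show ?thesis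
    using rec_fun_rec_nat[OF assms(2,1), of "\<lambda>_ r _. Suc r"] rec_fun_Suc[OF rec_fun_weaken[OF rec_fun_hd]] by simp
qed

lemma rec_fun_mult:
  assumes "rec_fun n f" "rec_fun n g"
  shows "rec_fun n (\<lambda>xs. f xs * g xs)"
proof -
  have "rec_nat 0 (\<lambda>k r. r + a) b = a * b" for a b :: nat by (induction b) auto
  then show ?thesis
    using rec_fun_rec_nat[OF assms(2) rec_fun_const[of _ 0], of "\<lambda>_ r xs. r + f xs"]
      rec_fun_add[OF rec_fun_weaken[OF rec_fun_hd] rec_fun_weaken[OF rec_fun_weaken[OF assms(1)]]] by simp
qed

lemma rec_fun_diff:
  assumes "rec_fun n f" "rec_fun n g"
  shows "rec_fun n (\<lambda>xs. f xs - g xs)"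
proof -
  have pred: "rec_fun m (\<lambda>xs. h xs - 1)" if "rec_fun m h" for m h
  proof -
    have "rec_nat 0 (\<lambda>k r. k) b = b - 1" for b :: nat by (cases b) auto
    then show ?thesis using rec_fun_rec_nat[OF that rec_fun_const[of _ 0], of "\<lambda>k _ _. k"] rec_fun_hd by simp
  qed
  have "rec_nat a (\<lambda>k r. r - 1) b = a - b" for a b :: nat by (induction b) auto
  then show ?thesis
    using rec_fun_rec_nat[OF assms(2,1), of "\<lambda>_ r xs. r - 1"] pred[OF rec_fun_weaken[OF rec_fun_hd]] by simp
qed

lemma rec_fun_power:
  assumes "rec_fun n f" "rec_fun n g"
  shows "rec_fun n (\<lambda>xs. f xs ^ g xs)"
proof -
  have "rec_nat 1 (\<lambda>k r. r * a) b = a ^ b" for a b :: nat by (induction b) auto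
  then show ?thesis
    using rec_fun_rec_nat[OF assms(2) rec_fun_const[of _ 1], of "\<lambda>_ r xs. r * f xs"]
      rec_fun_mult[OF rec_fun_weaken[OF rec_fun_hd] rec_fun_weaken[OF rec_fun_weaken[OF assms(1)]]] by simp
qed

text \<open>Bounded quantifiers, halving and the decoding of pairs are all expressed through bounded
  sums.\<close>

lemma rec_fun_sum:
  assumes "rec_fun n b" "rec_fun (Suc n) (\<lambda>xs. f (hd xs) (tl xs))"
  shows "rec_fun n (\<lambda>xs. \<Sum>k<b xs. f k xs)"
proof -
  have "rec_nat 0 (\<lambda>k r. r + h k) b = (\<Sum>k<b. h k)" for h :: "nat \<Rightarrow> nat" and b by (induction b) auto
  moreover have "rec_fun (Suc (Suc n)) (\<lambda>xs. f (hd xs) (tl (tl xs)))"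
  proof -
    have "rec_fun (Suc (Suc n)) (\<lambda>xs. (\<lambda>ys. f (hd ys) (tl ys))
        (map (\<lambda>h. h xs) (hd # map (\<lambda>i xs. xs ! Suc (Suc i)) [0..<n])))"
      by (intro rec_fun_comp) (use assms(2) in \<open>auto intro: rec_fun_nth rec_fun_hd\<close>)
    moreover have "map (\<lambda>h. h xs) (map (\<lambda>i xs. xs ! Suc (Suc i)) [0..<n]) = tl (tl xs)"
      if "length xs = Suc (Suc n)" for xs :: "nat list"
      using that by (intro nth_equalityI) (auto simp: nth_tl)
    ultimately show ?thesis by (elim rec_fun_cong[rotated]) simp
  qed
  ultimately show ?thesis
    using rec_fun_rec_nat[OF assms(1) rec_fun_const[of _ 0], of "\<lambda>k r xs. r + f k xs"]
      rec_fun_add[OF rec_fun_weaken[OF rec_fun_hd], of n "\<lambda>xs. f (hd xs) (tl (tl xs))"] by simp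
qed

lemma rec_pred_le: "rec_fun n f \<Longrightarrow> rec_fun n g \<Longrightarrow> rec_pred n (\<lambda>xs. f xs \<le> g xs)"
  unfolding rec_pred_def
  using rec_fun_diff[OF rec_fun_const[of n 1] rec_fun_diff[of n f g]] by (rule rec_fun_cong[rotated]) auto

lemma rec_pred_not: "rec_pred n P \<Longrightarrow> rec_pred n (\<lambda>xs. \<not> P xs)"
  unfolding rec_pred_def
  using rec_fun_diff[OF rec_fun_const[of n 1], of "\<lambda>xs. of_bool (P xs)"] by (rule rec_fun_cong[rotated]) auto

lemma rec_pred_conj: "rec_pred n P \<Longrightarrow> rec_pred n Q \<Longrightarrow> rec_pred n (\<lambda>xs. P xs \<and> Q xs)"
  unfolding rec_pred_def
  using rec_fun_mult[of n "\<lambda>xs. of_bool (P xs)" "\<lambda>xs. of_bool (Q xs)"] by (simp only: of_bool_conj)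

lemma rec_pred_disj:
  assumes "rec_pred n P" "rec_pred n Q"
  shows "rec_pred n (\<lambda>xs. P xs \<or> Q xs)"
proof -
  have "rec_pred n (\<lambda>xs. \<not> (\<not> P xs \<and> \<not> Q xs))" by (intro rec_pred_not rec_pred_conj assms)
  then show ?thesis by simp
qed

lemma rec_pred_less:
  assumes "rec_fun n f" "rec_fun n g"
  shows "rec_pred n (\<lambda>xs. f xs < g xs)"
proof -
  have "rec_pred n (\<lambda>xs. \<not> g xs \<le> f xs)" by (intro rec_pred_not rec_pred_le assms)
  then show ?thesis by (simp only: not_le)
qed

lemma rec_pred_eq:
  assumes "rec_fun n f" "rec_fun n g"
  shows "rec_pred n (\<lambda>xs. f xs = g xs)"
proof -
  have "rec_pred n (\<lambda>xs. f xs \<le> g xs \<and> g xs \<le> f xs)" by (intro rec_pred_conj rec_pred_le assms)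
  then show ?thesis by (simp only: order_eq_iff)
qed

lemma rec_pred_ex:
  assumes "rec_fun n b" "rec_pred (Suc n) (\<lambda>xs. P (hd xs) (tl xs))"
  shows "rec_pred n (\<lambda>xs. \<exists>k<b xs. P k xs)"
proof -
  have "rec_pred n (\<lambda>xs. 0 < (\<Sum>k<b xs. of_bool (P k xs) :: nat))"
    using assms unfolding rec_pred_def[of "Suc n"] by (intro rec_pred_less rec_fun_const rec_fun_sum)
  moreover have "0 < (\<Sum>k<b xs. of_bool (P k xs) :: nat) \<longleftrightarrow> (\<exists>k<b xs. P k xs)" for xs
    by (simp only: sum_eq_0_iff finite_lessThan of_bool_eq_0_iff flip: neq0_conv) auto
  ultimately show ?thesis by (simp only:)
qed

lemma rec_pred_all:
  assumes "rec_fun n b" "rec_pred (Suc n) (\<lambda>xs. P (hd xs) (tl xs))"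
  shows "rec_pred n (\<lambda>xs. \<forall>k<b xs. P k xs)"
proof -
  have "rec_pred n (\<lambda>xs. \<not> (\<exists>k<b xs. \<not> P k xs))" by (intro rec_pred_not rec_pred_ex assms)
  then show ?thesis by (simp only: not_ex not_not de_Morgan_conj imp_conv_disj)
qed

lemma rec_fun_of_bool: "rec_pred n P \<Longrightarrow> rec_fun n (\<lambda>xs. of_bool (P xs))"
  by (simp only: rec_pred_def)

lemma rec_fun_if:
  assumes "rec_pred n P" "rec_fun n f" "rec_fun n g"
  shows "rec_fun n (\<lambda>xs. if P xs then f xs else g xs)"
proof -
  have "rec_fun n (\<lambda>xs. of_bool (P xs) * f xs + of_bool (\<not> P xs) * g xs)"
    by (intro rec_fun_add rec_fun_mult rec_fun_of_bool rec_pred_not assms)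
  then show ?thesis by (rule rec_fun_cong[rotated]) simp
qed

lemma rec_fun_recursive2:
  assumes "recursive2 h" "rec_fun n f" "rec_fun n g"
  shows "rec_fun n (\<lambda>xs. h (f xs) (g xs))"
proof -
  obtain e where e: "\<And>i j. rec_eval e [i, j] (h i j)" using assms(1) unfolding recursive2_def by blast
  have "rec_fun (length [f, g]) (\<lambda>ys. h (ys ! 0) (ys ! 1))"
    unfolding rec_fun_def
  proof (intro exI allI impI)
    fix ys :: "nat list" assume "length ys = length [f, g]"
    then obtain i j where "ys = [i, j]" by (auto simp: length_Suc_conv)
    then show "rec_eval e ys (h (ys ! 0) (ys ! 1))" using e by simp
  qed
  from rec_fun_comp[OF this, of n] show ?thesis using assms(2,3) by auto
qed

lemmas rec_fun_intros = rec_fun_add rec_fun_mult rec_fun_diff rec_fun_power rec_fun_sum rec_fun_Suc rec_fun_const rec_fun_hd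
  rec_pred_le rec_pred_not rec_pred_conj rec_pred_disj rec_pred_less rec_pred_eq rec_pred_ex rec_pred_all rec_fun_of_bool rec_fun_if

section \<open>Halving, pairing and binary digits\<close>

lemma rec_fun_div2:
  assumes "rec_fun n f"
  shows "rec_fun n (\<lambda>xs. f xs div 2)"
proof -
  have "(\<Sum>k<x. of_bool (2 * Suc k \<le> x)) = x div 2" for x :: nat
  proof -
    have "(\<Sum>k<x. of_bool (2 * Suc k \<le> x)) = card {k \<in> {..<x}. 2 * Suc k \<le> x}"
      by (simp add: sum.If_cases of_bool_def Int_def)
    also have "{k \<in> {..<x}. 2 * Suc k \<le> x} = {..<x div 2}" by auto
    finally show ?thesis by simp
  qed
  moreover have "rec_fun n (\<lambda>xs. \<Sum>k<f xs. of_bool (2 * Suc k \<le> f xs))"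
    by (intro rec_fun_intros assms rec_fun_weaken[OF assms])
  ultimately show ?thesis by simp
qed

lemma rec_pred_even:
  assumes "rec_fun n f"
  shows "rec_pred n (\<lambda>xs. even (f xs))"
proof -
  have "rec_pred n (\<lambda>xs. 2 * (f xs div 2) = f xs)"
    by (intro rec_fun_intros rec_fun_div2 assms)
  moreover have "2 * (x div 2) = x \<longleftrightarrow> even x" for x :: nat by presburger
  ultimately show ?thesis by (simp only:)
qed

lemma rec_fun_prod_encode:
  assumes "rec_fun n f" "rec_fun n g"
  shows "rec_fun n (\<lambda>xs. prod_encode (f xs, g xs))"
  unfolding prod_encode_def triangle_def prod.case
  by (intro rec_fun_intros rec_fun_div2 assms)

text \<open>Both components of a pair are at most its code, so decoding is a bounded search; a
  single pair has code \<open>x\<close>, so the double sum has at most one nonzero term.\<close>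

lemma rec_fun_fst_prod_decode:
  assumes "rec_fun n f"
  shows "rec_fun n (\<lambda>xs. fst (prod_decode (f xs)))"
proof -
  have "(\<Sum>a<Suc x. \<Sum>b<Suc x. if prod_encode (a, b) = x then a else 0) = fst (prod_decode x)" for x
  proof -
    obtain u v where uv: "prod_decode x = (u, v)" by fastforce
    then have x: "x = prod_encode (u, v)" using prod_decode_inverse[of x] by simp
    have le: "u < Suc x" "v < Suc x" using le_prod_encode_1 le_prod_encode_2 x by (auto simp: less_Suc_eq_le)
    have "(\<Sum>a<Suc x. \<Sum>b<Suc x. if prod_encode (a, b) = x then a else 0) =
        (\<Sum>a<Suc x. \<Sum>b<Suc x. if b = v then if a = u then u else 0 else 0)"
      using x by (intro sum.cong) auto
    also have "\<dots> = u" using le by (simp del: sum.lessThan_Suc)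
    finally show ?thesis using uv by simp
  qed
  moreover have "rec_fun n (\<lambda>xs. \<Sum>a<Suc (f xs). \<Sum>b<Suc (f xs). if prod_encode (a, b) = f xs then a else 0)"
    by (intro rec_fun_intros rec_fun_prod_encode assms rec_fun_weaken[OF assms] rec_fun_weaken[OF rec_fun_weaken[OF assms]] rec_fun_weaken[OF rec_fun_hd])
  ultimately show ?thesis by simp
qed

lemma rec_fun_snd_prod_decode:
  assumes "rec_fun n f"
  shows "rec_fun n (\<lambda>xs. snd (prod_decode (f xs)))"
proof -
  have "(\<Sum>b<Suc x. of_bool (prod_encode (fst (prod_decode x), b) = x) * b) = snd (prod_decode x)" for x
  proof -
    obtain u v where uv: "prod_decode x = (u, v)" by fastforce
    then have x: "x = prod_encode (u, v)" using prod_decode_inverse[of x] by simp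
    have le: "v < Suc x" using le_prod_encode_2 x by (auto simp: less_Suc_eq_le)
    have "(\<Sum>b<Suc x. of_bool (prod_encode (u, b) = x) * b) = (\<Sum>b<Suc x. if b = v then b else 0)"
      using x by (intro sum.cong) auto
    also have "\<dots> = v" using le by (simp del: sum.lessThan_Suc)
    finally show ?thesis using uv by simp
  qed
  moreover have "rec_fun n (\<lambda>xs. \<Sum>b<Suc (f xs). of_bool (prod_encode (fst (prod_decode (f xs)), b) = f xs) * b)"
    by (intro rec_fun_intros rec_fun_prod_encode rec_fun_fst_prod_decode assms rec_fun_weaken[OF assms])
  ultimately show ?thesis by simp
qed

text \<open>Here \<open>q\<close> is the part of \<open>h\<close> above digit \<open>j\<close> and
  \<open>r\<close> the part below it. Both are bounded, so digits come from bounded quantifiers,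
  without dividing by a power of 2.\<close>

lemma bit_iff_ex: "bit h j \<longleftrightarrow> (\<exists>q<Suc h. \<exists>r<2 ^ j. h = (2 * q + 1) * 2 ^ j + r)" for h j :: nat
proof
  assume "bit h j"
  then have "odd (h div 2 ^ j)" by (simp add: bit_iff_odd)
  then obtain q where q: "h div 2 ^ j = 2 * q + 1" by (elim oddE)
  have "h = (2 * q + 1) * 2 ^ j + h mod 2 ^ j" using q by (metis div_mult_mod_eq)
  moreover have "q \<le> h div 2 ^ j" using q by simp
  then have "q < Suc h" using div_le_dividend[of h "2 ^ j"] by linarith
  ultimately show "\<exists>q<Suc h. \<exists>r<2 ^ j. h = (2 * q + 1) * 2 ^ j + r"
    by (intro exI[of _ q] conjI exI[of _ "h mod 2 ^ j"]) auto
next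
  assume "\<exists>q<Suc h. \<exists>r<2 ^ j. h = (2 * q + 1) * 2 ^ j + r"
  then obtain q r where r: "r < 2 ^ j" "h = (2 * q + 1) * 2 ^ j + r" by blast
  have "h div 2 ^ j = 2 * q + 1" unfolding r(2) by (subst div_mult_self3) (use r(1) in simp_all)
  then show "bit h j" by (simp add: bit_iff_odd)
qed

lemma rec_pred_bit:
  assumes "rec_fun n f" "rec_fun n g"
  shows "rec_pred n (\<lambda>xs. bit (f xs) (g xs))"
  unfolding bit_iff_ex
  by (intro rec_fun_intros assms rec_fun_weaken[OF assms(1)] rec_fun_weaken[OF assms(2)] rec_fun_weaken[OF rec_fun_weaken[OF assms(1)]]
      rec_fun_weaken[OF rec_fun_weaken[OF assms(2)]] rec_fun_weaken[OF rec_fun_hd])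

section \<open>The decidable test\<close>

text \<open>The names of the two measures sit at the positions \<open>2 * j\<close> and \<open>4 * j + 1\<close> of the input;
  \<open>c\<close> and \<open>d\<close> select one of them. A virtual symbol 1 in front of the name lets the first block look
  like all others. Only the first \<open>m\<close> input bits are inspected.\<close>

definition source_bit :: "nat \<Rightarrow> nat \<Rightarrow> (nat \<Rightarrow> bool) \<Rightarrow> nat \<Rightarrow> bool" where
  "source_bit c d B j \<longleftrightarrow> j = 0 \<or> B (c * (j - 1) + d)"

text \<open>The bound \<open>4 * (i + v + 1) + 1 < m\<close> exceeds every input position that is
  consulted, for both sources \<open>2, 0\<close> and \<open>4, 1\<close>; the same bound for both
  keeps stage \<open>m\<close> within the first \<open>m\<close> bits.\<close>

definition listed :: "nat \<Rightarrow> nat \<Rightarrow> (nat \<Rightarrow> bool) \<Rightarrow> nat \<Rightarrow> nat \<Rightarrow> bool" where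
  "listed c d B m v \<longleftrightarrow> (\<exists>i<m. 4 * (i + v + 1) + 1 < m \<and> source_bit c d B i \<and>
     (\<forall>k<v. \<not> source_bit c d B (i + 1 + k)) \<and> source_bit c d B (i + 1 + v))"

text \<open>\<open>abs_decode\<close> is the absolute value of \<open>int_decode\<close>, so the rational with number
  \<open>prod_encode (a, b)\<close> has absolute value \<open>abs_decode a / abs_decode b\<close>.\<close>

definition abs_decode :: "nat \<Rightarrow> nat" where
  "abs_decode x = Suc x div 2"

text \<open>Tests whether a listed bound shows that the measure of \<open>\<alpha> e\<close>, times the absolute value of the
  rational with number \<open>prod_encode (a, b)\<close>, is at least \<open>(t + 1) / D\<close>, respectively at most \<open>t / D\<close>.\<close>

definition lower_test :: "nat \<Rightarrow> nat \<Rightarrow> (nat \<Rightarrow> bool) \<Rightarrow> nat \<Rightarrow> nat \<Rightarrow> nat \<Rightarrow> nat \<Rightarrow> nat \<Rightarrow> nat \<Rightarrow> bool" where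
  "lower_test c d B m a b e D t \<longleftrightarrow> (\<exists>u\<^sub>1<m. \<exists>u\<^sub>2<m. \<exists>v<m.
     listed c d B m (prod_encode (prod_encode (u\<^sub>1, u\<^sub>2), prod_encode (e, v))) \<and> even (u\<^sub>1 + u\<^sub>2) \<and> 0 < u\<^sub>2 \<and> 0 < b \<and>
     Suc t * (abs_decode b * abs_decode u\<^sub>2) \<le> abs_decode a * abs_decode u\<^sub>1 * D)"

definition upper_test :: "nat \<Rightarrow> nat \<Rightarrow> (nat \<Rightarrow> bool) \<Rightarrow> nat \<Rightarrow> nat \<Rightarrow> nat \<Rightarrow> nat \<Rightarrow> nat \<Rightarrow> nat \<Rightarrow> bool" where
  "upper_test c d B m a b e D t \<longleftrightarrow> (\<exists>u<m. \<exists>v\<^sub>1<m. \<exists>v\<^sub>2<m.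
     listed c d B m (prod_encode (u, prod_encode (e, prod_encode (v\<^sub>1, v\<^sub>2)))) \<and>
     (b = 0 \<or> abs_decode a * abs_decode v\<^sub>1 * D \<le> t * (abs_decode b * abs_decode v\<^sub>2)))"

text \<open>Counting thresholds yields \<open>D\<close> times the best lower bound known at stage
  \<open>m\<close>, rounded down and capped at \<open>m\<close>. Dually, \<open>upper\<close> rounds
  the best upper bound up and is capped at \<open>K\<close>, the value it has while no upper bound
  is known.\<close>

definition lower :: "nat \<Rightarrow> nat \<Rightarrow> (nat \<Rightarrow> bool) \<Rightarrow> nat \<Rightarrow> nat \<Rightarrow> nat \<Rightarrow> nat \<Rightarrow> nat \<Rightarrow> nat" where
  "lower c d B m a b e D = (\<Sum>t<m. of_bool (lower_test c d B m a b e D t))"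

definition upper :: "nat \<Rightarrow> nat \<Rightarrow> (nat \<Rightarrow> bool) \<Rightarrow> nat \<Rightarrow> nat \<Rightarrow> nat \<Rightarrow> nat \<Rightarrow> nat \<Rightarrow> nat \<Rightarrow> nat" where
  "upper c d B m K a b e D = (\<Sum>t<K. of_bool (\<not> upper_test c d B m a b e D t))"

text \<open>A nonempty list has the code \<open>Suc (prod_encode (x, rest))\<close>, which explains
  \<open>r - 1\<close>. The code 0 of the empty list is a fixed point, so going past the end does no
  harm.\<close>

definition list_rest :: "nat \<Rightarrow> nat \<Rightarrow> nat" where
  "list_rest c k = rec_nat c (\<lambda>_ r. snd (prod_decode (r - 1))) k"

definition list_elem :: "nat \<Rightarrow> nat \<Rightarrow> nat" where
  "list_elem c k = fst (prod_decode (list_rest c k - 1))"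

definition coeff_num :: "nat \<Rightarrow> nat" where "coeff_num x = fst (prod_decode (fst (prod_decode x)))"
definition coeff_den :: "nat \<Rightarrow> nat" where "coeff_den x = snd (prod_decode (fst (prod_decode x)))"

text \<open>A step function contributes coefficient times the difference of the measures on
  \<open>a\<close> and on \<open>b\<close>. To stay within the natural numbers, each product is put
  on the side where its sign is positive; parity of the two codes is the sign of the coefficient, so
  a negative one swaps \<open>a\<close> and \<open>b\<close>.\<close>

definition lower_term :: "(nat \<Rightarrow> nat \<Rightarrow> nat) \<Rightarrow> (nat \<Rightarrow> bool) \<Rightarrow> nat \<Rightarrow> nat \<Rightarrow> nat \<Rightarrow> nat \<Rightarrow> nat \<Rightarrow> nat" where
  "lower_term fi B m x a b D = lower 2 0 B m (coeff_num x) (coeff_den x)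
     (fi (snd (prod_decode x)) (if even (coeff_num x + coeff_den x) then a else b)) D"

definition upper_term :: "(nat \<Rightarrow> nat \<Rightarrow> nat) \<Rightarrow> (nat \<Rightarrow> bool) \<Rightarrow> nat \<Rightarrow> nat \<Rightarrow> nat \<Rightarrow> nat \<Rightarrow> nat \<Rightarrow> nat \<Rightarrow> nat" where
  "upper_term fi B m K x a b D = upper 2 0 B m K (coeff_num x) (coeff_den x)
     (fi (snd (prod_decode x)) (if even (coeff_num x + coeff_den x) then b else a)) D"

text \<open>With \<open>K\<close> as a bound on the left-hand side, an upper bound that is not known yet makes the
  test fail.\<close>

definition separated :: "(nat \<Rightarrow> nat \<Rightarrow> nat) \<Rightarrow> (nat \<Rightarrow> bool) \<Rightarrow> nat \<Rightarrow> nat \<Rightarrow> nat \<Rightarrow> nat \<Rightarrow> nat \<Rightarrow> nat \<Rightarrow> nat \<Rightarrow> bool" where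
  "separated fi B m K c i D a b \<longleftrightarrow>
     2 ^ i * ((\<Sum>k<c. if list_rest c k = 0 then 0 else upper_term fi B m K (list_elem c k) a b D) +
        upper 4 1 B m K 2 2 a D) + D <
     2 ^ i * ((\<Sum>k<c. if list_rest c k = 0 then 0 else lower_term fi B m (list_elem c k) a b D) +
        lower 4 1 B m 2 2 b D)"

text \<open>Bounding \<open>D\<close>, \<open>a\<close> and \<open>b\<close> by \<open>m\<close>
  dovetails the search. The cap \<open>Suc c * m\<close> dominates all lower counts together: a list
  with code \<open>c\<close> has at most \<open>c\<close> entries, each counting at most
  \<open>m\<close>, and the second measure adds one more count.\<close>

definition far_test :: "(nat \<Rightarrow> nat \<Rightarrow> nat) \<Rightarrow> (nat \<Rightarrow> nat \<Rightarrow> nat) \<Rightarrow> (nat \<Rightarrow> bool) \<Rightarrow> nat \<Rightarrow> nat \<Rightarrow> bool" where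
  "far_test fi fd B n m \<longleftrightarrow> (\<exists>D<m. \<exists>a<m. \<exists>b<m.
     separated fi B m (Suc (fst (prod_decode n)) * m) (fst (prod_decode n)) (snd (prod_decode n)) D a (fd b a))"

lemma not_far_test_0: "\<not> far_test fi fd B n 0"
  by (simp add: far_test_def)

section \<open>Locality and recursiveness of the test\<close>

lemma source_bit_cong: "(\<And>j. j < m \<Longrightarrow> B j = B' j) \<Longrightarrow> c * (j - 1) + d < m \<Longrightarrow> source_bit c d B j = source_bit c d B' j"
  by (simp add: source_bit_def)

lemma listed_cong:
  assumes "\<And>j. j < m \<Longrightarrow> B j = B' j" "c \<le> 4" "d \<le> 1"
  shows "listed c d B m v = listed c d B' m v"
proof -
  have eq: "source_bit c d B j = source_bit c d B' j" if "j \<le> i + v + 1" "4 * (i + v + 1) + 1 < m" for i j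
  proof (rule source_bit_cong[OF assms(1)])
    have "c * (j - 1) \<le> 4 * (i + v + 1)" using that(1) assms(2) by (intro mult_mono) auto
    then show "c * (j - 1) + d < m" using that(2) assms(3) by linarith
  qed
  have "(source_bit c d B i \<and> (\<forall>k<v. \<not> source_bit c d B (i + 1 + k)) \<and> source_bit c d B (i + 1 + v)) =
      (source_bit c d B' i \<and> (\<forall>k<v. \<not> source_bit c d B' (i + 1 + k)) \<and> source_bit c d B' (i + 1 + v))"
    if "4 * (i + v + 1) + 1 < m" for i
    using eq[of i i] eq[of "i + 1 + v" i] eq[of "i + 1 + _" i] that by auto
  then have "(4 * (i + v + 1) + 1 < m \<and> source_bit c d B i \<and> (\<forall>k<v. \<not> source_bit c d B (i + 1 + k)) \<and> source_bit c d B (i + 1 + v)) =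
      (4 * (i + v + 1) + 1 < m \<and> source_bit c d B' i \<and> (\<forall>k<v. \<not> source_bit c d B' (i + 1 + k)) \<and> source_bit c d B' (i + 1 + v))" for i
    by meson
  then show ?thesis unfolding listed_def by (simp only:)
qed

text \<open>This lets the enumerator run stage \<open>m\<close> on the finitely many digits it has
  read, in place of the infinite input.\<close>

lemma far_test_cong:
  assumes "\<And>j. j < m \<Longrightarrow> B j = B' j"
  shows "far_test fi fd B n m = far_test fi fd B' n m"
proof -
  have "listed 2 0 B m = listed 2 0 B' m" "listed 4 1 B m = listed 4 1 B' m"
    using listed_cong[of m B B'] assms by auto
  then show ?thesis
    unfolding far_test_def separated_def lower_term_def upper_term_def lower_def upper_def lower_test_def upper_test_def
    by (simp only:)
qed

lemma rec_pred_source_bit: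
  assumes "rec_fun n h" "rec_fun n f"
  shows "rec_pred n (\<lambda>xs. source_bit c d (bit (h xs)) (f xs))"
  unfolding source_bit_def by (intro rec_fun_intros rec_pred_bit assms)

lemma rec_pred_listed:
  assumes "rec_fun n h" "rec_fun n m" "rec_fun n v"
  shows "rec_pred n (\<lambda>xs. listed c d (bit (h xs)) (m xs) (v xs))"
  unfolding listed_def
  by (intro rec_fun_intros rec_pred_source_bit assms assms[THEN rec_fun_weaken] assms[THEN rec_fun_weaken, THEN rec_fun_weaken] rec_fun_weaken[OF rec_fun_hd])

lemma rec_fun_abs_decode: "rec_fun n f \<Longrightarrow> rec_fun n (\<lambda>xs. abs_decode (f xs))"
  unfolding abs_decode_def by (intro rec_fun_div2 rec_fun_Suc)

lemma rec_pred_lower_test: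
  assumes "rec_fun n h" "rec_fun n m" "rec_fun n a" "rec_fun n b" "rec_fun n e" "rec_fun n D" "rec_fun n t"
  shows "rec_pred n (\<lambda>xs. lower_test c d (bit (h xs)) (m xs) (a xs) (b xs) (e xs) (D xs) (t xs))"
  unfolding lower_test_def
  by (intro rec_fun_intros rec_pred_listed rec_pred_even rec_fun_prod_encode rec_fun_abs_decode assms assms[THEN rec_fun_weaken]
      assms[THEN rec_fun_weaken, THEN rec_fun_weaken] assms[THEN rec_fun_weaken, THEN rec_fun_weaken, THEN rec_fun_weaken]
      rec_fun_weaken[OF rec_fun_hd] rec_fun_weaken[OF rec_fun_weaken[OF rec_fun_hd]])

lemma rec_pred_upper_test:
  assumes "rec_fun n h" "rec_fun n m" "rec_fun n a" "rec_fun n b" "rec_fun n e" "rec_fun n D" "rec_fun n t"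
  shows "rec_pred n (\<lambda>xs. upper_test c d (bit (h xs)) (m xs) (a xs) (b xs) (e xs) (D xs) (t xs))"
  unfolding upper_test_def
  by (intro rec_fun_intros rec_pred_listed rec_pred_even rec_fun_prod_encode rec_fun_abs_decode assms assms[THEN rec_fun_weaken]
      assms[THEN rec_fun_weaken, THEN rec_fun_weaken] assms[THEN rec_fun_weaken, THEN rec_fun_weaken, THEN rec_fun_weaken]
      rec_fun_weaken[OF rec_fun_hd] rec_fun_weaken[OF rec_fun_weaken[OF rec_fun_hd]])

lemma rec_fun_lower:
  assumes "rec_fun n h" "rec_fun n m" "rec_fun n a" "rec_fun n b" "rec_fun n e" "rec_fun n D"
  shows "rec_fun n (\<lambda>xs. lower c d (bit (h xs)) (m xs) (a xs) (b xs) (e xs) (D xs))"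
  unfolding lower_def by (intro rec_fun_intros rec_pred_lower_test assms assms[THEN rec_fun_weaken])

lemma rec_fun_upper:
  assumes "rec_fun n h" "rec_fun n m" "rec_fun n a" "rec_fun n b" "rec_fun n e" "rec_fun n D" "rec_fun n K"
  shows "rec_fun n (\<lambda>xs. upper c d (bit (h xs)) (m xs) (K xs) (a xs) (b xs) (e xs) (D xs))"
  unfolding upper_def by (intro rec_fun_intros rec_pred_upper_test assms assms[THEN rec_fun_weaken])

lemma rec_fun_list_rest:
  assumes "rec_fun n c" "rec_fun n k"
  shows "rec_fun n (\<lambda>xs. list_rest (c xs) (k xs))"
  unfolding list_rest_def
  by (intro rec_fun_rec_nat rec_fun_snd_prod_decode rec_fun_intros assms rec_fun_weaken[OF rec_fun_hd])

lemma rec_fun_list_elem: "rec_fun n c \<Longrightarrow> rec_fun n k \<Longrightarrow> rec_fun n (\<lambda>xs. list_elem (c xs) (k xs))"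
  unfolding list_elem_def by (intro rec_fun_fst_prod_decode rec_fun_intros rec_fun_list_rest)

lemma rec_fun_coeff: "rec_fun n x \<Longrightarrow> rec_fun n (\<lambda>xs. coeff_num (x xs))" "rec_fun n x \<Longrightarrow> rec_fun n (\<lambda>xs. coeff_den (x xs))"
  unfolding coeff_num_def coeff_den_def by (intro rec_fun_fst_prod_decode rec_fun_snd_prod_decode; assumption)+

lemma rec_fun_terms:
  assumes "recursive2 fi" "rec_fun n h" "rec_fun n m" "rec_fun n x" "rec_fun n a" "rec_fun n b" "rec_fun n D"
  shows "rec_fun n (\<lambda>xs. lower_term fi (bit (h xs)) (m xs) (x xs) (a xs) (b xs) (D xs))"
    and "rec_fun n K \<Longrightarrow> rec_fun n (\<lambda>xs. upper_term fi (bit (h xs)) (m xs) (K xs) (x xs) (a xs) (b xs) (D xs))"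
  unfolding lower_term_def upper_term_def
  by (intro rec_fun_lower rec_fun_upper rec_fun_recursive2[OF assms(1)] rec_fun_intros rec_pred_even rec_fun_coeff rec_fun_snd_prod_decode assms(2-); assumption?)+

lemma rec_pred_separated:
  assumes fi: "recursive2 fi" and "rec_fun n h" "rec_fun n m" "rec_fun n K" "rec_fun n c" "rec_fun n i" "rec_fun n D" "rec_fun n a" "rec_fun n b"
  shows "rec_pred n (\<lambda>xs. separated fi (bit (h xs)) (m xs) (K xs) (c xs) (i xs) (D xs) (a xs) (b xs))"
  unfolding separated_def
  by (intro rec_fun_intros rec_fun_terms[OF fi] rec_fun_lower rec_fun_upper rec_fun_list_rest rec_fun_list_elem assms(2-) assms(2-)[THEN rec_fun_weaken])

lemma rec_pred_far_test:
  assumes fi: "recursive2 fi" and fd: "recursive2 fd" and "rec_fun l h" "rec_fun l n" "rec_fun l m"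
  shows "rec_pred l (\<lambda>xs. far_test fi fd (bit (h xs)) (n xs) (m xs))"
  unfolding far_test_def
  by (intro rec_fun_intros rec_pred_separated[OF fi] rec_fun_recursive2[OF fd] rec_fun_fst_prod_decode rec_fun_snd_prod_decode
      assms(3-) assms(3-)[THEN rec_fun_weaken] assms(3-)[THEN rec_fun_weaken, THEN rec_fun_weaken]
      assms(3-)[THEN rec_fun_weaken, THEN rec_fun_weaken, THEN rec_fun_weaken] rec_fun_weaken[OF rec_fun_hd] rec_fun_weaken[OF rec_fun_weaken[OF rec_fun_hd]])

section \<open>The two machines\<close>

lemma rec_fun_transducer:
  assumes "rec_fun 3 (\<lambda>xs. f (xs ! 0) (xs ! 1) (xs ! 2))"
  obtains e where "\<And>b m z. rec_eval e [b, m, z] (f b m z)"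
proof -
  obtain e where "\<And>xs. length xs = 3 \<Longrightarrow> rec_eval e xs (f (xs ! 0) (xs ! 1) (xs ! 2))"
    using assms unfolding rec_fun_def by blast
  from this[of "[_, _, _]"] show thesis using that[of e] by (simp add: numeral_2_eq_2)
qed

lemma bit_add_power:
  fixes z :: nat
  assumes "z < 2 ^ m"
  shows "bit (z + 2 ^ m) j \<longleftrightarrow> bit z j \<or> j = m"
proof -
  consider "j < m" | "j = m" | "m < j" by linarith
  then show ?thesis
  proof cases
    case 1
    have "(2::nat) ^ m = 2 ^ j * 2 ^ (m - j)" using 1 by (simp flip: power_add)
    then have "(z + 2 ^ m) div 2 ^ j = z div 2 ^ j + 2 ^ (m - j)" by simp
    then show ?thesis using 1 by (simp add: bit_iff_odd)
  next
    case 2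
    then have "(z + 2 ^ m) div 2 ^ j = 1" using assms by simp
    then show ?thesis using 2 by (simp add: bit_iff_odd)
  next
    case 3
    have "(2::nat) ^ Suc m \<le> 2 ^ j" using 3 by (intro power_increasing) auto
    then have "z + 2 ^ m < 2 ^ j" "z < 2 ^ j" using assms by simp_all
    then show ?thesis using 3 by (simp add: bit_iff_odd)
  qed
qed

text \<open>An element \<open>n\<close> is written in the round whose number codes \<open>n\<close>
  and its least successful stage, hence just once. A stage is at most the code of a pair containing
  it, so the digits read before that round decide the test.\<close>

lemma enumerator:
  fixes T :: "(nat \<Rightarrow> bool) \<Rightarrow> nat \<Rightarrow> nat \<Rightarrow> bool"
  assumes rec_pred: "\<And>l h n m. rec_fun l h \<Longrightarrow> rec_fun l n \<Longrightarrow> rec_fun l m \<Longrightarrow> rec_pred l (\<lambda>xs. T (bit (h xs)) (n xs) (m xs))"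
    and cong: "\<And>B B' n m. (\<And>j. j < m \<Longrightarrow> B j = B' j) \<Longrightarrow> T B n m = T B' n m"
    and T0: "\<And>B n. \<not> T B n 0"
  obtains F :: "'a::{finite,zero_neq_one} name list \<rightharpoonup> 'a name" where "t2_computable 1 F"
    and "\<And>p. \<exists>q. F [p] = Some q \<and> {n. \<exists>m. T (\<lambda>j. p j = 1) n m} \<in> En q"
proof -
  define first where "first B N \<longleftrightarrow> T B (fst (prod_decode N)) (snd (prod_decode N)) \<and>
    \<not> (\<exists>k<snd (prod_decode N). T B (fst (prod_decode N)) k)" for B N
  \<comment> \<open>One unit of the summand 2 is the shift in \<open>block\<close>, the other the
    shift from \<open>n\<close> to a block of length \<open>n + 1\<close> in \<open>En\<close>; the
    value 1 writes an empty padding block.\<close>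
  define out where "out b N z = (if first (bit z) N then fst (prod_decode N) + 2 else 1)" for b N z :: nat
  define g where "g b N z = z + b * 2 ^ N" for b N z :: nat
  have "rec_fun 3 (\<lambda>xs. g (xs ! 0) (xs ! 1) (xs ! 2))"
    unfolding g_def by (intro rec_fun_intros rec_fun_nth) simp_all
  then obtain eg where eg: "\<And>b m z. rec_eval eg [b, m, z] (g b m z)" by (rule rec_fun_transducer) blast
  have "rec_fun 3 (\<lambda>xs. out (xs ! 0) (xs ! 1) (xs ! 2))"
    unfolding out_def first_def
    by (intro rec_fun_intros rec_pred rec_fun_fst_prod_decode rec_fun_snd_prod_decode rec_fun_nth rec_fun_weaken[OF rec_fun_nth]) simp_all
  then obtain eo where eo: "\<And>b m z. rec_eval eo [b, m, z] (out b m z)" by (rule rec_fun_transducer) blast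
  obtain F :: "'a name list \<rightharpoonup> 'a name" where F: "t2_computable 1 F" and
    F': "\<And>ps b s cnt. length ps = 1 \<Longrightarrow> b = (\<lambda>i. of_bool ((ps ! 0) i = 1)) \<Longrightarrow>
      (\<And>N. concat (map (\<lambda>m. block (out (b m) m (transducer_state g b m))) [0..<N]) =
        concat (map (\<lambda>i. block (Suc (s i))) [0..<cnt N])) \<Longrightarrow> (\<And>n. \<exists>N. n \<le> cnt N) \<Longrightarrow>
      F ps = Some (seq_name s)"
    by (rule transducer_computable[where j = 0 and k = 1 and 'a = 'a, OF eg eo]) auto
  show thesis
  proof (rule that[OF F])
    fix p :: "'a name"
    define B where "B j \<longleftrightarrow> p j = 1" for j
    define b :: "nat \<Rightarrow> nat" where "b i = of_bool (p i = 1)" for i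
    define Z where "Z = transducer_state g b"
    have Z: "Z N < 2 ^ N \<and> (\<forall>j. bit (Z N) j \<longleftrightarrow> j < N \<and> B j)" for N
    proof (induction N)
      case (Suc N)
      have "Z (Suc N) = Z N + of_bool (B N) * 2 ^ N" by (simp add: Z_def g_def b_def B_def)
      then show ?case using Suc bit_add_power[of "Z N" N] by (auto simp: less_Suc_eq)
    qed (simp add: Z_def)
    define s where "s N = (if first B N then fst (prod_decode N) + 1 else 0)" for N
    have out: "out (b N) N (Z N) = Suc (s N)" for N
    proof -
      have "snd (prod_decode N) \<le> N"
        using le_prod_encode_2[of "snd (prod_decode N)" "fst (prod_decode N)"] by simp
      then have "T (bit (Z N)) (fst (prod_decode N)) k = T B (fst (prod_decode N)) k" if "k \<le> snd (prod_decode N)" for k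
        using that Z[of N] by (intro cong) auto
      then have "first (bit (Z N)) N = first B N" unfolding first_def by auto
      then show ?thesis by (simp add: out_def s_def)
    qed
    have "F [p] = Some (seq_name s)"
    proof (rule F'[where b = b and cnt = "\<lambda>N. N"])
      show "b = (\<lambda>i. of_bool (([p] ! 0) i = 1))" by (auto simp: b_def)
    qed (use out in \<open>auto simp: Z_def\<close>)
    moreover have "{n. Suc n \<in> range s} \<in> En (seq_name s :: 'a name)"
    proof (rule En_seq_name)
      \<comment> \<open>Round 0 codes the pair (0, 0), and no test succeeds at stage 0.\<close>
      show "s 0 = 0" using T0 by (simp add: s_def first_def prod_decode_def prod_decode_aux.simps)
    next
      fix i j assume ij: "s i = s j" "s i \<noteq> 0"
      then have f: "first B i" "first B j" "fst (prod_decode i) = fst (prod_decode j)"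
        by (auto simp: s_def split: if_splits)
      then have "snd (prod_decode i) = snd (prod_decode j)"
        unfolding first_def by (metis linorder_neqE_nat)
      then have "prod_decode i = prod_decode j" using f(3) by (simp add: prod_eq_iff)
      then show "i = j" by (metis prod_decode_inverse)
    qed
    moreover have "Suc n \<in> range s \<longleftrightarrow> (\<exists>m. T B n m)" for n
    proof
      assume "Suc n \<in> range s"
      then obtain N where "s N = Suc n" by (metis rangeE)
      then show "\<exists>m. T B n m" by (auto simp: s_def first_def split: if_splits)
    next
      assume ex: "\<exists>m. T B n m"
      define m where "m = (LEAST m. T B n m)"
      have "T B n m" using ex unfolding m_def by (rule LeastI_ex)
      moreover have "\<not> T B n k" if "k < m" for k using that not_less_Least m_def by blast
      ultimately have "s (prod_encode (n, m)) = Suc n" by (auto simp: s_def first_def)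
      then show "Suc n \<in> range s" by (metis rangeI)
    qed
    then have "{n. Suc n \<in> range s} = {n. \<exists>m. T (\<lambda>j. p j = 1) n m}" by (simp add: B_def[abs_def])
    ultimately show "\<exists>q. F [p] = Some q \<and> {n. \<exists>m. T (\<lambda>j. p j = 1) n m} \<in> En q" by auto
  qed
qed

text \<open>The head moves one way, so a pair that was passed is lost. The state counts the blocks
  written, and any \<open>c\<close> with a precision index \<open>i\<close> of at least this count
  is accepted. Good pairs exist with arbitrarily large \<open>i\<close>, so the pass always meets
  another one.\<close>

lemma scanner:
  obtains F :: "'a::{finite,zero_neq_one} name list \<rightharpoonup> 'a name" where "t2_computable 2 F"
    and "\<And>p q. (\<And>k. \<exists>c i. k \<le> i \<and> q (prod_encode (c, i)) \<noteq> 1) \<Longrightarrow>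
      \<exists>s. F [p, q] = Some (seq_name s) \<and> (\<forall>k. \<exists>i\<ge>k. q (prod_encode (s k, i)) \<noteq> 1)"
proof -
  define hit where "hit b m z \<longleftrightarrow> b = 0 \<and> z \<le> snd (prod_decode m)" for b m z :: nat
  define out where "out b m z = (if hit b m z then Suc (fst (prod_decode m)) else 0)" for b m z
  define g where "g b m z = (if hit b m z then Suc z else z)" for b m z
  have "rec_fun 3 (\<lambda>xs. g (xs ! 0) (xs ! 1) (xs ! 2))"
    unfolding g_def hit_def by (intro rec_fun_intros rec_fun_snd_prod_decode rec_fun_nth) simp_all
  then obtain eg where eg: "\<And>b m z. rec_eval eg [b, m, z] (g b m z)" by (rule rec_fun_transducer) blast
  have "rec_fun 3 (\<lambda>xs. out (xs ! 0) (xs ! 1) (xs ! 2))"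
    unfolding out_def hit_def by (intro rec_fun_intros rec_fun_fst_prod_decode rec_fun_snd_prod_decode rec_fun_nth) simp_all
  then obtain eo where eo: "\<And>b m z. rec_eval eo [b, m, z] (out b m z)" by (rule rec_fun_transducer) blast
  obtain F :: "'a name list \<rightharpoonup> 'a name" where F: "t2_computable 2 F" and
    F': "\<And>ps b s cnt. length ps = 2 \<Longrightarrow> b = (\<lambda>i. of_bool ((ps ! 1) i = 1)) \<Longrightarrow>
      (\<And>N. concat (map (\<lambda>m. block (out (b m) m (transducer_state g b m))) [0..<N]) =
        concat (map (\<lambda>i. block (Suc (s i))) [0..<cnt N])) \<Longrightarrow> (\<And>n. \<exists>N. n \<le> cnt N) \<Longrightarrow>
      F ps = Some (seq_name s)"
    by (rule transducer_computable[where j = 1 and k = 2 and 'a = 'a, OF eg eo]) auto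
  show thesis
  proof (rule that[OF F])
    fix p q :: "'a name"
    assume good: "\<And>k. \<exists>c i. k \<le> i \<and> q (prod_encode (c, i)) \<noteq> 1"
    define b :: "nat \<Rightarrow> nat" where "b i = of_bool (q i = 1)" for i
    define Z where "Z = transducer_state g b"
    define H where "H N \<longleftrightarrow> hit (b N) N (Z N)" for N
    have Z0: "Z 0 = 0" by (simp add: Z_def)
    have ZS: "Z (Suc N) = (if H N then Suc (Z N) else Z N)" for N by (simp add: Z_def H_def g_def)
    have mono: "mono Z" by (rule monoI, rule lift_Suc_mono_le[of Z]) (auto simp: ZS)
    have unb: "\<exists>N. k \<le> Z N" for k
    proof (induction k)
      case (Suc k)
      then obtain N where N: "k \<le> Z N" by blast
      \<comment> \<open>\<open>i \<ge> N\<close> places the pair at or after round \<open>N\<close>.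
        If it is then rejected, the count already exceeds \<open>i\<close>, hence also
        \<open>k\<close>.\<close>
      obtain c i where ci: "max (Suc k) N \<le> i" "q (prod_encode (c, i)) \<noteq> 1" using good by blast
      define n where "n = prod_encode (c, i)"
      have "N \<le> n" using le_prod_encode_2[of i c] ci(1) by (simp add: n_def)
      then have kn: "k \<le> Z n" using monoD[OF mono] N by (meson order.trans)
      have "Suc k \<le> Z (Suc n)"
      proof (cases "Z n \<le> i")
        case True
        then have "H n" using ci by (simp add: H_def hit_def b_def n_def)
        then show ?thesis using kn by (simp add: ZS)
      next
        case False
        then show ?thesis using ci(1) by (simp add: ZS)
      qed
      then show ?case by blast
    qed simp
    \<comment> \<open>The round that writes block \<open>k\<close>.\<close>
    define t where "t k = (LEAST N. k < Z (Suc N))" for k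
    have t: "H (t k) \<and> Z (t k) = k" for k
    proof -
      obtain N where "Suc k \<le> Z N" using unb by blast
      then have "k < Z (Suc N)" by (simp add: ZS)
      then have 1: "k < Z (Suc (t k))" unfolding t_def by (rule LeastI)
      have "Z (t k) \<le> k"
      proof (cases "t k")
        case (Suc N)
        then show ?thesis using not_less_Least[of N "\<lambda>N. k < Z (Suc N)"] by (simp add: t_def)
      qed (simp add: Z0)
      then show ?thesis using 1 by (auto simp: ZS split: if_splits)
    qed
    have tZ: "t (Z N) = N" if "H N" for N
      unfolding t_def
    proof (rule Least_equality)
      fix M assume "Z N < Z (Suc M)"
      then show "N \<le> M" using monoD[OF mono, of "Suc M" N] by (meson not_less not_less_eq_eq)
    qed (use that in \<open>simp add: ZS\<close>)
    define s where "s k = fst (prod_decode (t k))" for k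
    have "F [p, q] = Some (seq_name s)"
    proof (rule F'[where b = b and cnt = Z])
      show "b = (\<lambda>i. of_bool (([p, q] ! 1) i = 1))" by (auto simp: b_def)
    next
      fix N
      show "concat (map (\<lambda>m. block (out (b m) m (transducer_state g b m))) [0..<N]) =
        concat (map (\<lambda>i. block (Suc (s i))) [0..<Z N])"
      proof (induction N)
        case (Suc N)
        have "block (out (b N) N (transducer_state g b N)) = (if H N then block (Suc (s (Z N))) else [])"
          using tZ[of N] by (simp add: out_def s_def H_def Z_def block_def)
        then show ?case using Suc by (simp add: ZS)
      qed (simp add: Z0)
    qed (use unb in auto)
    moreover have "\<exists>i\<ge>k. q (prod_encode (s k, i)) \<noteq> 1" for k
      using t[of k] by (intro exI[of _ "snd (prod_decode (t k))"]) (auto simp: H_def hit_def b_def s_def)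
    ultimately show "\<exists>s. F [p, q] = Some (seq_name s) \<and> (\<forall>k. \<exists>i\<ge>k. q (prod_encode (s k, i)) \<noteq> 1)" by blast
  qed
qed

section \<open>Measures on the sigma-algebra generated by a countable ring\<close>

lemma (in finite_measure) measure_UN_tail:
  fixes A :: "nat \<Rightarrow> 'a set"
  assumes "range A \<subseteq> sets M" "0 < e"
  shows "\<exists>n. measure M ((\<Union>i. A i) - (\<Union>i<n. A i)) < e"
proof -
  define U where "U n = (\<Union>i<n. A i)" for n
  have U: "range U \<subseteq> sets M" "incseq U" "(\<Union>n. U n) = (\<Union>i. A i)"
    using assms(1) by (auto simp: U_def incseq_def intro: less_le_trans)
  have "(\<lambda>n. measure M (U n)) \<longlonglongrightarrow> measure M (\<Union>i. A i)"
    using finite_Lim_measure_incseq[OF U(1,2)] U(3) by simp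
  then obtain n where n: "\<bar>measure M (U n) - measure M (\<Union>i. A i)\<bar> < e"
    using LIMSEQ_D[of _ _ e] assms(2) by fastforce
  have "measure M ((\<Union>i. A i) - U n) = measure M (\<Union>i. A i) - measure M (U n)"
  proof (rule finite_measure_Diff)
    show "(\<Union>i. A i) \<in> sets M" by (rule sets.countable_UN[OF assms(1)])
    show "U n \<in> sets M" using U(1) by auto
    show "U n \<subseteq> (\<Union>i. A i)" by (auto simp: U_def)
  qed
  then show ?thesis using n by (intro exI[of _ n]) (simp add: U_def)
qed

text \<open>The sets that ring elements approximate form a sigma-algebra. A ring need not contain
  the whole space, so a complement is taken inside a ring set \<open>E0\<close> of almost full
  measure, which exists because countably many ring sets cover the space.\<close>

lemma ring_approximation:
  assumes ring: "ring_of_sets \<Omega> R" and "countable R" and Un: "\<Union>R = \<Omega>"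
    and fin: "finite_measure M" and sets: "sets M = sigma_sets \<Omega> R" and S: "S \<in> sets M" and e: "0 < e"
  shows "\<exists>E\<in>R. measure M ((S - E) \<union> (E - S)) < e"
proof -
  interpret R: ring_of_sets \<Omega> R by fact
  interpret finite_measure M by fact
  have R_sets [measurable]: "E \<in> sets M" if "E \<in> R" for E unfolding sets using that by (rule sigma_sets.Basic)
  have sub: "X \<subseteq> \<Omega>" if "X \<in> sets M" for X
    using that sigma_sets_into_sp[OF R.space_closed, of X] by (auto simp only: sets)
  have Om: "\<Omega> \<in> sets M" unfolding sets by (rule sigma_sets_top)
  have UnR: "(\<Union>i<n. E i) \<in> R" if "\<And>i. E i \<in> R" for E and n :: nat
    by (rule R.finite_UN) (use that in auto)
  have top: "\<exists>E\<in>R. measure M (\<Omega> - E) < e" if pos: "0 < e" for e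
  proof -
    define A where "A = from_nat_into R"
    have A: "range A = R" unfolding A_def
      by (rule range_from_nat_into[OF _ assms(2)]) (use R.empty_sets in blast)
    then have "range A \<subseteq> sets M" using R_sets by (simp add: subset_iff)
    obtain n where "measure M ((\<Union>i. A i) - (\<Union>i<n. A i)) < e"
      using measure_UN_tail[OF \<open>range A \<subseteq> sets M\<close> pos] by (elim exE)
    moreover have "(\<Union>i. A i) = \<Omega>" using A Un by auto
    ultimately show ?thesis using UnR[of A n] A by (metis rangeI)
  qed
  from S have "S \<in> sigma_sets \<Omega> R" by (simp add: sets)
  then have "\<forall>e>0. \<exists>E\<in>R. measure M ((S - E) \<union> (E - S)) < e"
  proof (induction S)
    case (Basic S)
    then show ?case by (auto intro!: bexI[of _ S])
  next
    case Empty
    then show ?case by (auto intro!: bexI[of _ "{}"])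
  next
    case (Compl S)
    then have S: "S \<in> sets M" by (simp add: sets)
    show ?case
    proof (intro allI impI)
      fix e :: real assume "0 < e"
      then obtain E E0 where E: "E \<in> R" "measure M ((S - E) \<union> (E - S)) < e / 2"
          and E0: "E0 \<in> R" "measure M (\<Omega> - E0) < e / 2"
        using Compl.IH top[of "e / 2"] by (meson half_gt_zero)
      have "measure M (((\<Omega> - S) - (E0 - E)) \<union> ((E0 - E) - (\<Omega> - S))) \<le>
          measure M (((S - E) \<union> (E - S)) \<union> (\<Omega> - E0))"
        using S Om E E0 sub[OF R_sets[OF E0(1)]] by (intro finite_measure_mono) auto
      also have "\<dots> \<le> measure M ((S - E) \<union> (E - S)) + measure M (\<Omega> - E0)"
        using S Om E E0 by (intro measure_Un_le) auto
      also have "\<dots> < e" using E E0 by simp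
      finally show "\<exists>E\<in>R. measure M (((\<Omega> - S) - E) \<union> (E - (\<Omega> - S))) < e"
        using E E0 by (intro bexI[of _ "E0 - E"]) auto
    qed
  next
    case (Union A)
    then have A: "range A \<subseteq> sets M" by (auto simp: sets)
    show ?case
    proof (intro allI impI)
      fix e :: real assume e: "0 < e"
      obtain n where n: "measure M ((\<Union>i. A i) - (\<Union>i<n. A i)) < e / 2"
        using measure_UN_tail[OF A, of "e / 2"] e by auto
      \<comment> \<open>Only \<open>n\<close> sets are approximated; \<open>Suc n\<close> avoids
        dividing by zero when \<open>n = 0\<close>.\<close>
      have "\<forall>i. \<exists>E\<in>R. measure M ((A i - E) \<union> (E - A i)) < e / (2 * Suc n)"
        using Union.IH e by simp
      then obtain E where E: "\<And>i. E i \<in> R" "\<And>i. measure M ((A i - E i) \<union> (E i - A i)) < e / (2 * Suc n)"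
        by metis
      define V where "V = (\<Union>i<n. E i)"
      have V: "V \<in> R" unfolding V_def by (rule UnR[OF E(1)])
      have "measure M (((\<Union>i. A i) - V) \<union> (V - (\<Union>i. A i))) \<le>
        measure M (((\<Union>i. A i) - (\<Union>i<n. A i)) \<union> (\<Union>i<n. (A i - E i) \<union> (E i - A i)))"
        using A E(1) R_sets by (intro finite_measure_mono) (auto simp: V_def intro!: sets.Un sets.Diff sets.countable_UN sets.finite_UN)
      also have "\<dots> \<le> measure M ((\<Union>i. A i) - (\<Union>i<n. A i)) + measure M (\<Union>i<n. (A i - E i) \<union> (E i - A i))"
        using A E(1) R_sets by (intro measure_Un_le) (auto intro!: sets.Un sets.Diff sets.countable_UN sets.finite_UN)
      also have "measure M (\<Union>i<n. (A i - E i) \<union> (E i - A i)) \<le> (\<Sum>i<n. measure M ((A i - E i) \<union> (E i - A i)))"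
        using A E(1) R_sets by (intro measure_UNION_le) (auto intro!: sets.Un sets.Diff)
      also have "\<dots> \<le> (\<Sum>i<n. e / (2 * Suc n))" by (intro sum_mono less_imp_le E(2))
      also have "\<dots> = e / 2 * (n / Suc n)" by simp
      also have "\<dots> \<le> e / 2 * 1" using e by (intro mult_left_mono) auto
      finally have "measure M (((\<Union>i. A i) - V) \<union> (V - (\<Union>i. A i))) < e" using n by simp
      then show "\<exists>E\<in>R. measure M (((\<Union>i. A i) - E) \<union> (E - (\<Union>i. A i))) < e" using V by blast
    qed
  qed
  then show ?thesis using e by blast
qed

locale countable_ring_measure =
  fixes \<Omega> :: "'w set" and R :: "'w set set" and N :: "'w measure"
  assumes ring: "ring_of_sets \<Omega> R" and countable_ring: "countable R" and Union_ring: "\<Union>R = \<Omega>"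
    and space_N: "space N = \<Omega>" and sets_N: "sets N = sigma_sets \<Omega> R"
    and finite_ring: "\<And>E. E \<in> R \<Longrightarrow> emeasure N E < \<infinity>"
begin

lemma ring_sets [measurable]: "E \<in> R \<Longrightarrow> E \<in> sets N"
  by (simp add: sets_N)

sublocale sigma_finite_measure N
  by standard (use countable_ring Union_ring space_N finite_ring ring_sets in \<open>auto intro!: exI[of _ R] simp: less_top\<close>)

lemma integrable_indicator_ring: "E \<in> R \<Longrightarrow> integrable N (indicator E :: 'w \<Rightarrow> real)"
  by (intro integrable_real_indicator ring_sets finite_ring)

lemma integrable_indicator_mult:
  fixes g :: "'w \<Rightarrow> real"
  assumes "integrable N g" "A \<in> sets N"
  shows "integrable N (\<lambda>x. indicator A x * g x)"
  using integrable_real_mult_indicator[OF assms(2,1)] by (simp add: mult.commute)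

text \<open>\<open>N\<close> may be infinite, so ring approximation is applied to the finite measure
  with density \<open>\<bar>g\<bar>\<close>.\<close>

lemma approximation_weighted:
  fixes g :: "'w \<Rightarrow> real"
  assumes g: "integrable N g" and S: "S \<in> sets N" and e: "0 < e"
  shows "\<exists>E\<in>R. (LINT x|N. indicator ((S - E) \<union> (E - S)) x * \<bar>g x\<bar>) < e"
proof -
  define M where "M = density N (\<lambda>x. ennreal \<bar>g x\<bar>)"
  have g_meas [measurable]: "g \<in> borel_measurable N" using g by simp
  have m: "emeasure M A = ennreal (LINT x|N. indicator A x * \<bar>g x\<bar>)" if [measurable]: "A \<in> sets N" for A
  proof -
    have "emeasure M A = (\<integral>\<^sup>+x. ennreal (indicator A x * \<bar>g x\<bar>) \<partial>N)"
      unfolding M_def by (subst emeasure_density) (auto simp: ennreal_indicator ennreal_mult mult.commute intro!: nn_integral_cong split: split_indicator)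
    also have "\<dots> = ennreal (LINT x|N. indicator A x * \<bar>g x\<bar>)"
      by (intro nn_integral_eq_integral integrable_indicator_mult[OF integrable_abs[OF g] that]) auto
    finally show ?thesis .
  qed
  have fin: "finite_measure M"
    by (rule finite_measureI) (use m[of "space N"] in \<open>simp add: M_def\<close>)
  have [simp]: "sets M = sets N" by (simp add: M_def)
  obtain E where E: "E \<in> R" "measure M ((S - E) \<union> (E - S)) < e"
    using ring_approximation[OF ring countable_ring Union_ring fin _ _ e, of S] S sets_N by auto
  have "(S - E) \<union> (E - S) \<in> sets N" using S E by auto
  then have "measure M ((S - E) \<union> (E - S)) = (LINT x|N. indicator ((S - E) \<union> (E - S)) x * \<bar>g x\<bar>)"
    using m by (simp add: measure_def integral_nonneg_AE)
  then show ?thesis using E by auto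
qed

lemma integral_abs_ge:
  fixes g :: "'w \<Rightarrow> real"
  assumes g: "integrable N g" and AB: "A \<in> sets N" "B \<in> sets N" "A \<inter> B = {}"
  shows "(LINT x|N. indicator A x * g x) - (LINT x|N. indicator B x * g x) \<le> (LINT x|N. \<bar>g x\<bar>)"
proof -
  have "(LINT x|N. indicator A x * g x) - (LINT x|N. indicator B x * g x) =
      (LINT x|N. indicator A x * g x - indicator B x * g x)"
    by (rule Bochner_Integration.integral_diff[symmetric]) (intro integrable_indicator_mult g AB)+
  also have "\<dots> \<le> (LINT x|N. \<bar>g x\<bar>)"
    using AB(3) by (intro integral_mono Bochner_Integration.integrable_diff integrable_indicator_mult g AB integrable_abs)
      (auto split: split_indicator)
  finally show ?thesis .
qed

text \<open>The norm is attained by the set where \<open>g\<close> is positive and its complement,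
  and both are replaced by ring sets that are close with respect to the weight
  \<open>\<bar>g\<bar>\<close>. The approximations may overlap, hence \<open>B - A\<close>.\<close>

lemma integral_abs_approx:
  fixes g :: "'w \<Rightarrow> real"
  assumes g: "integrable N g" and q: "q < (LINT x|N. \<bar>g x\<bar>)"
  shows "\<exists>A\<in>R. \<exists>B\<in>R. q < (LINT x|N. indicator A x * g x) - (LINT x|N. indicator (B - A) x * g x)"
proof -
  \<comment> \<open>The total error stays below \<open>3 * e\<close>; a quarter of the margin leaves
    room for it.\<close>
  define e where "e = ((LINT x|N. \<bar>g x\<bar>) - q) / 4"
  have e: "0 < e" using q by (simp add: e_def)
  have g_meas [measurable]: "g \<in> borel_measurable N" using g by simp
  define P where "P = {x \<in> space N. 0 < g x}"
  define Q where "Q = space N - P"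
  have PQ [measurable]: "P \<in> sets N" "Q \<in> sets N" unfolding P_def Q_def by measurable
  obtain A where A: "A \<in> R" "(LINT x|N. indicator ((P - A) \<union> (A - P)) x * \<bar>g x\<bar>) < e"
    using approximation_weighted[OF g PQ(1) e] by blast
  obtain B where B: "B \<in> R" "(LINT x|N. indicator ((Q - B) \<union> (B - Q)) x * \<bar>g x\<bar>) < e"
    using approximation_weighted[OF g PQ(2) e] by blast
  have sp: "A \<subseteq> space N" "B \<subseteq> space N"
    using sets.sets_into_space[OF ring_sets[OF A(1)]] sets.sets_into_space[OF ring_sets[OF B(1)]] .
  define f1 where "f1 x = indicator A x * g x" for x
  define f2 where "f2 x = indicator (B - A) x * g x" for x
  define f3 where "f3 x = indicator ((P - A) \<union> (A - P)) x * \<bar>g x\<bar>" for x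
  define f4 where "f4 x = indicator ((Q - B) \<union> (B - Q)) x * \<bar>g x\<bar>" for x
  have sets: "A \<in> sets N" "B \<in> sets N" using A(1) B(1) by (simp_all add: ring_sets)
  have int: "integrable N f1" "integrable N f2" "integrable N f3" "integrable N f4"
    unfolding f1_def f2_def f3_def f4_def
    by (rule integrable_indicator_mult integrable_abs g sets.Un sets.Diff sets PQ)+
  \<comment> \<open>A point misplaced by \<open>A\<close> costs up to twice
    \<open>\<bar>g x\<bar>\<close>, since it may count with the wrong sign; one misplaced by
    \<open>B\<close> alone costs at most \<open>\<bar>g x\<bar>\<close>.\<close>
  have "\<bar>g x\<bar> \<le> f1 x - f2 x + (2 * f3 x + f4 x)" if "x \<in> space N" for x
    using that unfolding f1_def f2_def f3_def f4_def
    by (cases "x \<in> P"; cases "x \<in> A"; cases "x \<in> B") (simp_all add: P_def Q_def indicator_def)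
  then have "(LINT x|N. \<bar>g x\<bar>) \<le> (LINT x|N. f1 x - f2 x + (2 * f3 x + f4 x))"
    by (intro integral_mono integrable_abs g) (use int in auto)
  also have "\<dots> = ((LINT x|N. f1 x) - (LINT x|N. f2 x)) + (2 * (LINT x|N. f3 x) + (LINT x|N. f4 x))"
    using int by simp
  also have "\<dots> < ((LINT x|N. f1 x) - (LINT x|N. f2 x)) + 3 * e"
    using A(2) B(2) by (simp add: f3_def f4_def)
  finally have "(LINT x|N. \<bar>g x\<bar>) < ((LINT x|N. f1 x) - (LINT x|N. f2 x)) + 3 * e" .
  moreover have "4 * e = (LINT x|N. \<bar>g x\<bar>) - q" by (simp add: e_def)
  ultimately have "q < (LINT x|N. f1 x) - (LINT x|N. f2 x)" using e by linarith
  then show ?thesis unfolding f1_def f2_def using A(1) B(1) by blast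
qed

text \<open>A set that is close to \<open>S\<close> with respect to a finite weight may still be
  large elsewhere. So \<open>E0\<close> first captures most of \<open>S\<close>, then
  \<open>E\<close> approximates \<open>S\<close> with weight on \<open>E0\<close>, and
  \<open>E \<inter> E0\<close> cuts off the uncontrolled part.\<close>

lemma approximation_finite:
  assumes S: "S \<in> sets N" "emeasure N S < \<infinity>" and e: "0 < e"
  shows "\<exists>E\<in>R. (LINT x|N. \<bar>indicator E x - indicator S x :: real\<bar>) < e"
proof -
  interpret R: ring_of_sets \<Omega> R by (rule ring)
  have intS: "integrable N (indicator S :: 'w \<Rightarrow> real)" using S by (rule integrable_real_indicator)
  obtain E0 where E0: "E0 \<in> R" "(LINT x|N. indicator ((S - E0) \<union> (E0 - S)) x * \<bar>indicator S x :: real\<bar>) < e / 2"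
    using approximation_weighted[OF intS S(1), of "e / 2"] e by auto
  have intE0: "integrable N (indicator E0 :: 'w \<Rightarrow> real)" using E0(1) by (rule integrable_indicator_ring)
  obtain E where E: "E \<in> R" "(LINT x|N. indicator ((S - E) \<union> (E - S)) x * \<bar>indicator E0 x :: real\<bar>) < e / 2"
    using approximation_weighted[OF intE0 S(1), of "e / 2"] e by auto
  define f1 where "f1 x = indicator ((S - E0) \<union> (E0 - S)) x * \<bar>indicator S x :: real\<bar>" for x
  define f2 where "f2 x = indicator ((S - E) \<union> (E - S)) x * \<bar>indicator E0 x :: real\<bar>" for x
  have int: "integrable N f1" "integrable N f2"
    unfolding f1_def f2_def
    by (rule integrable_indicator_mult integrable_abs intS intE0 sets.Un sets.Diff S ring_sets E0 E)+
  have EE: "E \<inter> E0 \<in> R" using E(1) E0(1) by blast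
  have "(LINT x|N. \<bar>indicator (E \<inter> E0) x - indicator S x :: real\<bar>) \<le> (LINT x|N. f1 x + f2 x)"
  proof (rule integral_mono)
    show "\<bar>indicator (E \<inter> E0) x - indicator S x\<bar> \<le> f1 x + f2 x" for x
      by (simp add: f1_def f2_def split: split_indicator)
  qed (use int intS integrable_indicator_ring[OF EE] in auto)
  also have "\<dots> = (LINT x|N. f1 x) + (LINT x|N. f2 x)" using int by simp
  also have "\<dots> < e" using E0(2) E(2) unfolding f1_def f2_def by linarith
  finally show ?thesis using EE by blast
qed

section \<open>Densities and their L1 classes\<close>

lemma finite_measure_density_exists:
  assumes M: "finite_measure M" "sets M = sets N" "absolutely_continuous N M"
  obtains f :: "'w \<Rightarrow> real" where "integrable N f"
    "\<And>E. E \<in> sets N \<Longrightarrow> measure M E = (LINT x|N. indicator E x * f x)"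
proof -
  interpret M: finite_measure M by fact
  define r where "r = RN_deriv N M"
  have [measurable]: "r \<in> borel_measurable N" by (simp add: r_def)
  have M_eq: "density N r = M" unfolding r_def using M by (intro density_RN_deriv)
  define f where "f x = enn2real (r x)" for x
  have [measurable]: "f \<in> borel_measurable N" unfolding f_def by measurable
  have em: "emeasure M E = (\<integral>\<^sup>+x. r x * indicator E x \<partial>N)" if "E \<in> sets N" for E
    using that M_eq emeasure_density[of r N E] by simp
  have "(\<integral>\<^sup>+x. r x \<partial>N) = emeasure M (space N)"
    using em[OF sets.top] by (auto intro!: nn_integral_cong)
  then have "(\<integral>\<^sup>+x. r x \<partial>N) \<noteq> \<infinity>" by simp
  \<comment> \<open>Finite total mass makes the extended-valued derivative finite almost everywhere,
    so passing to real values changes it only on a null set.\<close>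
  then have "AE x in N. r x \<noteq> \<infinity>" by (intro nn_integral_PInf_AE) auto
  then have rf: "AE x in N. r x = ennreal (f x)"
    by eventually_elim (simp add: f_def less_top)
  have emf: "emeasure M E = (\<integral>\<^sup>+x. ennreal (indicator E x * f x) \<partial>N)" if "E \<in> sets N" for E
    unfolding em[OF that] by (rule nn_integral_cong_AE, use rf in eventually_elim) (simp split: split_indicator)
  have nonneg: "0 \<le> f x" for x by (simp add: f_def)
  have int: "integrable N f"
  proof (rule integrableI_nonneg)
    have "(\<integral>\<^sup>+x. ennreal (f x) \<partial>N) = (\<integral>\<^sup>+x. ennreal (indicator (space N) x * f x) \<partial>N)"
      by (intro nn_integral_cong) simp
    also have "\<dots> = emeasure M (space N)" using emf[OF sets.top] by simp
    finally show "(\<integral>\<^sup>+x. ennreal (f x) \<partial>N) < \<infinity>"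
      using M.emeasure_finite[of "space N"] by (simp flip: less_top)
  qed (use nonneg in auto)
  have "measure M E = (LINT x|N. indicator E x * f x)" if "E \<in> sets N" for E
  proof -
    have "emeasure M E = ennreal (LINT x|N. indicator E x * f x)"
      unfolding emf[OF that]
      by (intro nn_integral_eq_integral integrable_indicator_mult[OF int that]) (simp add: nonneg)
    then show ?thesis by (simp add: measure_def nonneg integral_nonneg_AE)
  qed
  then show thesis using that int by blast
qed

lemma L1_class_eq_iff:
  assumes "integrable N f" "integrable N g"
  shows "L1_class N f = L1_class N g \<longleftrightarrow> (AE x in N. f x = g x)"
proof
  assume "L1_class N f = L1_class N g"
  moreover have "f \<in> L1_class N f" using assms by (simp add: L1_class_def)
  ultimately show "AE x in N. f x = g x" by (simp add: L1_class_def)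
next
  assume fg: "AE x in N. f x = g x"
  have "(AE x in N. h x = f x) \<longleftrightarrow> (AE x in N. h x = g x)" for h
  proof
    assume "AE x in N. h x = f x"
    with fg show "AE x in N. h x = g x" by eventually_elim simp
  next
    assume "AE x in N. h x = g x"
    with fg show "AE x in N. h x = f x" by eventually_elim simp
  qed
  then show "L1_class N f = L1_class N g" by (simp add: L1_class_def)
qed

lemma L1_class_integral_cong:
  fixes f g :: "'w \<Rightarrow> real"
  assumes "integrable N f" "g \<in> L1_class N f" "E \<in> sets N"
  shows "(LINT x:E|N. g x) = (LINT x|N. indicator E x * f x)"
proof -
  have "integrable N g" "AE x in N. g x = f x" using assms(2) by (auto simp: L1_class_def)
  then show ?thesis unfolding set_lebesgue_integral_def real_scaleR_def
    by (intro integral_cong_AE borel_measurable_times borel_measurable_indicator assms borel_measurable_integrable)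
      auto
qed

text \<open>This resolves the definite description in \<open>RN_fun\<close>: uniqueness holds only
  up to null sets, which is why it speaks of classes.\<close>

lemma The_density:
  fixes f :: "'w \<Rightarrow> real"
  assumes f: "integrable N f" "\<And>E. E \<in> sets N \<Longrightarrow> measure M E = (LINT x|N. indicator E x * f x)"
  shows "(THE h. h \<in> L1 N \<and> (\<forall>E\<in>sigma_sets \<Omega> R. \<forall>f\<in>h. measure M E = (LINT x:E|N. f x))) = L1_class N f"
proof (rule the_equality)
  show "L1_class N f \<in> L1 N \<and> (\<forall>E\<in>sigma_sets \<Omega> R. \<forall>g\<in>L1_class N f. measure M E = (LINT x:E|N. g x))"
    using f L1_class_integral_cong[OF f(1)] by (auto simp: L1_def sets_N)
next
  fix h assume h: "h \<in> L1 N \<and> (\<forall>E\<in>sigma_sets \<Omega> R. \<forall>f\<in>h. measure M E = (LINT x:E|N. f x))"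
  then obtain g where g: "integrable N g" "h = L1_class N g" by (auto simp: L1_def)
  then have "g \<in> h" by (simp add: L1_class_def)
  have "AE x in N. g x = f x"
  proof (rule density_unique_real[OF g(1) f(1)])
    fix E assume E: "E \<in> sets N"
    then have "measure M E = (LINT x:E|N. g x)" using h \<open>g \<in> h\<close> by (simp add: sets_N)
    then show "(LINT x:E|N. g x) = (LINT x:E|N. f x)"
      using f(2)[OF E] by (simp add: set_lebesgue_integral_def)
  qed
  then show "h = L1_class N f" using L1_class_eq_iff[OF g(1) f(1)] g(2) by simp
qed

context
  fixes \<alpha> :: "nat \<Rightarrow> 'w set"
  assumes range_alpha: "range \<alpha> = R"
begin

section \<open>Density of the rational step functions in L1\<close>

lemma rsf_list_encode:
  "rsf \<alpha> (list_encode cs) x = (\<Sum>(a, n)\<leftarrow>map prod_decode cs. of_rat (nat_to_rat_surj a) * indicator (\<alpha> n) x)"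
  by (simp add: rsf_def)

lemma integrable_rsf: "integrable N (rsf \<alpha> c)"
proof -
  have "integrable N (\<lambda>x. \<Sum>(a, n)\<leftarrow>xs. of_rat (nat_to_rat_surj a) * indicator (\<alpha> n) x :: real)" for xs
    by (induction xs) (use integrable_indicator_ring range_alpha in auto)
  then show ?thesis unfolding rsf_def[abs_def] .
qed

lemma rsf_dense:
  fixes f :: "'w \<Rightarrow> real"
  assumes "integrable N f"
  shows "0 < e \<Longrightarrow> \<exists>c. (LINT x|N. \<bar>rsf \<alpha> c x - f x\<bar>) < e"
  using assms
proof (induction f arbitrary: e rule: integrable_induct)
  case (base A c)
  define d where "d = e / (2 * (1 + \<bar>c\<bar>))"
  have d: "0 < d" using base(3) by (simp add: d_def)
  obtain E where E: "E \<in> R" "(LINT x|N. \<bar>indicator E x - indicator A x :: real\<bar>) < d"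
    using approximation_finite[OF base(1,2) d] by blast
  define m where "m = measure N E"
  have m: "0 \<le> m" by (simp add: m_def)
  \<comment> \<open>The rational lies above \<open>c\<close>, so that \<open>r - c\<close> needs no
    absolute value; the summand 1 in \<open>1 + m\<close> covers sets of measure zero.\<close>
  obtain r' :: rat where r': "c < of_rat r'" "of_rat r' < c + e / (2 * (1 + m))"
    using of_rat_dense[of c "c + e / (2 * (1 + m))"] base(3) m by auto
  define r :: real where "r = of_rat r'"
  have r: "c < r" "r < c + e / (2 * (1 + m))" using r' by (simp_all add: r_def)
  obtain a n where an: "nat_to_rat_surj a = r'" "\<alpha> n = E"
    using surj_nat_to_rat_surj E(1) range_alpha by (metis rangeE surjD)
  define k where "k = list_encode [prod_encode (a, n)]"
  have k: "rsf \<alpha> k x = r * indicator E x" for x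
    unfolding k_def rsf_list_encode by (simp add: an r_def)
  have iE: "integrable N (indicator E :: 'w \<Rightarrow> real)" using E(1) by (rule integrable_indicator_ring)
  have iA: "integrable N (indicator A :: 'w \<Rightarrow> real)" using base by (intro integrable_real_indicator) auto
  have "(LINT x|N. \<bar>rsf \<alpha> k x - indicator A x *\<^sub>R c\<bar>) \<le>
      (LINT x|N. (r - c) * indicator E x + \<bar>c\<bar> * \<bar>indicator E x - indicator A x\<bar>)"
  proof (rule integral_mono)
    show "\<bar>rsf \<alpha> k x - indicator A x *\<^sub>R c\<bar> \<le> (r - c) * indicator E x + \<bar>c\<bar> * \<bar>indicator E x - indicator A x\<bar>" for x
      using r(1) by (auto simp: k split: split_indicator)
  qed (use iE iA integrable_rsf in auto)
  also have "\<dots> = (r - c) * m + \<bar>c\<bar> * (LINT x|N. \<bar>indicator E x - indicator A x\<bar>)"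
    using iE iA E(1) by (simp add: m_def)
  also have "\<dots> \<le> (r - c) * (1 + m) + \<bar>c\<bar> * d"
    using E(2) r(1) m by (intro add_mono mult_left_mono) auto
  also have "\<dots> < e / 2 + e / 2"
  proof (intro add_less_le_mono)
    show "(r - c) * (1 + m) < e / 2" using r(2) m by (simp add: field_simps)
    have "\<bar>c\<bar> * d = e / 2 * (\<bar>c\<bar> / (1 + \<bar>c\<bar>))" by (simp add: d_def)
    also have "\<dots> \<le> e / 2 * 1" using base(3) by (intro mult_left_mono) auto
    finally show "\<bar>c\<bar> * d \<le> e / 2" by simp
  qed
  finally show ?case by auto
next
  case (add f g)
  obtain c c' where c: "(LINT x|N. \<bar>rsf \<alpha> c x - f x\<bar>) < e / 2" "(LINT x|N. \<bar>rsf \<alpha> c' x - g x\<bar>) < e / 2"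
    using add.IH[of "e / 2"] add.prems by (meson half_gt_zero)
  define k where "k = list_encode (list_decode c @ list_decode c')"
  have k: "rsf \<alpha> k x = rsf \<alpha> c x + rsf \<alpha> c' x" for x
    by (simp add: k_def rsf_list_encode rsf_def)
  have "(LINT x|N. \<bar>rsf \<alpha> k x - (f x + g x)\<bar>) \<le> (LINT x|N. \<bar>rsf \<alpha> c x - f x\<bar> + \<bar>rsf \<alpha> c' x - g x\<bar>)"
    by (intro integral_mono) (use add.hyps integrable_rsf in \<open>auto simp: k\<close>)
  also have "\<dots> = (LINT x|N. \<bar>rsf \<alpha> c x - f x\<bar>) + (LINT x|N. \<bar>rsf \<alpha> c' x - g x\<bar>)"
    using add.hyps integrable_rsf by simp
  finally show ?case using c by (intro exI[of _ k]) linarith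
next
  case (lim f s)
  have "(\<lambda>i. LINT x|N. \<bar>s i x - f x\<bar>) \<longlonglongrightarrow> (LINT x|N. 0)"
  \<comment> \<open>The induction rule provides
    \<open>\<bar>s i x\<bar> \<le> 2 * \<bar>f x\<bar>\<close>, and the difference with
    \<open>f\<close> adds one more \<open>\<bar>f x\<bar>\<close>.\<close>
  proof (rule integral_dominated_convergence[where w = "\<lambda>x. 3 * \<bar>f x\<bar>"])
    show "AE x in N. (\<lambda>i. \<bar>s i x - f x\<bar>) \<longlonglongrightarrow> 0"
      by (intro AE_I2 tendsto_rabs_zero LIM_zero lim.hyps(2))
    show "AE x in N. norm \<bar>s i x - f x\<bar> \<le> 3 * \<bar>f x\<bar>" for i
      using lim.hyps(3)[of _ i] by (intro AE_I2) fastforce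
  qed (use lim.hyps in auto)
  then have "(\<lambda>i. LINT x|N. \<bar>s i x - f x\<bar>) \<longlonglongrightarrow> 0" by simp
  then obtain i where "\<bar>LINT x|N. \<bar>s i x - f x\<bar>\<bar> < e / 2"
    using LIMSEQ_D[of _ 0 "e / 2"] lim.prems by fastforce
  moreover obtain c where c: "(LINT x|N. \<bar>rsf \<alpha> c x - s i x\<bar>) < e / 2"
    using lim.IH[of "e / 2" i] lim.prems by auto
  moreover have "(LINT x|N. \<bar>rsf \<alpha> c x - f x\<bar>) \<le> (LINT x|N. \<bar>rsf \<alpha> c x - s i x\<bar> + \<bar>s i x - f x\<bar>)"
    by (intro integral_mono) (use lim.hyps integrable_rsf in auto)
  moreover have "\<dots> = (LINT x|N. \<bar>rsf \<alpha> c x - s i x\<bar>) + (LINT x|N. \<bar>s i x - f x\<bar>)"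
    using lim.hyps integrable_rsf by simp
  ultimately show ?case by (intro exI[of _ c]) linarith
qed

end

end

section \<open>Correctness of the test\<close>

text \<open>The bridge from thresholds to real numbers. Neither this lemma nor its two companions
  assumes that the accepted thresholds form an initial segment.\<close>

lemma count_ge:
  assumes "\<And>t. t < K \<Longrightarrow> real t < x \<Longrightarrow> P t"
  shows "min (real K) x \<le> real (\<Sum>t<K. of_bool (P t))"
  using assms
proof (induction K)
  case (Suc K)
  then show ?case by (cases "real K < x") auto
qed simp

lemma count_le:
  assumes "\<And>t. P t \<Longrightarrow> real (Suc t) \<le> x" "0 \<le> x"
  shows "real (\<Sum>t<m. of_bool (P t)) \<le> x"
proof -
  have "real (\<Sum>t<m. of_bool (P t)) \<le> min (real m) x"
  proof (induction m)
    case (Suc m)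
    then show ?case using assms(1)[of m] by (cases "P m") auto
  qed (use assms(2) in simp)
  then show ?thesis by simp
qed

lemma count_le_card:
  assumes "\<And>t. P t \<Longrightarrow> t < T"
  shows "(\<Sum>t<m. of_bool (P t) :: nat) \<le> T"
proof -
  have "(\<Sum>t<m. of_bool (P t) :: nat) \<le> min m T" by (induction m) (use assms in fastforce)+
  then show ?thesis by simp
qed

definition abs_rat :: "nat \<Rightarrow> nat \<Rightarrow> real" where
  "abs_rat a b = real (abs_decode a) / real (abs_decode b)"

lemma abs_rat_nonneg: "0 \<le> abs_rat a b"
  by (simp add: abs_rat_def)

lemma int_decode_abs: "real_of_int (int_decode x) = (if even x then 1 else - 1) * real (abs_decode x)"
proof (cases "even x")
  case True
  then obtain y where "x = 2 * y" by blast
  then show ?thesis by (simp add: int_decode_def sum_decode_def abs_decode_def)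
next
  case False
  then obtain y where "x = 2 * y + 1" by (elim oddE)
  then show ?thesis by (simp add: int_decode_def sum_decode_def abs_decode_def)
qed

text \<open>The parity of a code is the sign of the coded integer, so the parity of the sum is the
  sign of the quotient. A zero denominator gives 0 on both sides.\<close>

lemma nat_to_rat_surj_abs:
  "real_of_rat (nat_to_rat_surj (prod_encode (a, b))) = (if even (a + b) then 1 else - 1) * abs_rat a b"
proof -
  have "real_of_rat (nat_to_rat_surj (prod_encode (a, b))) =
      real_of_int (int_decode a) / real_of_int (int_decode b)"
    by (cases "int_decode b = 0") (simp_all add: nat_to_rat_surj_def of_rat_rat Fract_of_int_quotient of_rat_divide)
  then show ?thesis by (simp add: int_decode_abs abs_rat_def)
qed

lemma abs_decode_pos: "0 < abs_decode b \<longleftrightarrow> 0 < b"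
  by (cases b) (auto simp: abs_decode_def)

lemma sign_mult_pos: "0 < (if P then 1 else - 1) * x \<Longrightarrow> 0 \<le> x \<Longrightarrow> P \<and> x \<noteq> 0" for x :: real
  by (auto split: if_splits)

text \<open>One measure name within the input: \<open>V n\<close> is the measure of set
  \<open>n\<close>, and \<open>s\<close> its list of bounds. Taking \<open>seq_name\<close> at type
  \<open>nat\<close> keeps the alphabet out of the locale.\<close>

locale bound_source =
  fixes c d :: nat and B :: "nat \<Rightarrow> bool" and s :: "nat \<Rightarrow> nat" and V :: "nat \<Rightarrow> real"
  assumes bits: "\<And>j. B (c * j + d) \<longleftrightarrow> seq_name s j = (1 :: nat)"
    and bounds: "range (\<lambda>i. decode_bound (s i)) = {(u, n, v). of_rat u < V n \<and> V n < of_rat v}"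
    and V_nonneg: "\<And>n. 0 \<le> V n"
begin

text \<open>A leading symbol 1 is an empty block, so with it the source is the name of
  \<open>case_nat 0 s\<close>, whose blocks after the first are exactly those of
  \<open>s\<close>.\<close>

lemma source_bit: "source_bit c d B j \<longleftrightarrow> seq_name (case_nat 0 s) j = (1 :: nat)"
proof -
  have b: "block_start (case_nat 0 s) (Suc k) = Suc (block_start s k)" for k
    by (induction k) auto
  have "Suc j = block_start s (Suc k) \<longleftrightarrow> Suc (Suc j) = block_start (case_nat 0 s) (Suc (Suc k))" for j k
    unfolding b by simp
  moreover have "Suc (Suc j) \<noteq> block_start (case_nat 0 s) (Suc 0)" for j by simp
  ultimately have "seq_name s j = (1 :: nat) \<longleftrightarrow> seq_name (case_nat 0 s) (Suc j) = (1 :: nat)" for j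
    unfolding seq_name_eq_1 by (metis not0_implies_Suc)
  moreover have "seq_name (case_nat 0 s) 0 = (1 :: nat)"
    unfolding seq_name_eq_1 by (intro exI[of _ 0]) simp
  ultimately show ?thesis unfolding source_bit_def using bits by (cases j) auto
qed

lemma listed_iff: "(\<exists>m. listed c d B m v) \<longleftrightarrow> v \<in> range s"
proof -
  have "(\<exists>m. listed c d B m v) \<longleftrightarrow> (\<exists>i. source_bit c d B i \<and>
      (\<forall>k<v. \<not> source_bit c d B (i + 1 + k)) \<and> source_bit c d B (i + 1 + v))"
  proof
    assume "\<exists>i. source_bit c d B i \<and>
      (\<forall>k<v. \<not> source_bit c d B (i + 1 + k)) \<and> source_bit c d B (i + 1 + v)"
    then obtain i where "source_bit c d B i" "\<forall>k<v. \<not> source_bit c d B (i + 1 + k)"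
      "source_bit c d B (i + 1 + v)" by blast
    then have "listed c d B (4 * (i + v + 1) + 2) v"
      unfolding listed_def by (intro exI[of _ i]) auto
    then show "\<exists>m. listed c d B m v" by blast
  qed (auto simp only: listed_def)
  also have "\<dots> \<longleftrightarrow> (\<exists>n>0. case_nat 0 s n = v)"
    unfolding source_bit by (rule seq_name_pattern)
  also have "\<dots> \<longleftrightarrow> v \<in> range s"
    by (auto simp: gr0_conv_Suc)
  finally show ?thesis .
qed

lemma listed_mono: "listed c d B m v \<Longrightarrow> m \<le> m' \<Longrightarrow> listed c d B m' v"
  unfolding listed_def by (meson order_less_le_trans)

lemma eventually_listed: "v \<in> range s \<Longrightarrow> \<forall>\<^sub>F m in sequentially. listed c d B m v"
  using listed_iff listed_mono unfolding eventually_sequentially by blast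

lemma listed_bounds:
  assumes "listed c d B m (prod_encode (u, prod_encode (e, v)))"
  shows "of_rat (nat_to_rat_surj u) < V e \<and> V e < of_rat (nat_to_rat_surj v)"
proof -
  have "prod_encode (u, prod_encode (e, v)) \<in> range s" using listed_iff assms by blast
  then obtain i where "s i = prod_encode (u, prod_encode (e, v))" by (metis rangeE)
  then have "decode_bound (s i) = (nat_to_rat_surj u, e, nat_to_rat_surj v)"
    by (simp add: decode_bound_def)
  then have "(nat_to_rat_surj u, e, nat_to_rat_surj v) \<in> range (\<lambda>i. decode_bound (s i))"
    by (metis rangeI)
  then show ?thesis unfolding bounds by simp
qed

lemma obtain_listed:
  assumes "of_rat u < V e" "V e < of_rat v"
  obtains x y where "nat_to_rat_surj x = u" "nat_to_rat_surj y = v"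
    "\<forall>\<^sub>F m in sequentially. listed c d B m (prod_encode (x, prod_encode (e, y)))"
proof -
  have "(u, e, v) \<in> range (\<lambda>i. decode_bound (s i))" unfolding bounds using assms by simp
  then obtain i where i: "decode_bound (s i) = (u, e, v)" by (metis rangeE)
  define x y where "x = fst (prod_decode (s i))" and "y = snd (prod_decode (snd (prod_decode (s i))))"
  have xy: "nat_to_rat_surj x = u" "fst (prod_decode (snd (prod_decode (s i)))) = e" "nat_to_rat_surj y = v"
    using i by (auto simp: decode_bound_def x_def y_def split: prod.splits)
  then have "prod_encode (x, prod_encode (e, y)) = s i"
    unfolding x_def y_def by (metis prod.collapse prod_decode_inverse)
  then show thesis using that xy eventually_listed by (metis rangeI)
qed

section \<open>Soundness and completeness of the counts\<close>

lemma lower_test_sound: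
  assumes "lower_test c d B m a b e D t"
  shows "real (Suc t) \<le> abs_rat a b * V e * D"
proof -
  obtain u1 u2 v where l: "listed c d B m (prod_encode (prod_encode (u1, u2), prod_encode (e, v)))"
    and *: "even (u1 + u2)" "0 < u2" "0 < b"
    "Suc t * (abs_decode b * abs_decode u2) \<le> abs_decode a * abs_decode u1 * D"
    using assms unfolding lower_test_def by blast
  have u: "abs_rat u1 u2 < V e" using listed_bounds[OF l] *(1) by (simp add: nat_to_rat_surj_abs)
  have pos: "0 < real (abs_decode b)" "0 < real (abs_decode u2)" using *(2,3) abs_decode_pos by simp_all
  have "real (Suc t * (abs_decode b * abs_decode u2)) \<le> real (abs_decode a * abs_decode u1 * D)"
    using *(4) by (rule of_nat_mono)
  then have "real (Suc t) \<le> abs_rat a b * abs_rat u1 u2 * D"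
    using pos by (simp add: abs_rat_def field_simps)
  also have "\<dots> \<le> abs_rat a b * V e * D"
    using u by (intro mult_right_mono mult_left_mono) (auto simp: abs_rat_nonneg)
  finally show ?thesis .
qed

lemma upper_test_sound:
  assumes "upper_test c d B m a b e D t"
  shows "abs_rat a b * V e * D \<le> real t"
proof -
  obtain u v1 v2 where l: "listed c d B m (prod_encode (u, prod_encode (e, prod_encode (v1, v2))))"
    and *: "b = 0 \<or> abs_decode a * abs_decode v1 * D \<le> t * (abs_decode b * abs_decode v2)"
    using assms unfolding upper_test_def by blast
  show ?thesis
  proof (cases "b = 0")
    case True
    then show ?thesis by (simp add: abs_rat_def abs_decode_def)
  next
    case False
    have "V e < (if even (v1 + v2) then 1 else - 1) * abs_rat v1 v2"
      using listed_bounds[OF l] by (simp only: nat_to_rat_surj_abs)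
    \<comment> \<open>An upper bound of the nonnegative \<open>V e\<close> is positive, which is why
      \<open>upper_test\<close> checks neither its sign nor its denominator.\<close>
    then have v: "V e < abs_rat v1 v2" using V_nonneg[of e] abs_rat_nonneg[of v1 v2] by (auto split: if_splits)
    then have "abs_rat v1 v2 \<noteq> 0" using V_nonneg[of e] by auto
    then have pos: "0 < real (abs_decode b)" "0 < real (abs_decode v2)"
      using False abs_decode_pos[of b] by (auto simp: abs_rat_def)
    have "real (abs_decode a * abs_decode v1 * D) \<le> real (t * (abs_decode b * abs_decode v2))"
      using * False by (intro of_nat_mono) simp
    then have "abs_rat a b * abs_rat v1 v2 * D \<le> real t"
      using pos by (simp add: abs_rat_def field_simps)
    moreover have "abs_rat a b * V e * D \<le> abs_rat a b * abs_rat v1 v2 * D"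
      using v by (intro mult_right_mono mult_left_mono) (auto simp: abs_rat_nonneg)
    ultimately show ?thesis by linarith
  qed
qed

lemma lower_le: "real (lower c d B m a b e D) \<le> abs_rat a b * V e * D"
  unfolding lower_def
  by (intro count_le lower_test_sound) (auto simp: abs_rat_nonneg V_nonneg)

lemma lower_le_bound: "lower c d B m a b e D \<le> m"
  unfolding lower_def by (rule order.trans[OF sum_mono[where g = "\<lambda>_. 1"]]) auto

lemma upper_ge: "min (real K) (abs_rat a b * V e * D) \<le> real (upper c d B m K a b e D)"
  unfolding upper_def by (intro count_ge) (use upper_test_sound in force)

text \<open>The strict inequality leaves room for a rational between the threshold and
  \<open>V e\<close>, and every such rational occurs in the list of bounds.\<close>

lemma eventually_lower_test:
  assumes "real (Suc t) < abs_rat a b * V e * D"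
  shows "\<forall>\<^sub>F m in sequentially. lower_test c d B m a b e D t"
proof -
  have nz: "abs_rat a b \<noteq> 0" "D \<noteq> 0" using assms by (cases "abs_rat a b = 0"; cases "D = 0"; simp)+
  then have wD: "0 < abs_rat a b * D" using abs_rat_nonneg[of a b] by simp
  have b: "0 < real (abs_decode b)" using nz by (auto simp: abs_rat_def)
  have "real (Suc t) / (abs_rat a b * D) < V e" using assms wD by (simp add: field_simps)
  then obtain u where u: "real (Suc t) / (abs_rat a b * D) < of_rat u" "of_rat u < V e"
    using of_rat_dense by blast
  obtain v where v: "V e < of_rat v" using of_rat_dense[of "V e" "V e + 1"] by auto
  obtain x y where xy: "nat_to_rat_surj x = u"
    "\<forall>\<^sub>F m in sequentially. listed c d B m (prod_encode (x, prod_encode (e, y)))"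
    using obtain_listed[OF u(2) v] by metis
  obtain u1 u2 where x: "x = prod_encode (u1, u2)" by (metis prod.collapse prod_decode_inverse)
  have "0 < real_of_rat u" using u(1) wD by (smt (verit) divide_nonneg_pos of_nat_0_le_iff)
  then have "0 < (if even (u1 + u2) then 1 else - 1) * abs_rat u1 u2"
    using xy(1) x by (simp only: nat_to_rat_surj_abs[symmetric])
  from sign_mult_pos[OF this abs_rat_nonneg]
  have ev: "even (u1 + u2)" "real_of_rat u = abs_rat u1 u2" "abs_rat u1 u2 \<noteq> 0"
    using nat_to_rat_surj_abs[of u1 u2] xy(1) x by simp_all
  then have u2: "0 < real (abs_decode u2)" by (auto simp: abs_rat_def)
  have "real (Suc t) \<le> abs_rat a b * abs_rat u1 u2 * D"
    using u(1) wD ev(2) by (simp add: field_simps)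
  then have "real (Suc t * (abs_decode b * abs_decode u2)) \<le> real (abs_decode a * abs_decode u1 * D)"
    using b u2 by (simp add: abs_rat_def field_simps)
  then have le: "Suc t * (abs_decode b * abs_decode u2) \<le> abs_decode a * abs_decode u1 * D"
    by (simp only: of_nat_le_iff)
  have "\<forall>\<^sub>F m in sequentially. u1 < m \<and> u2 < m \<and> y < m"
    by (intro eventually_conj eventually_gt_at_top)
  with xy(2) show ?thesis
  proof eventually_elim
    case (elim m)
    then show ?case unfolding lower_test_def
      using x ev(1) le b u2 abs_decode_pos[of b] abs_decode_pos[of u2] by (metis of_nat_0_less_iff)
  qed
qed

lemma eventually_upper_test:
  assumes "abs_rat a b * V e * D < real T"
  shows "\<forall>\<^sub>F m in sequentially. \<forall>t\<ge>T. upper_test c d B m a b e D t"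
proof -
  have "\<exists>v. V e < of_rat v \<and> abs_rat a b * of_rat v * D \<le> real T"
  proof (cases "abs_rat a b * D = 0")
    case True
    then show ?thesis using of_rat_dense[of "V e" "V e + 1"] by auto
  next
    case False
    then have wD: "0 < abs_rat a b * D" using abs_rat_nonneg[of a b] by simp
    then have "V e < real T / (abs_rat a b * D)" using assms by (simp add: field_simps)
    then obtain v where v: "V e < of_rat v" "of_rat v < real T / (abs_rat a b * D)"
      using of_rat_dense by blast
    then have "abs_rat a b * of_rat v * D \<le> real T" using wD by (simp add: field_simps)
    then show ?thesis using v(1) by blast
  qed
  then obtain v where v: "V e < of_rat v" "abs_rat a b * of_rat v * D \<le> real T" by blast
  obtain u where u: "of_rat u < V e" using of_rat_dense[of "V e - 1" "V e"] by auto
  obtain x y where xy: "nat_to_rat_surj y = v"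
    "\<forall>\<^sub>F m in sequentially. listed c d B m (prod_encode (x, prod_encode (e, y)))"
    using obtain_listed[OF u v(1)] by metis
  obtain v1 v2 where y: "y = prod_encode (v1, v2)" by (metis prod.collapse prod_decode_inverse)
  have "0 < real_of_rat v" using v(1) V_nonneg[of e] by linarith
  then have "0 < (if even (v1 + v2) then 1 else - 1) * abs_rat v1 v2"
    using xy(1) y by (simp only: nat_to_rat_surj_abs[symmetric])
  from sign_mult_pos[OF this abs_rat_nonneg] have ev: "real_of_rat v = abs_rat v1 v2" "abs_rat v1 v2 \<noteq> 0"
    using nat_to_rat_surj_abs[of v1 v2] xy(1) y by simp_all
  then have v2: "0 < real (abs_decode v2)" by (auto simp: abs_rat_def)
  have le: "b = 0 \<or> abs_decode a * abs_decode v1 * D \<le> t * (abs_decode b * abs_decode v2)" if "T \<le> t" for t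
  proof (cases "b = 0")
    case False
    then have b: "0 < real (abs_decode b)" using abs_decode_pos[of b] by simp
    have "abs_rat a b * abs_rat v1 v2 * D \<le> real t" using v(2) ev(1) that by simp
    then have "real (abs_decode a * abs_decode v1 * D) \<le> real (t * (abs_decode b * abs_decode v2))"
      using b v2 by (simp add: abs_rat_def field_simps)
    then show ?thesis by (simp only: of_nat_le_iff simp_thms)
  qed simp
  have "\<forall>\<^sub>F m in sequentially. x < m \<and> v1 < m \<and> v2 < m"
    by (intro eventually_conj eventually_gt_at_top)
  with xy(2) show ?thesis
  proof eventually_elim
    case (elim m)
    then show ?case unfolding upper_test_def using y le by blast
  qed
qed

text \<open>Only finitely many thresholds are concerned, so from some stage on all of them pass
  together. Rounding costs at most 1; the constant 2 is generous.\<close>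

lemma eventually_lower_ge: "\<forall>\<^sub>F m in sequentially. abs_rat a b * V e * D - 2 \<le> real (lower c d B m a b e D)"
proof -
  define x where "x = abs_rat a b * V e * D - 1"
  have "finite {t. real t < x}"
    by (rule finite_subset[of _ "{..nat \<lceil>x\<rceil>}"]) (auto, linarith)
  then have "\<forall>\<^sub>F m in sequentially. \<forall>t\<in>{t. real t < x}. lower_test c d B m a b e D t"
    by (intro eventually_ball_finite ballI eventually_lower_test) (auto simp: x_def)
  moreover have "\<forall>\<^sub>F m in sequentially. nat \<lceil>x\<rceil> \<le> m" by (rule eventually_ge_at_top)
  ultimately show ?thesis
  proof eventually_elim
    case (elim m)
    have "min (real m) x \<le> real (lower c d B m a b e D)"
      unfolding lower_def by (intro count_ge) (use elim(1) in auto)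
    moreover have "x \<le> real m" using elim(2) by linarith
    ultimately show ?case by (simp add: x_def)
  qed
qed

text \<open>The stage is uniform in the cap \<open>K\<close>, because \<open>far_test\<close> lets
  the cap grow with \<open>m\<close>.\<close>

lemma eventually_upper_le: "\<forall>\<^sub>F m in sequentially. \<forall>K. real (upper c d B m K a b e D) \<le> abs_rat a b * V e * D + 2"
proof -
  define x where "x = abs_rat a b * V e * D"
  have x: "0 \<le> x" by (simp add: x_def abs_rat_nonneg V_nonneg)
  define T where "T = nat \<lfloor>x\<rfloor> + 1"
  have T: "x < real T" "real T \<le> x + 1" using x unfolding T_def by linarith+
  have "\<forall>\<^sub>F m in sequentially. \<forall>t\<ge>T. upper_test c d B m a b e D t"
    by (rule eventually_upper_test) (use T in \<open>simp add: x_def\<close>)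
  then show ?thesis
  proof eventually_elim
    case (elim m)
    have "upper c d B m K a b e D \<le> T" for K
      unfolding upper_def by (rule count_le_card) (use elim in \<open>meson not_less\<close>)
    then show ?case using T(2) unfolding x_def by (meson add_left_mono one_le_numeral order.trans of_nat_mono)
  qed
qed

end

section \<open>Sums over coded lists\<close>

lemma list_rest_Suc: "list_rest c (Suc k) = list_rest (snd (prod_decode (c - 1))) k"
  by (induction k) (simp_all add: list_rest_def)

text \<open>A list has at most as many entries as its code, so summing up to \<open>c\<close>
  reaches all of them, and the positions past the end contribute 0.\<close>

lemma sum_list_decode:
  fixes f :: "nat \<Rightarrow> 'b::comm_monoid_add"
  shows "(\<Sum>k<c. if list_rest c k = 0 then 0 else f (list_elem c k)) = (\<Sum>x\<leftarrow>list_decode c. f x)"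
proof -
  have rest0: "list_rest 0 k = 0" for k
    by (induction k) (simp_all add: list_rest_def prod_decode_def prod_decode_aux.simps)
  have "(\<Sum>k<l. if list_rest (list_encode xs) k = 0 then 0 else f (list_elem (list_encode xs) k)) = (\<Sum>x\<leftarrow>xs. f x)"
    if "list_encode xs \<le> l" for xs l
    using that
  proof (induction xs arbitrary: l)
    case Nil
    then show ?case by (simp add: rest0)
  next
    case (Cons x xs)
    obtain l' where l': "l = Suc l'" "list_encode xs \<le> l'"
      using Cons.prems le_prod_encode_2[of "list_encode xs" x] by (cases l) auto
    have 0: "list_rest (list_encode (x # xs)) 0 \<noteq> 0" "list_elem (list_encode (x # xs)) 0 = x"
      by (simp_all add: list_rest_def list_elem_def)
    have S: "list_rest (list_encode (x # xs)) (Suc k) = list_rest (list_encode xs) k"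
      "list_elem (list_encode (x # xs)) (Suc k) = list_elem (list_encode xs) k" for k
      by (simp_all add: list_rest_Suc list_elem_def)
    show ?case unfolding l'(1) sum.lessThan_Suc_shift S using 0 Cons.IH[OF l'(2)] by simp
  qed
  from this[of "list_decode c" c, unfolded list_decode_inverse] show ?thesis by simp
qed

lemma length_list_decode: "length (list_decode c) \<le> c"
proof -
  have "length xs \<le> list_encode xs" for xs
  proof (induction xs)
    case (Cons x xs)
    then show ?case using le_prod_encode_2[of "list_encode xs" x] by simp
  qed simp
  from this[of "list_decode c"] show ?thesis by simp
qed

lemma sum_list_ge_diff:
  fixes f g :: "'b \<Rightarrow> real"
  assumes "\<And>x. x \<in> set xs \<Longrightarrow> f x - k \<le> g x"
  shows "sum_list (map f xs) - k * length xs \<le> sum_list (map g xs)"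
  using assms by (induction xs) (auto simp: algebra_simps, fastforce)

lemma real_sum_list: "real (sum_list (map f xs)) = (\<Sum>x\<leftarrow>xs. real (f x))"
  by (induction xs) auto

lemma separated_alt:
  "separated fi B m K c i D a b \<longleftrightarrow>
     2 ^ i * ((\<Sum>x\<leftarrow>list_decode c. upper_term fi B m K x a b D) + upper 4 1 B m K 2 2 a D) + D <
     2 ^ i * ((\<Sum>x\<leftarrow>list_decode c. lower_term fi B m x a b D) + lower 4 1 B m 2 2 b D)"
  unfolding separated_def sum_list_decode[where f = "\<lambda>x. upper_term fi B m K x a b D"]
    sum_list_decode[where f = "\<lambda>x. lower_term fi B m x a b D"] ..

locale density_names = countable_ring_measure \<Omega> R N for \<Omega> :: "'w set" and R N +
  fixes \<alpha> :: "nat \<Rightarrow> 'w set" and fi fd :: "nat \<Rightarrow> nat \<Rightarrow> nat" and M :: "'w measure" and h :: "'w \<Rightarrow> real"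
    and B :: "nat \<Rightarrow> bool" and s1 s2 :: "nat \<Rightarrow> nat"
  assumes alpha: "range \<alpha> = R"
    and fi: "\<And>i j. \<alpha> (fi i j) = \<alpha> i \<inter> \<alpha> j" and fd: "\<And>i j. \<alpha> (fd i j) = \<alpha> i - \<alpha> j"
    and h: "integrable N h" "\<And>E. E \<in> sets N \<Longrightarrow> measure M E = (LINT x|N. indicator E x * h x)"
    and names: "bound_source 2 0 B s1 (\<lambda>n. measure N (\<alpha> n))" "bound_source 4 1 B s2 (\<lambda>n. measure M (\<alpha> n))"
begin

interpretation N: bound_source 2 0 B s1 "\<lambda>n. measure N (\<alpha> n)" by (rule names)
interpretation M: bound_source 4 1 B s2 "\<lambda>n. measure M (\<alpha> n)" by (rule names)

lemma alpha_R: "\<alpha> n \<in> R"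
  using alpha by blast

lemma alpha_sets: "\<alpha> n \<in> sets N"
  using alpha_R by (rule ring_sets)

definition lower_value :: "nat \<Rightarrow> nat \<Rightarrow> nat \<Rightarrow> real" where
  "lower_value x a b = abs_rat (coeff_num x) (coeff_den x) *
     measure N (\<alpha> (fi (snd (prod_decode x)) (if even (coeff_num x + coeff_den x) then a else b)))"

definition upper_value :: "nat \<Rightarrow> nat \<Rightarrow> nat \<Rightarrow> real" where
  "upper_value x a b = abs_rat (coeff_num x) (coeff_den x) *
     measure N (\<alpha> (fi (snd (prod_decode x)) (if even (coeff_num x + coeff_den x) then b else a)))"

lemma value_diff:
  "lower_value x a b - upper_value x a b = of_rat (nat_to_rat_surj (fst (prod_decode x))) *
     (measure N (\<alpha> (snd (prod_decode x)) \<inter> \<alpha> a) - measure N (\<alpha> (snd (prod_decode x)) \<inter> \<alpha> b))"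
proof -
  have "fst (prod_decode x) = prod_encode (coeff_num x, coeff_den x)"
    by (simp add: coeff_num_def coeff_den_def)
  then show ?thesis
    by (simp only: nat_to_rat_surj_abs) (simp add: lower_value_def upper_value_def fi algebra_simps)
qed

text \<open>The exact quantity behind \<open>separated\<close>: by \<open>gap_eq\<close> it is the
  integral of the step function minus \<open>h\<close> over \<open>\<alpha> a\<close>, less that
  over \<open>\<alpha> b\<close>. It is grouped into the nonnegative terms that the test estimates
  from below and from above.\<close>

definition gap :: "nat \<Rightarrow> nat \<Rightarrow> nat \<Rightarrow> real" where
  "gap c a b = (\<Sum>x\<leftarrow>list_decode c. lower_value x a b) + measure M (\<alpha> b) -
     ((\<Sum>x\<leftarrow>list_decode c. upper_value x a b) + measure M (\<alpha> a))"

lemma integral_rsf: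
  assumes "A \<in> sets N"
  shows "(LINT x|N. indicator A x * rsf \<alpha> c x) =
    (\<Sum>x\<leftarrow>list_decode c. of_rat (nat_to_rat_surj (fst (prod_decode x))) * measure N (\<alpha> (snd (prod_decode x)) \<inter> A))"
proof -
  have "integrable N (\<lambda>x. indicator A x * (\<Sum>(a, n)\<leftarrow>map prod_decode xs. of_rat (nat_to_rat_surj a) * indicator (\<alpha> n) x :: real)) \<and>
    (LINT x|N. indicator A x * (\<Sum>(a, n)\<leftarrow>map prod_decode xs. of_rat (nat_to_rat_surj a) * indicator (\<alpha> n) x)) =
    (\<Sum>x\<leftarrow>xs. of_rat (nat_to_rat_surj (fst (prod_decode x))) * measure N (\<alpha> (snd (prod_decode x)) \<inter> A))" for xs
  proof (induction xs)
    case (Cons y xs)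
    obtain a n where y: "prod_decode y = (a, n)" by fastforce
    have int: "integrable N (indicator (\<alpha> n \<inter> A) :: 'w \<Rightarrow> real)"
      using alpha_sets[of n] assms finite_ring[OF alpha_R[of n]] emeasure_mono[of "\<alpha> n \<inter> A" "\<alpha> n" N]
      by (intro integrable_real_indicator) (auto intro: order_le_less_trans)
    have eq: "indicator A x * (\<Sum>(a, n)\<leftarrow>map prod_decode (y # xs). of_rat (nat_to_rat_surj a) * indicator (\<alpha> n) x :: real) =
      of_rat (nat_to_rat_surj a) * indicator (\<alpha> n \<inter> A) x +
      indicator A x * (\<Sum>(a, n)\<leftarrow>map prod_decode xs. of_rat (nat_to_rat_surj a) * indicator (\<alpha> n) x)" for x
      by (simp add: y indicator_inter_arith algebra_simps)
    have "measure N (\<alpha> n \<inter> A) = (LINT x|N. indicator (\<alpha> n \<inter> A) x)"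
      using sets.sets_into_space[OF alpha_sets[of n]] by (simp add: Int_absorb1 inf.absorb1 le_infI1)
    then show ?case unfolding eq using int Cons.IH by (simp add: y)
  qed simp
  then show ?thesis unfolding rsf_def by blast
qed

lemma gap_eq:
  "gap c a b = (LINT x|N. indicator (\<alpha> a) x * (rsf \<alpha> c x - h x)) - (LINT x|N. indicator (\<alpha> b) x * (rsf \<alpha> c x - h x))"
proof -
  have i: "(LINT x|N. indicator A x * (rsf \<alpha> c x - h x)) = (LINT x|N. indicator A x * rsf \<alpha> c x) - measure M A"
    if "A \<in> sets N" for A
    unfolding right_diff_distrib h(2)[OF that]
    by (intro Bochner_Integration.integral_diff integrable_indicator_mult integrable_rsf alpha h(1) that)
  have "(\<Sum>x\<leftarrow>xs. lower_value x a b) - (\<Sum>x\<leftarrow>xs. upper_value x a b) = (\<Sum>x\<leftarrow>xs. lower_value x a b - upper_value x a b)" for xs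
    by (induction xs) auto
  moreover have "(\<Sum>x\<leftarrow>xs. lower_value x a b - upper_value x a b) =
    (\<Sum>x\<leftarrow>xs. of_rat (nat_to_rat_surj (fst (prod_decode x))) * measure N (\<alpha> (snd (prod_decode x)) \<inter> \<alpha> a)) -
    (\<Sum>x\<leftarrow>xs. of_rat (nat_to_rat_surj (fst (prod_decode x))) * measure N (\<alpha> (snd (prod_decode x)) \<inter> \<alpha> b))" for xs
    unfolding value_diff by (induction xs) (auto simp: algebra_simps)
  ultimately show ?thesis
    unfolding gap_def i[OF alpha_sets] integral_rsf[OF alpha_sets] by (simp add: algebra_simps)
qed

text \<open>The integer 1 has code 2, so the pair \<open>2 2\<close> in \<open>separated\<close> is
  the coefficient 1 of the measure \<open>M\<close>.\<close>

lemma abs_rat_2: "abs_rat 2 2 = 1"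
  by (simp add: abs_rat_def abs_decode_def)

text \<open>An upper count equal to the cap says nothing about the measure. But all lower counts
  together are at most the cap, so the strict inequality forces every upper count below it, where it
  is a genuine upper estimate.\<close>

lemma separated_sound:
  assumes sep: "separated fi B m (Suc c * m) c i D a b"
  shows "1 / 2 ^ i < gap c a b"
proof -
  define K where "K = Suc c * m"
  define xs where "xs = list_decode c"
  define l u where "l x = lower_term fi B m x a b D" and "u x = upper_term fi B m K x a b D" for x
  define l' u' where "l' = lower 4 1 B m 2 2 b D" and "u' = upper 4 1 B m K 2 2 a D"
  have sep': "2 ^ i * (sum_list (map u xs) + u') + D < 2 ^ i * (sum_list (map l xs) + l')"
    using sep unfolding separated_alt xs_def l_def u_def l'_def u'_def K_def .
  have l: "real (l x) \<le> lower_value x a b * D" for x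
    unfolding l_def lower_term_def lower_value_def by (rule N.lower_le)
  have l': "real l' \<le> measure M (\<alpha> b) * D"
    using M.lower_le[of m 2 2 b D] by (simp add: l'_def abs_rat_2)
  have u: "min (real K) (upper_value x a b * D) \<le> real (u x)" for x
    unfolding u_def upper_term_def upper_value_def by (rule N.upper_ge)
  have u': "min (real K) (measure M (\<alpha> a) * D) \<le> real u'"
    using M.upper_ge[of K 2 2 a D m] by (simp add: u'_def abs_rat_2)
  have "l x \<le> m" for x unfolding l_def lower_term_def by (rule N.lower_le_bound)
  then have "sum_list (map l xs) \<le> length xs * m"
    using sum_list_mono[of xs l "\<lambda>_. m"] by (simp add: sum_list_triv)
  also have "\<dots> \<le> c * m" using length_list_decode[of c] by (simp add: xs_def)
  finally have "sum_list (map l xs) + l' \<le> K"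
    using M.lower_le_bound[of m 2 2 b D] by (simp add: K_def l'_def)
  then have "2 ^ i * (sum_list (map l xs) + l') \<le> 2 ^ i * K" by (rule mult_le_mono2)
  then have "2 ^ i * (sum_list (map u xs) + u') < 2 ^ i * K" using sep' by linarith
  then have less: "sum_list (map u xs) + u' < K" by simp
  then have uK: "u x < K" if "x \<in> set xs" for x
    using member_le_sum_list[of "u x" "map u xs"] that by force
  then have u2: "upper_value x a b * D \<le> real (u x)" if "x \<in> set xs" for x
    using u[of x] uK[OF that] by (simp add: min_def split: if_splits)
  have u2': "measure M (\<alpha> a) * D \<le> real u'" using u' less by (simp add: min_def split: if_splits)
  have su: "(\<Sum>x\<leftarrow>xs. upper_value x a b) * D \<le> real (sum_list (map u xs))"
    using sum_list_mono[of xs "\<lambda>x. upper_value x a b * D" "\<lambda>x. real (u x)"] u2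
    by (simp add: sum_list_mult_const real_sum_list)
  have sl: "real (sum_list (map l xs)) \<le> (\<Sum>x\<leftarrow>xs. lower_value x a b) * D"
    using sum_list_mono[of xs "\<lambda>x. real (l x)" "\<lambda>x. lower_value x a b * D"] l
    by (simp add: sum_list_mult_const real_sum_list)
  have "real (2 ^ i * (sum_list (map u xs) + u') + D) < real (2 ^ i * (sum_list (map l xs) + l'))"
    using sep' by (simp only: of_nat_less_iff)
  then have 1: "2 ^ i * (real (sum_list (map u xs)) + real u') + real D < 2 ^ i * (real (sum_list (map l xs)) + real l')"
    by simp
  have "2 ^ i * ((\<Sum>x\<leftarrow>xs. upper_value x a b) * D + measure M (\<alpha> a) * D) + real D \<le>
      2 ^ i * (real (sum_list (map u xs)) + real u') + real D"
    using su u2' by (intro add_mono mult_left_mono) auto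
  also note 1
  also have "2 ^ i * (real (sum_list (map l xs)) + real l') \<le>
      2 ^ i * ((\<Sum>x\<leftarrow>xs. lower_value x a b) * D + measure M (\<alpha> b) * D)"
    using sl l' by (intro mult_left_mono add_mono) auto
  finally have 2: "real D < 2 ^ i * gap c a b * D" by (simp add: gap_def xs_def algebra_simps)
  then have "D \<noteq> 0" by (intro notI) simp
  then have "1 < 2 ^ i * gap c a b" using 2 by (simp add: mult_less_cancel_right1)
  then show ?thesis by (simp add: field_simps)
qed

lemma separated_complete:
  assumes gap: "1 / 2 ^ i < gap c a b"
  shows "\<exists>D. \<forall>\<^sub>F m in sequentially. \<forall>K. separated fi B m K c i D a b"
proof -
  define xs where "xs = list_decode c"
  have "0 < 2 ^ i * gap c a b - 1" using gap by (simp add: field_simps)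
  \<comment> \<open>Each of the \<open>length xs + 1\<close> terms on either side is off by at most
    2, which makes \<open>4 * (length xs + 1)\<close> in total; the surplus of the gap, magnified by
    \<open>D\<close>, has to exceed this error.\<close>
  then obtain D where D: "2 ^ i * (4 * (real (length xs) + 1)) < real D * (2 ^ i * gap c a b - 1)"
    using ex_less_of_nat_mult by blast
  have "\<forall>\<^sub>F m in sequentially. \<forall>x\<in>set xs. lower_value x a b * D - 2 \<le> real (lower_term fi B m x a b D)"
    unfolding lower_term_def lower_value_def by (intro eventually_ball_finite ballI N.eventually_lower_ge) auto
  moreover have "\<forall>\<^sub>F m in sequentially. \<forall>x\<in>set xs. \<forall>K. real (upper_term fi B m K x a b D) \<le> upper_value x a b * D + 2"
    unfolding upper_term_def upper_value_def by (intro eventually_ball_finite ballI N.eventually_upper_le) auto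
  moreover have "\<forall>\<^sub>F m in sequentially. measure M (\<alpha> b) * D - 2 \<le> real (lower 4 1 B m 2 2 b D)"
    using M.eventually_lower_ge[of 2 2 b D] by (simp add: abs_rat_2)
  moreover have "\<forall>\<^sub>F m in sequentially. \<forall>K. real (upper 4 1 B m K 2 2 a D) \<le> measure M (\<alpha> a) * D + 2"
    using M.eventually_upper_le[of 2 2 a D] by (simp add: abs_rat_2)
  ultimately have "\<forall>\<^sub>F m in sequentially. \<forall>K. separated fi B m K c i D a b"
  proof eventually_elim
    case (elim m)
    show ?case
    proof
      fix K
      define l u where "l x = lower_term fi B m x a b D" and "u x = upper_term fi B m K x a b D" for x
      define l' u' where "l' = lower 4 1 B m 2 2 b D" and "u' = upper 4 1 B m K 2 2 a D"
      have sl: "(\<Sum>x\<leftarrow>xs. lower_value x a b) * D - 2 * length xs \<le> real (sum_list (map l xs))"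
        using sum_list_ge_diff[of xs "\<lambda>x. lower_value x a b * D" 2 "\<lambda>x. real (l x)"] elim(1)
        by (simp add: sum_list_mult_const real_sum_list l_def)
      have "real (sum_list (map u xs)) - 2 * length xs \<le> (\<Sum>x\<leftarrow>xs. upper_value x a b) * D"
        using sum_list_ge_diff[of xs "\<lambda>x. real (u x)" 2 "\<lambda>x. upper_value x a b * D"] elim(2)
        by (simp add: sum_list_mult_const real_sum_list u_def diff_le_eq)
      then have su: "real (sum_list (map u xs)) \<le> (\<Sum>x\<leftarrow>xs. upper_value x a b) * D + 2 * length xs" by simp
      have "2 ^ i * (real (sum_list (map u xs)) + real u') + real D \<le>
          2 ^ i * (((\<Sum>x\<leftarrow>xs. upper_value x a b) * D + 2 * length xs) + (measure M (\<alpha> a) * D + 2)) + real D"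
        using su elim(4) by (intro add_mono mult_left_mono) (auto simp: u'_def)
      also have "\<dots> < 2 ^ i * (((\<Sum>x\<leftarrow>xs. lower_value x a b) * D - 2 * length xs) + (measure M (\<alpha> b) * D - 2))"
        using D by (simp add: gap_def xs_def algebra_simps)
      also have "\<dots> \<le> 2 ^ i * (real (sum_list (map l xs)) + real l')"
        using sl elim(3) by (intro mult_left_mono add_mono) (auto simp: l'_def)
      finally have "real (2 ^ i * (sum_list (map u xs) + u') + D) < real (2 ^ i * (sum_list (map l xs) + l'))"
        by simp
      then have "2 ^ i * (sum_list (map u xs) + u') + D < 2 ^ i * (sum_list (map l xs) + l')"
        by (simp only: of_nat_less_iff)
      then show "separated fi B m K c i D a b"
        unfolding separated_alt xs_def l_def u_def l'_def u'_def .
    qed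
  qed
  then show ?thesis ..
qed

text \<open>The strict inequality is what makes being far enumerable. One direction uses that
  \<open>\<alpha> a\<close> and \<open>\<alpha> (fd b a)\<close> are disjoint, so the gap cannot
  exceed the norm; for the other, ring sets come close to the norm, and a large \<open>m\<close>
  admits their indices together with \<open>D\<close>.\<close>

theorem far_test_iff:
  "(\<exists>m. far_test fi fd B (prod_encode (c, i)) m) \<longleftrightarrow> 1 / 2 ^ i < (LINT x|N. \<bar>rsf \<alpha> c x - h x\<bar>)"
proof
  assume "\<exists>m. far_test fi fd B (prod_encode (c, i)) m"
  then obtain m D a b where "separated fi B m (Suc c * m) c i D a (fd b a)"
    unfolding far_test_def by auto
  then have "1 / 2 ^ i < gap c a (fd b a)" by (rule separated_sound)
  also have "\<dots> \<le> (LINT x|N. \<bar>rsf \<alpha> c x - h x\<bar>)"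
    unfolding gap_eq
    by (intro integral_abs_ge Bochner_Integration.integrable_diff integrable_rsf alpha h(1) alpha_sets) (auto simp: fd)
  finally show "1 / 2 ^ i < (LINT x|N. \<bar>rsf \<alpha> c x - h x\<bar>)" .
next
  assume far: "1 / 2 ^ i < (LINT x|N. \<bar>rsf \<alpha> c x - h x\<bar>)"
  have "integrable N (\<lambda>x. rsf \<alpha> c x - h x)"
    by (intro Bochner_Integration.integrable_diff integrable_rsf alpha h(1))
  from integral_abs_approx[OF this far] obtain A C where AC: "A \<in> R" "C \<in> R"
    "1 / 2 ^ i < (LINT x|N. indicator A x * (rsf \<alpha> c x - h x)) - (LINT x|N. indicator (C - A) x * (rsf \<alpha> c x - h x))"
    by blast
  obtain a b where ab: "A = \<alpha> a" "C = \<alpha> b" using AC(1,2) alpha by (metis rangeE)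
  have "1 / 2 ^ i < gap c a (fd b a)" using AC(3) unfolding gap_eq fd ab .
  then obtain D where "\<forall>\<^sub>F m in sequentially. \<forall>K. separated fi B m K c i D a (fd b a)"
    using separated_complete by blast
  then have "\<forall>\<^sub>F m in sequentially. (\<forall>K. separated fi B m K c i D a (fd b a)) \<and> D < m \<and> a < m \<and> b < m"
    by (intro eventually_conj eventually_gt_at_top)
  from eventually_happens'[OF sequentially_bot this]
  obtain m where m: "\<forall>K. separated fi B m K c i D a (fd b a)" "D < m" "a < m" "b < m"
    by (elim exE conjE)
  have "separated fi B m (Suc c * m) c i D a (fd b a)" using m(1) by (rule spec)
  then have "far_test fi fd B (prod_encode (c, i)) m"
    unfolding far_test_def prod_encode_inverse fst_conv snd_conv
    by - (rule exI[of _ D], rule conjI[OF m(2)], rule exI[of _ a], rule conjI[OF m(3)], rule exI[of _ b], rule conjI[OF m(4)])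
  then show "\<exists>m. far_test fi fd B (prod_encode (c, i)) m" ..
qed

end

section \<open>The reduction\<close>

lemma bound_source_rep_M:
  assumes \<mu>: "\<mu> \<in> rep_M \<Omega> \<A> \<R> \<alpha> p"
    and B: "\<And>j. B (c * j + d) \<longleftrightarrow> p j = (1 :: 'a::zero_neq_one)"
  shows "\<exists>s. bound_source c d B s (\<lambda>n. measure \<mu> (\<alpha> n))"
proof -
  obtain s where s: "p = seq_name s" "range (\<lambda>i. decode_bound (s i)) =
      {(u, n, v). of_rat u < measure \<mu> (\<alpha> n) \<and> measure \<mu> (\<alpha> n) < of_rat v}"
    using \<mu> unfolding rep_M_def by blast
  have "bound_source c d B s (\<lambda>n. measure \<mu> (\<alpha> n))"
  proof
    show "B (c * j + d) \<longleftrightarrow> seq_name s j = (1 :: nat)" for j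
      unfolding B s(1) seq_name_eq_1 ..
  qed (use s(2) in auto)
  then show ?thesis by blast
qed

theorem theorem1:
  fixes \<Omega> :: "'w set" and \<A> \<R> :: "'w set set" and \<alpha> :: "nat \<Rightarrow> 'w set"
  assumes "computable_measurable_space \<Omega> \<A> \<R> \<alpha>"
  shows "RN \<Omega> \<A> \<R> \<alpha> \<le>\<^sub>W (EC :: ('a::{finite, zero_neq_one}, _) multirep \<times> _)"
proof -
  have ring: "ring_of_sets \<Omega> \<R>" "countable \<R>" "\<Union>\<R> = \<Omega>" and A: "\<A> = sigma_sets \<Omega> \<R>"
    and alpha: "range \<alpha> = \<R>"
    using assms by (simp_all add: computable_measurable_space_def)
  obtain fi where fi: "recursive2 fi" "\<And>i j. \<alpha> (fi i j) = \<alpha> i \<inter> \<alpha> j"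
    using assms unfolding computable_measurable_space_def by (elim conjE exE) blast
  obtain fd where fd: "recursive2 fd" "\<And>i j. \<alpha> (fd i j) = \<alpha> i - \<alpha> j"
    using assms unfolding computable_measurable_space_def by (elim conjE exE) blast
  obtain FH :: "'a name list \<rightharpoonup> 'a name" where FH: "t2_computable 1 FH"
    "\<And>p. \<exists>q. FH [p] = Some q \<and> {n. \<exists>m. far_test fi fd (\<lambda>j. p j = 1) n m} \<in> En q"
    by (rule enumerator[of "far_test fi fd", OF rec_pred_far_test[OF fi(1) fd(1)] far_test_cong not_far_test_0]) blast+
  obtain FK :: "'a name list \<rightharpoonup> 'a name" where FK: "t2_computable 2 FK"
    "\<And>p q. (\<And>k. \<exists>c i. k \<le> i \<and> q (prod_encode (c, i)) \<noteq> 1) \<Longrightarrow>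
      \<exists>s. FK [p, q] = Some (seq_name s) \<and> (\<forall>k. \<exists>i\<ge>k. q (prod_encode (s k, i)) \<noteq> 1)"
    by (rule scanner) blast
  define H where "H p = FH [p]" for p
  define K where "K p q = FK [p, q]" for p q
  show ?thesis
    unfolding weihrauch_le_def
  proof (intro exI[of _ K] exI[of _ H] conjI allI impI)
    have "FK ps = K (ps ! 0) (ps ! 1)" if "length ps = 2" for ps
      using that by (auto simp: K_def length_Suc_conv numeral_2_eq_2)
    then show "t2_computable 2 (\<lambda>ps. K (ps ! 0) (ps ! 1))"
      using FK(1) unfolding t2_computable_def by (metis (no_types, lifting))
    have "FH ps = H (ps ! 0)" if "length ps = 1" for ps
      using that by (auto simp: H_def length_Suc_conv)
    then show "t2_computable 1 (\<lambda>ps. H (ps ! 0))"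
      using FH(1) unfolding t2_computable_def by (metis (no_types, lifting))
  next
    fix G :: "'a name \<rightharpoonup> 'a name" assume G: "realizes G EC"
    show "realizes (\<lambda>p. Option.bind (H p) (\<lambda>q. Option.bind (G q) (K p))) (RN \<Omega> \<A> \<R> \<alpha>)"
      unfolding realizes_def RN_def prod.case
    proof (intro allI impI)
      fix p :: "'a name" and x y
      assume xy: "x \<in> prod_rep (rep_M \<Omega> \<A> \<R> \<alpha>) (rep_M_fin \<Omega> \<A> \<R> \<alpha>) p \<and> RN_fun \<Omega> \<A> \<R> x = Some y"
      obtain \<nu> \<mu> where x: "x = (\<nu>, \<mu>)" by fastforce
      from xy x obtain p1 p2 where p: "p = name_pair p1 p2" "\<nu> \<in> rep_M \<Omega> \<A> \<R> \<alpha> p1" "\<mu> \<in> rep_M_fin \<Omega> \<A> \<R> \<alpha> p2"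
        by (auto simp: prod_rep_def)
      obtain p3 p4 where p2: "p2 = name_pair p3 p4" "\<mu> \<in> rep_M \<Omega> \<A> \<R> \<alpha> p3"
        using p(3) unfolding rep_M_fin_def by blast
      have RN: "\<nu> \<in> ring_finite_measures \<Omega> \<A> \<R>" "\<mu> \<in> finite_measures \<Omega> \<A>" "absolutely_continuous \<nu> \<mu>"
        and y: "y = (\<nu>, THE h. h \<in> L1 \<nu> \<and> (\<forall>E\<in>\<A>. \<forall>f\<in>h. measure \<mu> E = (LINT x:E|\<nu>. f x)))"
        using xy x by (auto simp: RN_fun_def split: if_splits)
      interpret countable_ring_measure \<Omega> \<R> \<nu>
        by (rule countable_ring_measure.intro) (use ring RN(1) A in \<open>simp_all add: ring_finite_measures_def\<close>)
      have \<mu>: "finite_measure \<mu>" "sets \<mu> = sets \<nu>"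
        using RN(2) A sets_N by (auto simp: finite_measures_def intro!: finite_measureI)
      obtain f :: "'w \<Rightarrow> real" where f: "integrable \<nu> f"
        "\<And>E. E \<in> sets \<nu> \<Longrightarrow> measure \<mu> E = (LINT x|\<nu>. indicator E x * f x)"
        by (rule finite_measure_density_exists[OF \<mu> RN(3)]) (rule that; simp)
      have y': "y = (\<nu>, L1_class \<nu> f)" unfolding y A using The_density[OF f] by simp
      define B where "B j \<longleftrightarrow> p j = 1" for j
      have "\<exists>s. bound_source 2 0 B s (\<lambda>n. measure \<nu> (\<alpha> n))"
        by (rule bound_source_rep_M[OF p(2)]) (simp add: B_def p(1) name_pair_def)
      moreover have "\<exists>s. bound_source 4 1 B s (\<lambda>n. measure \<mu> (\<alpha> n))"
      proof (rule bound_source_rep_M[OF p2(2)])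
        fix j :: nat
        have "(4 * j + 1) div 2 = 2 * j" by presburger
        then show "B (4 * j + 1) \<longleftrightarrow> p3 j = 1" by (simp add: B_def p(1) p2(1) name_pair_def)
      qed
      ultimately obtain s1 s2 where names: "bound_source 2 0 B s1 (\<lambda>n. measure \<nu> (\<alpha> n))"
        "bound_source 4 1 B s2 (\<lambda>n. measure \<mu> (\<alpha> n))" by blast
      interpret density_names \<Omega> \<R> \<nu> \<alpha> fi fd \<mu> f B s1 s2
        by (intro density_names.intro density_names_axioms.intro)
          (rule countable_ring_measure_axioms alpha fi(2) fd(2) f(1) names | erule f(2))+
      obtain q where q: "H p = Some q" "{n. \<exists>m. far_test fi fd (\<lambda>j. p j = 1) n m} \<in> En q"
        using FH(2) unfolding H_def by blast
      then obtain r where r: "G q = Some r" "{n. \<exists>m. far_test fi fd B n m} \<in> Cf r"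
        using G unfolding realizes_def EC_def B_def[abs_def] by blast
      \<comment> \<open>\<open>Cf\<close> only fixes where \<open>r\<close> has the symbol 1; all
        other symbols mean that the function is close.\<close>
      have bit: "r (prod_encode (c, i)) \<noteq> 1 \<longleftrightarrow> (LINT x|\<nu>. \<bar>rsf \<alpha> c x - f x\<bar>) \<le> 1 / 2 ^ i" for c i
        using r(2) far_test_iff[of c i] by (auto simp: Cf_def set_eq_iff not_less)
      \<comment> \<open>Density supplies a close step function for every precision, so the scan
        never runs dry.\<close>
      have "\<exists>c i. k \<le> i \<and> r (prod_encode (c, i)) \<noteq> 1" for k
        using rsf_dense[OF alpha f(1), of "1 / 2 ^ k"] unfolding bit
        by (meson less_imp_le order.refl zero_less_divide_1_iff zero_less_power zero_less_numeral)
      then obtain s where s: "K p r = Some (seq_name s)" "\<forall>k. \<exists>i\<ge>k. r (prod_encode (s k, i)) \<noteq> 1"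
        using FK(2) unfolding K_def by blast
      have close: "(LINT x|\<nu>. \<bar>rsf \<alpha> (s k) x - f x\<bar>) \<le> 1 / 2 ^ k" for k
      proof -
        obtain i where "k \<le> i" "(LINT x|\<nu>. \<bar>rsf \<alpha> (s k) x - f x\<bar>) \<le> 1 / 2 ^ i"
          using s(2) unfolding bit by blast
        moreover have "(1 :: real) / 2 ^ i \<le> 1 / 2 ^ k"
          using \<open>k \<le> i\<close> by (intro divide_left_mono power_increasing) auto
        ultimately show ?thesis by linarith
      qed
      \<comment> \<open>The representation demands the estimate for every member of the class, and
        members differ from \<open>f\<close> only on a null set.\<close>
      have "(LINT x|\<nu>. \<bar>rsf \<alpha> (s k) x - g x\<bar>) \<le> 1 / 2 ^ k" if "g \<in> L1_class \<nu> f" for k g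
      proof -
        have g: "integrable \<nu> g" "AE x in \<nu>. g x = f x" using that by (auto simp: L1_class_def)
        have "(LINT x|\<nu>. \<bar>rsf \<alpha> (s k) x - g x\<bar>) = (LINT x|\<nu>. \<bar>rsf \<alpha> (s k) x - f x\<bar>)"
          using g integrable_rsf[OF alpha] f(1) by (intro integral_cong_AE) auto
        then show ?thesis using close by simp
      qed
      moreover have "L1_class \<nu> f \<in> L1 \<nu>" using f(1) by (auto simp: L1_def)
      ultimately have "y \<in> rep_L1_union \<Omega> \<A> \<R> \<alpha> (seq_name s :: 'a name)"
        unfolding y' rep_L1_union_def rep_L1_def using RN(1) by blast
      then show "\<exists>q. Option.bind (H p) (\<lambda>q. Option.bind (G q) (K p)) = Some q \<and> y \<in> rep_L1_union \<Omega> \<A> \<R> \<alpha> q"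
        using q(1) r(1) s(1) by simp
    qed
  qed
qed

end
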